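(* Let $k=\mathbb{F}_q$ be a finite field of odd characteristic and let $L$ be a finite-dimensional nilpotent Lie algebra over $k$ with $Z(L)\subseteq L'$ and $\dim L'=4$. Then $w(L)\neq L'$ if and only if one of the following holds: \begin{itemize} \item $L$ is $4$-step nilpotent with $\dim L=6$ and $\dim Z(L)=2$; \item $L$ is $3$-step nilpotent with $\dim L=7$ and $\dim Z(L)=3$; \item $L$ is $2$-step nilpotent with $\dim L=8$ and one of the following holds: \begin{itemize} \item the breadth type of $L$ is $(0,1,3)$ or $(0,1,2,3)$; \item the breadth type of $L$ is $(0,2,3)$ and $L$ does not possess any generating set $\{u_1,u_2,u_3,u_4\}$ such that $[u_1,u_2]=0=[u_3,u_4]$. \end{itemize} \end{itemize} Further, if $w(L)\neq L'$, then each element of $L'$ is a sum of at most two elements of $w(L)$.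
   Context: $L'=[L,L]$ is the derived subalgebra (linear span of all brackets) and $Z(L)$ is the center of $L$. A nonzero multilinear Lie polynomial of degree $2$ over $k$ is $w(x,y)=c[x,y]$ with $0\neq c\in k$, and $w(L)=\{w(x,y):x,y\in L\}=\{[x,y]:x,y\in L\}$ is its image. Put $L^0=L$, $L^1=L'$, $L^i=[L,L^{i-1}]$; $L$ is $n$-step nilpotent if $L^n=0$ and $L^{n-1}\neq 0$ (so a nonzero abelian Lie algebra is $1$-step nilpotent). The breadth $b(x)$ of $x\in L$ is the rank of $\operatorname{ad}x\colon L\to L$, $y\mapsto[x,y]$. The breadth type of $L$ is the tuple, in increasing order, of all distinct values $b(x)$, $x\in L$. A generating set is a set generating $L$ as a Lie algebra. *)

theory Defs
  imports Complex_Main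
begin

locale lie_algebra = vector_space scale
  for scale :: "'k::field \<Rightarrow> 'v::ab_group_add \<Rightarrow> 'v" (infixr \<open>*s\<close> 75) +
  fixes bracket :: "'v \<Rightarrow> 'v \<Rightarrow> 'v"
  assumes bracket_add_left: "bracket (x + y) z = bracket x z + bracket y z"
    and bracket_add_right: "bracket x (y + z) = bracket x y + bracket x z"
    and bracket_scale_left: "bracket (a *s x) y = a *s bracket x y"
    and bracket_scale_right: "bracket x (a *s y) = a *s bracket x y"
    and bracket_self: "bracket x x = 0"
    and jacobi: "bracket x (bracket y z) + bracket y (bracket z x) + bracket z (bracket x y) = 0"
begin

definition bracket_space :: "'v set \<Rightarrow> 'v set \<Rightarrow> 'v set" where
  "bracket_space A B = span {bracket x y | x y. x \<in> A \<and> y \<in> B}"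

definition derived :: "'v set" where
  "derived = bracket_space UNIV UNIV"

definition center :: "'v set" where
  "center = {z. \<forall>x. bracket z x = 0}"

text \<open>Indexing starts at \<open>lower_central 0 = L\<close>, so that \<open>lower_central 1\<close> is the derived subalgebra.\<close>

primrec lower_central :: "nat \<Rightarrow> 'v set" where
  "lower_central 0 = UNIV"
| "lower_central (Suc i) = bracket_space UNIV (lower_central i)"

definition nilpotent :: bool where
  "nilpotent \<longleftrightarrow> (\<exists>n. lower_central n = {0})"

text \<open>The condition \<open>n \<ge> 1\<close> guards against truncated subtraction at \<open>n = 0\<close>.\<close>

definition step_nilpotent :: "nat \<Rightarrow> bool" where
  "step_nilpotent n \<longleftrightarrow> n \<ge> 1 \<and> lower_central n = {0} \<and> lower_central (n - 1) \<noteq> {0}"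

definition breadth :: "'v \<Rightarrow> nat" where
  "breadth x = dim (range (bracket x))"

text \<open>Meaningful when the set of breadths is finite, in particular in finite dimension.\<close>

definition breadth_type :: "nat list" where
  "breadth_type = sorted_list_of_set (range breadth)"

definition subalgebra :: "'v set \<Rightarrow> bool" where
  "subalgebra S \<longleftrightarrow> subspace S \<and> (\<forall>x\<in>S. \<forall>y\<in>S. bracket x y \<in> S)"

definition generating_set :: "'v set \<Rightarrow> bool" where
  "generating_set S \<longleftrightarrow> subalgebra hull S = UNIV"

text \<open>The nonzero multilinear Lie polynomials of degree 2, as maps \<open>L \<times> L \<rightarrow> L\<close>.\<close>

definition multilinear_lie_poly2 :: "('v \<Rightarrow> 'v \<Rightarrow> 'v) \<Rightarrow> bool" where
  "multilinear_lie_poly2 w \<longleftrightarrow> (\<exists>c. c \<noteq> 0 \<and> (\<forall>x y. w x y = c *s bracket x y))"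

end

definition poly_image :: "('v \<Rightarrow> 'v \<Rightarrow> 'v) \<Rightarrow> 'v set" where
  "poly_image w = {w x y | x y. True}"

end

theory Submission
  imports Defs "HOL-Library.Function_Algebras" "HOL-Library.Cardinality" "HOL-Library.Product_Plus"
begin

text \<open>
  Let \<open>z \<in> L'\<close> and let \<open>A\<close>, \<open>H\<close> be the sets of alternating forms \<open>f \<circ> [\<cdot>,\<cdot>]\<close> with \<open>f\<close> a functional
  on \<open>L'\<close> such that \<open>f z = 1\<close>, respectively \<open>f z = 0\<close>. Separating \<open>z\<close> from the subspace \<open>[x,L]\<close> shows that \<open>z\<close>
  is not a commutator iff every \<open>x\<close> lies in the radical of some form in \<open>A\<close>. Counting incidences
  then gives \<open>A\<close> many forms of rank two, and looking at which of them differ by a form of rank two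
  contradicts this as soon as \<open>dim L/Z(L) \<ge> 5\<close>.

  If \<open>dim L/Z(L) = 4\<close>, then \<open>L' = \<Lambda>\<^sup>2(L/Z(L)) / K\<close> with \<open>dim K = 2\<close>, and the commutators are the images of
  the points of the Klein quadric. They fill \<open>L'\<close> iff the restriction to \<open>K\<close> of the Klein quadratic
  form is nondegenerate. The Jacobi identity forces degeneracy when \<open>dim Z(L)\<close> is 2 or 3, and for
  \<open>Z(L) = L'\<close> the isometry type of \<open>K\<close> is read off from the breadths and from commuting pairs.
\<close>

section \<open>Alternating forms of rank two\<close>

text \<open>The count gives \<open>RA\<close> more members than one form and its neighbours, so two
  members differ by a form of rank four. Their radicals meet in codimension at most 4, so dim L/Z(L)
  \<ge> 5 leaves a noncentral x annihilated by both. Fixing x reduces the problem to the values of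
  forms at x, which for \<open>H\<close> fill a space of dimension 1 or 2. The margins are thin: at
  q = 3 one case is decided by a single form, hence the strict version of the count.

  For dim L/Z(L) = 4 the kernel K is a plane because 6 - 4 = 2. An element of L' lifts to a coset of
  K and is a commutator iff the Klein form has a zero on that coset, where it is a quadratic
  polynomial in two variables. If K is hyperbolic, the equation can be made linear; if K is
  anisotropic, completing and counting squares gives a zero. If K is degenerate, the polynomial can
  be a nonzero constant (rank 0) or of the shape n - t^2 with n a nonsquare (rank 1). Odd
  characteristic serves both the completion of squares and the choice of n.\<close>

locale finite_scalars = vector_space scale
  for scale :: "'k::{field,finite} \<Rightarrow> 'v::ab_group_add \<Rightarrow> 'v" (infixr \<open>*s\<close> 75)
begin

lemma card_span_insert:
  assumes S: "subspace S" "finite S" and x: "x \<notin> S"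
  shows "finite (span (insert x S))" "card (span (insert x S)) = CARD('k) * card S"
proof -
  let ?f = "\<lambda>(c, y). c *s x + y"
  have eq: "span (insert x S) = ?f ` (UNIV \<times> S)"
  proof (intro equalityI subsetI)
    fix v assume "v \<in> span (insert x S)"
    then obtain c where "v - c *s x \<in> span S" by (auto simp: span_insert)
    then have "v - c *s x \<in> S" using S by (metis span_eq_iff)
    then show "v \<in> ?f ` (UNIV \<times> S)"
      by (intro image_eqI[where x = "(c, v - c *s x)"]) auto
  next
    fix v assume "v \<in> ?f ` (UNIV \<times> S)"
    then show "v \<in> span (insert x S)"
      by (auto intro!: span_add span_scale intro: span_base)
  qed
  have inj: "inj_on ?f (UNIV \<times> S)"
  proof (rule inj_onI, clarify)
    fix c y d z
    assume y: "y \<in> S" and z: "z \<in> S" and e: "c *s x + y = d *s x + z"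
    have "(c - d) *s x = z - y"
      using e by (simp add: scale_left_diff_distrib algebra_simps)
    then have in_S: "(c - d) *s x \<in> S" using S y z by (simp add: subspace_diff)
    have "c = d"
    proof (rule ccontr)
      assume "c \<noteq> d"
      then have "x = inverse (c - d) *s ((c - d) *s x)" by simp
      then show False using in_S S x by (metis subspace_scale)
    qed
    then show "c = d \<and> y = z" using e by simp
  qed
  show "finite (span (insert x S))" using eq S by simp
  show "card (span (insert x S)) = CARD('k) * card S"
    using eq inj by (simp add: card_image card_cartesian_product)
qed

lemma card_proper_subspace:
  assumes "subspace S" "subspace T" "S \<subset> T" "finite T"
  shows "CARD('k) * card S \<le> card T"
proof -
  obtain x where x: "x \<in> T" "x \<notin> S" using assms by auto
  have "span (insert x S) \<subseteq> T" using x assms by (intro span_minimal) auto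
  then have "card (span (insert x S)) \<le> card T" using assms by (intro card_mono)
  then show ?thesis
    using card_span_insert(2)[of S x] assms x by (metis finite_subset psubset_imp_subset)
qed

lemma card_span_independent:
  assumes "finite B" "independent B"
  shows "finite (span B) \<and> card (span B) = CARD('k) ^ card B"
  using assms
proof (induction B rule: finite_induct)
  case (insert x B)
  have i: "independent B" "x \<notin> span B"
    using insert by (simp_all add: independent_insert)
  have "span (insert x B) = span (insert x (span B))"
    by (metis span_insert span_span)
  then show ?case
    using card_span_insert[of "span B" x] insert i by simp
qed simp

lemma card_subspace:
  assumes "subspace S" "finite S"
  shows "card S = CARD('k) ^ dim S"
proof -
  obtain B where B: "B \<subseteq> S" "independent B" "S \<subseteq> span B" "card B = dim S"
    using basis_exists by blast
  have "span B = S" using B assms by (metis span_subspace)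
  then show ?thesis
    using card_span_independent[of B] B assms by (metis finite_subset)
qed

end

text \<open>The fibres are translates of the kernel. Stated for additive maps, so that one count
  serves forms, functionals, vectors and coordinate tuples, where it takes the place of
  rank-nullity.\<close>

lemma card_additive_kernel:
  fixes h :: "'a::ab_group_add \<Rightarrow> 'b::ab_group_add"
  assumes fin: "finite S" and zero: "0 \<in> S" and diff: "\<And>x y. x \<in> S \<Longrightarrow> y \<in> S \<Longrightarrow> x - y \<in> S"
    and h: "\<And>x y. x \<in> S \<Longrightarrow> y \<in> S \<Longrightarrow> h (x - y) = h x - h y"
  shows "card S = card {x \<in> S. h x = 0} * card (h ` S)"
proof -
  have add: "x + y \<in> S" if "x \<in> S" "y \<in> S" for x y
    using diff[OF that(1) diff[OF zero that(2)]] by simp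
  have fib: "card {x \<in> S. h x = y} = card {x \<in> S. h x = 0}" if y: "y \<in> h ` S" for y
  proof -
    obtain a where a: "a \<in> S" "h a = y" using y by auto
    have "bij_betw (\<lambda>x. x - a) {x \<in> S. h x = y} {x \<in> S. h x = 0}"
    proof (rule bij_betw_byWitness[where f' = "\<lambda>x. x + a"])
      show "(\<lambda>x. x - a) ` {x \<in> S. h x = y} \<subseteq> {x \<in> S. h x = 0}"
        using a diff h by auto
      have "h (x + a) = y" if "x \<in> S" "h x = 0" for x
        using h[OF add[OF that(1) a(1)] a(1)] that a by simp
      then show "(\<lambda>x. x + a) ` {x \<in> S. h x = 0} \<subseteq> {x \<in> S. h x = y}"
        using a add by auto
    qed auto
    then show ?thesis by (rule bij_betw_same_card)
  qed
  have "card S = (\<Sum>y\<in>h ` S. card {x \<in> S. h x = y})"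
    using sum.image_gen[OF fin, of "\<lambda>_. 1::nat" h] by simp
  then show ?thesis using fib by simp
qed

section \<open>Bilinear forms and the Pluecker relation\<close>

definition fscale :: "'k::times \<Rightarrow> ('v \<Rightarrow> 'v \<Rightarrow> 'k) \<Rightarrow> 'v \<Rightarrow> 'v \<Rightarrow> 'k" where
  "fscale c \<phi> = (\<lambda>x y. c * \<phi> x y)"

lemma fscale_apply [simp]: "fscale c \<phi> x y = c * \<phi> x y"
  by (simp add: fscale_def)

interpretation fs: finite_scalars "fscale :: 'k::{field,finite} \<Rightarrow> ('v \<Rightarrow> 'v \<Rightarrow> 'k) \<Rightarrow> _"
  by unfold_locales (auto simp: fun_eq_iff algebra_simps)

text \<open>For alternating \<open>\<phi>\<close> this is the Pfaffian of its Gram matrix on four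
  vectors.\<close>

definition pluecker :: "('v \<Rightarrow> 'v \<Rightarrow> 'k::field) \<Rightarrow> 'v \<Rightarrow> 'v \<Rightarrow> 'v \<Rightarrow> 'v \<Rightarrow> 'k" where
  "pluecker \<phi> x y z w = \<phi> x y * \<phi> z w - \<phi> x z * \<phi> y w + \<phi> x w * \<phi> y z"

text \<open>The polarization of \<open>pluecker\<close>, that is, its mixed term on a combination of
  two forms.\<close>

definition polar :: "('v \<Rightarrow> 'v \<Rightarrow> 'k::field) \<Rightarrow> ('v \<Rightarrow> 'v \<Rightarrow> 'k) \<Rightarrow> 'v \<Rightarrow> 'v \<Rightarrow> 'v \<Rightarrow> 'v \<Rightarrow> 'k" where
  "polar \<phi> \<psi> x y z w = \<phi> x y * \<psi> z w + \<psi> x y * \<phi> z w - \<phi> x z * \<psi> y w - \<psi> x z * \<phi> y w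
     + \<phi> x w * \<psi> y z + \<psi> x w * \<phi> y z"

text \<open>The zero form counts as decomposable; otherwise the condition says that \<open>\<phi>\<close> has rank two.\<close>

definition decomposable :: "('v \<Rightarrow> 'v \<Rightarrow> 'k::field) \<Rightarrow> bool" where
  "decomposable \<phi> \<longleftrightarrow> (\<forall>x y z w. pluecker \<phi> x y z w = 0)"

lemma pluecker_combination:
  "pluecker (fscale a \<phi> + fscale b \<psi>) x y z w
    = a * a * pluecker \<phi> x y z w + a * b * polar \<phi> \<psi> x y z w + b * b * pluecker \<psi> x y z w"
  unfolding pluecker_def polar_def by (simp add: algebra_simps)

text \<open>A line through two points of a quadric lies inside it or meets it in no third
  point.\<close>

lemma decomposable_combination:
  assumes "decomposable \<phi>" "decomposable \<psi>"
  shows "decomposable (fscale a \<phi> + fscale b \<psi>)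
    \<longleftrightarrow> a = 0 \<or> b = 0 \<or> (\<forall>x y z w. polar \<phi> \<psi> x y z w = 0)"
  using assms by (auto simp: decomposable_def pluecker_combination)

lemma decomposable_diff:
  assumes "decomposable \<phi>" "decomposable \<psi>"
  shows "decomposable (\<phi> - \<psi>) \<longleftrightarrow> (\<forall>x y z w. polar \<phi> \<psi> x y z w = 0)"
proof -
  have "\<phi> - \<psi> = fscale 1 \<phi> + fscale (-1) \<psi>" by (simp add: fun_eq_iff)
  then show ?thesis using decomposable_combination[OF assms, of 1 "-1"] by simp
qed

lemma decomposable_combination_diff:
  assumes "decomposable \<phi>" "decomposable \<psi>" "\<not> decomposable (\<phi> - \<psi>)"
    and "decomposable (fscale a \<phi> + fscale b \<psi>)"
  shows "a = 0 \<or> b = 0"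
  using assms decomposable_combination decomposable_diff by metis

lemma decomposable_fscale: "decomposable \<phi> \<Longrightarrow> decomposable (fscale c \<phi>)"
  using pluecker_combination[of c \<phi> 0 \<phi>] by (auto simp: decomposable_def pluecker_def)

text \<open>The exterior products with \<open>g\<close>. The second factor is an arbitrary function,
  so a witness needs no linearity check. The set is a linear space consisting of decomposable forms,
  which is how forms are recognized as neighbours later.\<close>

definition multiples :: "('v \<Rightarrow> 'k::field) \<Rightarrow> ('v \<Rightarrow> 'v \<Rightarrow> 'k) set" where
  "multiples g = {\<phi>. \<exists>h. \<phi> = (\<lambda>z w. g z * h w - g w * h z)}"

lemma subspace_multiples: "fs.subspace (multiples (g :: 'v \<Rightarrow> 'k::{field,finite}))"
proof (rule fs.subspaceI)
  show "0 \<in> multiples g"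
    unfolding multiples_def by (auto simp: fun_eq_iff intro: exI[where x = 0])
  fix \<phi> \<psi> and c :: 'k assume p: "\<phi> \<in> multiples g" 
  then obtain h where h: "\<phi> = (\<lambda>z w. g z * h w - g w * h z)" unfolding multiples_def by auto
  show "fscale c \<phi> \<in> multiples g"
    unfolding multiples_def
    by (rule CollectI, rule exI[where x = "\<lambda>z. c * h z"]) (simp add: h fun_eq_iff algebra_simps)
  assume "\<psi> \<in> multiples g"
  then obtain h' where h': "\<psi> = (\<lambda>z w. g z * h' w - g w * h' z)" unfolding multiples_def by auto
  show "\<phi> + \<psi> \<in> multiples g"
    unfolding multiples_def
    by (rule CollectI, rule exI[where x = "\<lambda>z. h z + h' z"]) (simp add: h h' fun_eq_iff algebra_simps)
qed

lemma decomposable_multiples: "\<phi> \<in> multiples g \<Longrightarrow> decomposable \<phi>"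
  unfolding multiples_def decomposable_def pluecker_def by (auto simp: algebra_simps)

text \<open>The Pluecker relation solved for \<open>\<phi> z w\<close>: a hyperbolic pair exhibits
  \<open>\<phi>\<close> as the product of the two functionals \<open>\<phi> a\<close> and
  \<open>\<phi> b\<close>.\<close>

lemma decomposable_expand:
  assumes "decomposable \<phi>" "\<phi> a b = 1"
  shows "\<phi> = (\<lambda>z w. \<phi> a z * \<phi> b w - \<phi> a w * \<phi> b z)"
proof (intro ext)
  fix z w
  have "pluecker \<phi> a b z w = 0" using assms by (simp add: decomposable_def)
  then show "\<phi> z w = \<phi> a z * \<phi> b w - \<phi> a w * \<phi> b z"
    using assms unfolding pluecker_def by (simp add: algebra_simps eq_neg_iff_add_eq_0)
qed

lemma multiples_fscale:
  assumes "\<And>y. g' y = c * g y" "\<phi> \<in> multiples g'"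
  shows "\<phi> \<in> multiples g"
proof -
  obtain h where "\<phi> = (\<lambda>z w. g' z * h w - g' w * h z)" using assms unfolding multiples_def by auto
  then have "\<phi> = (\<lambda>z w. g z * (c * h w) - g w * (c * h z))"
    by (simp add: assms fun_eq_iff algebra_simps)
  then show ?thesis unfolding multiples_def by auto
qed

text \<open>Contraction with \<open>x\<close> gives a factor: the other one is
  \<open>\<phi> y\<close>, suitably scaled, for any \<open>y\<close> with \<open>\<phi> x y\<close>
  nonzero.\<close>

lemma decomposable_in_multiples:
  assumes d: "decomposable \<phi>" and "\<phi> x \<noteq> 0"
  shows "\<phi> \<in> multiples (\<phi> x)"
proof -
  obtain y where y: "\<phi> x y \<noteq> 0" using assms by (auto simp: fun_eq_iff)
  have e: "\<phi> x y * \<phi> z w = \<phi> x z * \<phi> y w - \<phi> x w * \<phi> y z" for z w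
  proof -
    have "pluecker \<phi> x y z w = 0" using d by (simp add: decomposable_def)
    then show ?thesis unfolding pluecker_def by (simp add: algebra_simps eq_neg_iff_add_eq_0)
  qed
  have "\<phi> = (\<lambda>z w. \<phi> x z * (\<phi> y w / \<phi> x y) - \<phi> x w * (\<phi> y z / \<phi> x y))"
    using e y by (auto simp: fun_eq_iff field_simps)
  then show ?thesis unfolding multiples_def by (intro CollectI exI)
qed

definition radical :: "('v \<Rightarrow> 'v \<Rightarrow> 'k::zero) \<Rightarrow> 'v set" where
  "radical \<phi> = {x. \<phi> x = 0}"

section \<open>Alternating forms and the size of their radicals\<close>

context finite_scalars begin

definition alternating_form :: "('v \<Rightarrow> 'v \<Rightarrow> 'k) \<Rightarrow> bool" where
  "alternating_form \<phi> \<longleftrightarrow> (\<forall>x y z. \<phi> (x + y) z = \<phi> x z + \<phi> y z) \<and> (\<forall>x y z. \<phi> x (y + z) = \<phi> x y + \<phi> x z)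
    \<and> (\<forall>c x y. \<phi> (c *s x) y = c * \<phi> x y) \<and> (\<forall>c x y. \<phi> x (c *s y) = c * \<phi> x y) \<and> (\<forall>x. \<phi> x x = 0)"

lemma alternating_formD:
  assumes "alternating_form \<phi>"
  shows "\<phi> (x + y) z = \<phi> x z + \<phi> y z" "\<phi> x (y + z) = \<phi> x y + \<phi> x z"
    "\<phi> (c *s x) y = c * \<phi> x y" "\<phi> x (c *s y) = c * \<phi> x y" "\<phi> x x = 0"
    "\<phi> (x - y) z = \<phi> x z - \<phi> y z" "\<phi> x (y - z) = \<phi> x y - \<phi> x z"
    "\<phi> x 0 = 0" "\<phi> 0 x = 0"
proof -
  show p: "\<phi> (x + y) z = \<phi> x z + \<phi> y z" "\<phi> x (y + z) = \<phi> x y + \<phi> x z"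
    "\<phi> (c *s x) y = c * \<phi> x y" "\<phi> x (c *s y) = c * \<phi> x y" "\<phi> x x = 0" for x y z c
    using assms by (auto simp: alternating_form_def)
  show "\<phi> (x - y) z = \<phi> x z - \<phi> y z" by (metis p(1) add_diff_cancel_right' diff_add_cancel)
  show "\<phi> x (y - z) = \<phi> x y - \<phi> x z" by (metis p(2) add_diff_cancel_right' diff_add_cancel)
  show "\<phi> x 0 = 0" by (metis p(4) mult_zero_left scale_zero_left)
  show "\<phi> 0 x = 0" by (metis p(3) mult_zero_left scale_zero_left)
qed

lemma alternating_form_skew:
  assumes "alternating_form \<phi>"
  shows "\<phi> y x = - \<phi> x y"
proof -
  have "\<phi> (x + y) (x + y) = \<phi> y x + \<phi> x y"
    unfolding alternating_formD(1,2)[OF assms] by (simp add: alternating_formD(5)[OF assms])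
  then show ?thesis using alternating_formD(5)[OF assms] by (simp add: eq_neg_iff_add_eq_0)
qed

lemma alternating_form_unit:
  assumes "alternating_form \<phi>" "\<phi> \<noteq> 0"
  obtains a b where "\<phi> a b = 1"
proof -
  obtain a b where ab: "\<phi> a b \<noteq> 0" using assms by (auto simp: fun_eq_iff)
  have "\<phi> (inverse (\<phi> a b) *s a) b = 1" using ab assms by (simp add: alternating_formD)
  then show ?thesis by (rule that)
qed

lemma card_functional_kernel:
  fixes h :: "'v \<Rightarrow> 'k"
  assumes "finite S" "subspace S" "\<And>x y. h (x - y) = h x - h y"
  shows "card S \<le> CARD('k) * card {x \<in> S. h x = 0}"
proof -
  have "card S = card {x \<in> S. h x = 0} * card (h ` S)"
    using assms by (intro card_additive_kernel) (auto intro: subspace_diff subspace_0)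
  moreover have "card (h ` S) \<le> CARD('k)" by (intro card_mono) auto
  ultimately show ?thesis by (simp add: mult.commute)
qed

text \<open>A hyperbolic pair spans a plane meeting the radical in 0; the coordinates are read off
  by pairing with \<open>a\<close> and \<open>b\<close>.\<close>

lemma card_radical_le2:
  assumes fin: "finite (UNIV :: 'v set)" and f: "alternating_form \<phi>" "\<phi> \<noteq> 0"
  shows "card (radical \<phi>) * CARD('k)\<^sup>2 \<le> card (UNIV :: 'v set)"
proof -
  obtain a b where ab: "\<phi> a b = 1" using alternating_form_unit[OF f] .
  have ba: "\<phi> b a = -1" using alternating_form_skew[OF f(1), of b a] ab by simp
  let ?g = "\<lambda>(r, s, t). r + s *s a + t *s b"
  have r0: "\<phi> v r = 0" if "r \<in> radical \<phi>" for r v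
    using that alternating_form_skew[OF f(1), of v r] by (simp add: radical_def)
  have key: "r = r' \<and> s = s' \<and> t = t'"
    if r: "r \<in> radical \<phi>" "r' \<in> radical \<phi>" and e: "r + s *s a + t *s b = r' + s' *s a + t' *s b"
    for r r' s s' t t'
  proof -
    have "\<phi> a (r + s *s a + t *s b) = \<phi> a (r' + s' *s a + t' *s b)"
      "\<phi> b (r + s *s a + t *s b) = \<phi> b (r' + s' *s a + t' *s b)" using e by simp_all
    then have "t = t' \<and> s = s'" using ab ba r by (simp add: alternating_formD[OF f(1)] r0)
    then show ?thesis using e by simp
  qed
  have "inj_on ?g (radical \<phi> \<times> UNIV \<times> UNIV)"
    unfolding inj_on_def using key by clarsimp
  then have "card (radical \<phi> \<times> (UNIV :: 'k set) \<times> (UNIV :: 'k set)) \<le> card (UNIV :: 'v set)"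
    using fin by (intro card_inj_on_le) auto
  then show ?thesis by (simp add: card_cartesian_product power2_eq_square)
qed

text \<open>A form that is not the product of \<open>\<phi> a\<close> and \<open>\<phi> b\<close>
  has a second hyperbolic pair orthogonal to \<open>a\<close> and \<open>b\<close>. The four vectors
  are independent modulo the radical.\<close>

lemma card_radical_le4:
  assumes fin: "finite (UNIV :: 'v set)" and f: "alternating_form \<phi>" "\<not> decomposable \<phi>"
  shows "card (radical \<phi>) * CARD('k) ^ 4 \<le> card (UNIV :: 'v set)"
proof -
  note af = alternating_formD[OF f(1)] and skew = alternating_form_skew[OF f(1)]
  have "\<phi> \<noteq> 0" using f by (auto simp: decomposable_def pluecker_def)
  then obtain a b where ab: "\<phi> a b = 1" using alternating_form_unit[OF f(1)] by blast
  have ba: "\<phi> b a = -1" using skew[of b a] ab by simp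
  obtain z w where zw: "\<phi> z w \<noteq> \<phi> a z * \<phi> b w - \<phi> a w * \<phi> b z"
  proof (rule ccontr)
    assume "\<not> thesis"
    then have "\<phi> z w = \<phi> a z * \<phi> b w - \<phi> a w * \<phi> b z" for z w using that by blast
    then have "\<phi> \<in> multiples (\<phi> a)" unfolding multiples_def by (intro CollectI exI[where x = "\<phi> b"] ext)
    then show False using f(2) decomposable_multiples by blast
  qed
  \<comment> \<open>Remove from \<open>z\<close> and \<open>w\<close> their components along
    \<open>a\<close> and \<open>b\<close>. The form then takes on the remainders the value by which
    the product expansion fails at \<open>z\<close>, \<open>w\<close>.\<close>
  define u0 where "u0 = z + \<phi> b z *s a - \<phi> a z *s b"
  define v where "v = w + \<phi> b w *s a - \<phi> a w *s b"
  have uv0: "\<phi> a u0 = 0" "\<phi> b u0 = 0" "\<phi> a v = 0" "\<phi> b v = 0"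
    by (simp_all add: u0_def v_def af ab ba)
  have "\<phi> u0 v = \<phi> z v" by (simp add: u0_def af uv0)
  also have "\<dots> = \<phi> z w - (\<phi> a z * \<phi> b w - \<phi> a w * \<phi> b z)"
    using skew[of a z] skew[of b z] by (simp add: v_def af)
  finally have nz: "\<phi> u0 v \<noteq> 0" using zw by simp
  define u where "u = inverse (\<phi> u0 v) *s u0"
  have uv: "\<phi> u v = 1" "\<phi> a u = 0" "\<phi> b u = 0" using nz uv0 by (simp_all add: u_def af(3,4))
  have vu: "\<phi> v u = -1" "\<phi> u a = 0" "\<phi> u b = 0" "\<phi> v a = 0" "\<phi> v b = 0"
    using skew[of v u] skew[of u a] skew[of u b] skew[of v a] skew[of v b] uv uv0 by simp_all
  let ?g = "\<lambda>(r, s, t, s', t'). r + s *s a + t *s b + s' *s u + t' *s v"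
  have r0: "\<phi> v r = 0" if "r \<in> radical \<phi>" for r v
    using that skew[of v r] by (simp add: radical_def)
  have key: "r = r' \<and> s = s' \<and> t = t' \<and> s1 = s1' \<and> t1 = t1'"
    if r: "r \<in> radical \<phi>" "r' \<in> radical \<phi>"
      and e: "r + s *s a + t *s b + s1 *s u + t1 *s v = r' + s' *s a + t' *s b + s1' *s u + t1' *s v"
    for r r' s s' t t' s1 s1' t1 t1'
  proof -
    have "\<phi> x (r + s *s a + t *s b + s1 *s u + t1 *s v)
        = \<phi> x (r' + s' *s a + t' *s b + s1' *s u + t1' *s v)" for x using e by simp
    from this[of a] this[of b] this[of u] this[of v] have "t = t' \<and> s = s' \<and> t1 = t1' \<and> s1 = s1'"
      using ab ba uv uv0 vu r by (simp add: af r0)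
    then show ?thesis using e by simp
  qed
  have "inj_on ?g (radical \<phi> \<times> UNIV \<times> UNIV \<times> UNIV \<times> UNIV)"
    unfolding inj_on_def using key by clarsimp
  then have "card (radical \<phi> \<times> (UNIV :: 'k set) \<times> (UNIV :: 'k set) \<times> (UNIV :: 'k set) \<times> (UNIV :: 'k set))
      \<le> card (UNIV :: 'v set)"
    using fin by (intro card_inj_on_le) auto
  then show ?thesis by (simp add: card_cartesian_product power4_eq_xxxx)
qed

lemma subspace_radical: "alternating_form \<phi> \<Longrightarrow> subspace (radical \<phi>)"
  by (rule subspaceI) (auto simp: radical_def fun_eq_iff alternating_formD)

text \<open>By \<open>decomposable_expand\<close> the radical is the common kernel of two
  functionals, and each of them cuts the size by a factor of at most q.\<close>

lemma card_inter_radical: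
  assumes fin: "finite S" "subspace S" and f: "alternating_form \<phi>" "decomposable \<phi>" 
  shows "card S \<le> CARD('k)\<^sup>2 * card (S \<inter> radical \<phi>)"
proof (cases "\<phi> = 0")
  case True
  then have "S \<inter> radical \<phi> = S" by (auto simp: radical_def)
  then show ?thesis by simp
next
  case False
  then obtain a b where ab: "\<phi> a b = 1" using alternating_form_unit f by blast
  note af = alternating_formD[OF f(1)] and skew = alternating_form_skew[OF f(1)]
  define S1 where "S1 = {x \<in> S. \<phi> a x = 0}"
  have S1: "finite S1" "subspace S1"
    using fin by (simp_all add: S1_def subspace_def af)
  have "card S \<le> CARD('k) * card S1"
    unfolding S1_def using fin by (intro card_functional_kernel) (auto simp: af)
  also have "card S1 \<le> CARD('k) * card {x \<in> S1. \<phi> b x = 0}"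
    using S1 by (intro card_functional_kernel) (auto simp: af)
  also have "{x \<in> S1. \<phi> b x = 0} = S \<inter> radical \<phi>"
  proof -
    have "\<phi> x = 0 \<longleftrightarrow> \<phi> a x = 0 \<and> \<phi> b x = 0" for x
    proof
      assume "\<phi> x = 0"
      then show "\<phi> a x = 0 \<and> \<phi> b x = 0" using skew[of a x] skew[of b x] by simp
    next
      assume "\<phi> a x = 0 \<and> \<phi> b x = 0"
      then show "\<phi> x = 0" using fun_cong[OF decomposable_expand[OF f(2) ab], of x] by (simp add: fun_eq_iff)
    qed
    then show ?thesis by (auto simp: S1_def radical_def)
  qed
  finally show ?thesis by (simp add: power2_eq_square)
qed

end

text \<open>Here n is \<open>card RA\<close> and m is \<open>card RH\<close>. The hypothesis asks
  for (q^2 - 1) n \<ge> q^4 - q^3 + q^2 m, and n = q^2 - q + m falls short of this by q^2 - q + m.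
  Both sides are kept free of subtraction.\<close>

lemma rank_two_count_lower:
  fixes q n m :: nat
  assumes "q ^ 4 + q\<^sup>2 * m + n \<le> q\<^sup>2 * n + q ^ 3" "3 \<le> q"
  shows "q\<^sup>2 + 1 + m \<le> n + q"
proof (rule ccontr)
  assume "\<not> ?thesis"
  then have "int n \<le> int q * int q - int q + int m" by (simp add: power2_eq_square flip: of_nat_mult of_nat_add of_nat_diff)
  moreover have q: "int q \<ge> 3" using assms by simp
  then have "1 * 1 \<le> int q * int q" by (intro mult_mono) auto
  then have "0 \<le> int q * int q - 1" by simp
  ultimately have "(int q * int q - 1) * int n \<le> (int q * int q - 1) * (int q * int q - int q + int m)"
    by (rule mult_left_mono)
  moreover have "int q ^ 4 + (int q)\<^sup>2 * int m + int n \<le> (int q)\<^sup>2 * int n + int q ^ 3"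
    using assms(1) by (metis of_nat_add of_nat_mult of_nat_power zle_int)
  moreover have "int q * int q > int q" using q by simp
  ultimately show False
    by (simp add: algebra_simps power2_eq_square power3_eq_cube power4_eq_xxxx)
qed

text \<open>At n = q^2 - q + 1 + m the product (q^2 - 1) n exceeds q^4 - q^3 + q^2 m by q - 1 - m,
  which the last hypothesis makes nonpositive, against the strict inequality.\<close>

lemma rank_two_count_lower_strict:
  fixes q n m :: nat
  assumes "q ^ 4 + q\<^sup>2 * m + n < q\<^sup>2 * n + q ^ 3" "3 \<le> q" "q \<le> m + 1"
  shows "q\<^sup>2 + 2 + m \<le> n + q"
proof (rule ccontr)
  assume "\<not> ?thesis"
  then have "int n \<le> int q * int q - int q + 1 + int m" by (simp add: power2_eq_square flip: of_nat_mult of_nat_add of_nat_diff)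
  moreover have q: "int q \<ge> 3" using assms by simp
  then have "1 * 1 \<le> int q * int q" by (intro mult_mono) auto
  then have "0 \<le> int q * int q - 1" by simp
  ultimately have "(int q * int q - 1) * int n \<le> (int q * int q - 1) * (int q * int q - int q + 1 + int m)"
    by (rule mult_left_mono)
  moreover have "int q ^ 4 + (int q)\<^sup>2 * int m + int n < (int q)\<^sup>2 * int n + int q ^ 3"
    using assms(1) by (metis of_nat_add of_nat_mult of_nat_power of_nat_less_iff)
  moreover have "int q * int q > int q" using q by simp
  moreover have "int q \<le> int m + 1" using assms(3) by simp
  ultimately show False
    by (simp add: algebra_simps power2_eq_square power3_eq_cube power4_eq_xxxx)
qed

section \<open>Spaces of forms whose radicals cover\<close>

text \<open>Abstracts a non-commutator z: \<open>H\<close> stands for the forms of functionals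
  killing z, a space of dimension dim L' - 1 = 3, and \<open>\<phi>0\<close> for a functional with
  value 1 at z. \<open>cover\<close> says that z lies in no [x,L].\<close>

locale covering_forms = finite_scalars scale
  for scale :: "'k::{field,finite} \<Rightarrow> 'v::ab_group_add \<Rightarrow> 'v" (infixr \<open>*s\<close> 75) +
  fixes H :: "('v \<Rightarrow> 'v \<Rightarrow> 'k) set" and \<phi>0 :: "'v \<Rightarrow> 'v \<Rightarrow> 'k"
  assumes finite_UNIV: "finite (UNIV :: 'v set)"
    and subspace_H: "fs.subspace H"
    and form_H: "\<phi> \<in> H \<Longrightarrow> alternating_form \<phi>"
    and form_\<phi>0: "alternating_form \<phi>0"
    and \<phi>0_notin: "\<phi>0 \<notin> H"
    and card_H: "card H = CARD('k) ^ 3"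
    and cover: "\<exists>\<phi>. \<phi> - \<phi>0 \<in> H \<and> \<phi> x = 0"
    and card_k: "3 \<le> CARD('k)"
begin

definition A where "A = {\<phi>. \<phi> - \<phi>0 \<in> H}"
text \<open>For distinct \<open>\<phi>, \<psi> \<in> RA\<close> the difference lies in \<open>RH\<close> precisely when the supports of \<open>\<phi>\<close> and \<open>\<psi>\<close>,
  two planes in the dual space, meet nontrivially; we call such forms neighbours.\<close>

definition RA where "RA = {\<phi> \<in> A. decomposable \<phi>}"
definition RH where "RH = {\<phi> \<in> H. decomposable \<phi> \<and> \<phi> \<noteq> 0}"

lemma finite_H: "finite H"
  using card_H by (metis card.infinite power_eq_0_iff zero_less_card_finite less_numeral_extra(3))

lemma A_eq: "A = (\<lambda>\<phi>. \<phi> + \<phi>0) ` H"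
  unfolding A_def by (auto intro: image_eqI[where x = "_ - \<phi>0"])

lemma finite_A: "finite A" and card_A: "card A = CARD('k) ^ 3"
  by (simp_all add: A_eq finite_H card_image inj_on_def card_H)

lemma finite_RA: "finite RA" and finite_RH: "finite RH"
  by (simp_all add: RA_def RH_def finite_A finite_H)

lemma A_diff: "\<phi> \<in> A \<Longrightarrow> \<psi> \<in> A \<Longrightarrow> \<phi> - \<psi> \<in> H"
  using fs.subspace_diff[OF subspace_H, of "\<phi> - \<phi>0" "\<psi> - \<phi>0"] by (simp add: A_def)

lemma A_add: "\<phi> \<in> A \<Longrightarrow> \<eta> \<in> H \<Longrightarrow> \<phi> + \<eta> \<in> A"
  using fs.subspace_add[OF subspace_H, of "\<phi> - \<phi>0" "\<eta>"] by (simp add: A_def algebra_simps)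

lemma A_line:
  assumes "\<phi> \<in> A" "\<psi> \<in> A" "a + b = 1"
  shows "fscale a \<phi> + fscale b \<psi> \<in> A"
proof -
  have "fscale a \<phi> + fscale b \<psi> = \<phi> + fscale b (\<psi> - \<phi>)"
    using assms(3) by (auto simp: fun_eq_iff algebra_simps eq_diff_eq simp flip: distrib_right)
  then show ?thesis
    using A_add[OF assms(1) fs.subspace_scale[OF subspace_H A_diff[OF assms(2,1)]]] by simp
qed

lemma zero_notin_A: "0 \<notin> A"
  using fs.subspace_neg[OF subspace_H, of "0 - \<phi>0"] \<phi>0_notin by (auto simp: A_def)

lemma form_A: "\<phi> \<in> A \<Longrightarrow> alternating_form \<phi>"
proof -
  assume "\<phi> \<in> A"
  then have "alternating_form (\<phi> - \<phi>0)" using form_H by (simp add: A_def)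
  then show ?thesis
    using form_\<phi>0 unfolding alternating_form_def by (simp add: algebra_simps)
qed

lemma RA_diff: "\<phi> \<in> RA \<Longrightarrow> \<psi> \<in> RA \<Longrightarrow> \<phi> \<noteq> \<psi> \<Longrightarrow> decomposable (\<phi> - \<psi>) \<Longrightarrow> \<phi> - \<psi> \<in> RH"
  by (simp add: RA_def RH_def A_diff)

text \<open>For fixed \<open>x\<close>, the forms in \<open>A\<close> annihilating \<open>x\<close> are a nonempty translate of those in \<open>H\<close>.\<close>

lemma sum_card_radical: "(\<Sum>\<phi>\<in>A. card (radical \<phi>)) = (\<Sum>\<phi>\<in>H. card (radical \<phi>))"
proof -
  have sw: "(\<Sum>\<phi>\<in>B. card (radical \<phi>)) = (\<Sum>x\<in>UNIV. card {\<phi> \<in> B. \<phi> x = 0})" if "finite B" for B :: "('v \<Rightarrow> 'v \<Rightarrow> 'k) set"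
  proof -
    have "(\<Sum>\<phi>\<in>B. card (radical \<phi>)) = (\<Sum>\<phi>\<in>B. \<Sum>x\<in>UNIV. if \<phi> x = 0 then 1 else 0)"
      using finite_UNIV by (intro sum.cong refl) (simp add: radical_def flip: sum.inter_filter)
    also have "\<dots> = (\<Sum>x\<in>UNIV. \<Sum>\<phi>\<in>B. if \<phi> x = 0 then 1 else 0)" by (rule sum.swap)
    also have "\<dots> = (\<Sum>x\<in>UNIV. card {\<phi> \<in> B. \<phi> x = 0})"
      using that by (intro sum.cong refl) (simp flip: sum.inter_filter)
    finally show ?thesis .
  qed
  have "card {\<phi> \<in> A. \<phi> x = 0} = card {\<phi> \<in> H. \<phi> x = 0}" for x
  proof -
    obtain \<psi> where \<psi>: "\<psi> \<in> A" "\<psi> x = 0" using cover by (auto simp: A_def)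
    have "bij_betw (\<lambda>\<phi>. \<phi> - \<psi>) {\<phi> \<in> A. \<phi> x = 0} {\<phi> \<in> H. \<phi> x = 0}"
      by (rule bij_betw_byWitness[where f' = "\<lambda>\<phi>. \<psi> + \<phi>"]) (use \<psi> in \<open>auto simp: A_diff A_add\<close>)
    then show ?thesis by (rule bij_betw_same_card)
  qed
  then show ?thesis using sw finite_A finite_H by simp
qed

text \<open>Multiply the equality \<open>sum_card_radical\<close> by q^4 and divide by the number of
  vectors. In \<open>A\<close> a decomposable form contributes at most q^2 and any other at most 1;
  in \<open>H\<close> the zero form contributes q^4 and each member of \<open>RH\<close> at least
  q^2. A form of \<open>H\<close> of higher rank still contributes something, whence the strict
  version.\<close>

lemma rank_two_count:
  shows "CARD('k) ^ 4 + (CARD('k))\<^sup>2 * card RH + card RA \<le> (CARD('k))\<^sup>2 * card RA + CARD('k) ^ 3"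
    and "\<eta> \<in> H \<Longrightarrow> \<not> decomposable \<eta> \<Longrightarrow>
      CARD('k) ^ 4 + (CARD('k))\<^sup>2 * card RH + card RA < (CARD('k))\<^sup>2 * card RA + CARD('k) ^ 3"
proof -
  let ?q = "CARD('k)" and ?N = "card (UNIV :: 'v set)" and ?r = "\<lambda>\<phi> :: 'v \<Rightarrow> 'v \<Rightarrow> 'k. card (radical \<phi>)"
  have N: "?N > 0" using finite_UNIV by (simp add: card_gt_0_iff)
  have sub: "RA \<subseteq> A" by (auto simp: RA_def)
  have rest: "card (A - RA) + card RA = ?q ^ 3"
    using sub finite_A card_A by (metis card_Diff_subset card_mono finite_subset le_add_diff_inverse2)
  have "?q ^ 4 * (\<Sum>\<phi>\<in>A. ?r \<phi>) = (\<Sum>\<phi>\<in>RA. ?q ^ 4 * ?r \<phi>) + (\<Sum>\<phi>\<in>A - RA. ?q ^ 4 * ?r \<phi>)"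
    using sum.subset_diff[OF sub finite_A, of "\<lambda>\<phi>. ?q ^ 4 * ?r \<phi>"]
    by (simp add: sum_distrib_left add.commute)
  also have "(\<Sum>\<phi>\<in>RA. ?q ^ 4 * ?r \<phi>) \<le> (\<Sum>\<phi>\<in>RA. ?q\<^sup>2 * ?N)"
  proof (rule sum_mono)
    fix \<phi> assume "\<phi> \<in> RA"
    then have "?r \<phi> * ?q\<^sup>2 \<le> ?N"
      using card_radical_le2[OF finite_UNIV] form_A zero_notin_A by (auto simp: RA_def)
    then show "?q ^ 4 * ?r \<phi> \<le> ?q\<^sup>2 * ?N"
      using mult_left_mono[of "?r \<phi> * ?q\<^sup>2" ?N "?q\<^sup>2"]
      by (simp add: algebra_simps power2_eq_square power4_eq_xxxx)
  qed
  also have "(\<Sum>\<phi>\<in>A - RA. ?q ^ 4 * ?r \<phi>) \<le> (\<Sum>\<phi>\<in>A - RA. ?N)"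
    using card_radical_le4[OF finite_UNIV] form_A by (intro sum_mono) (auto simp: RA_def mult.commute)
  finally have up: "?q ^ 4 * (\<Sum>\<phi>\<in>A. ?r \<phi>) \<le> ?N * (?q\<^sup>2 * card RA + card (A - RA))"
    by (simp add: algebra_simps)
  have r0: "?r 0 = ?N" by (simp add: radical_def)
  have ge: "?q\<^sup>2 * ?N \<le> ?q ^ 4 * ?r \<phi>" if "\<phi> \<in> RH" for \<phi>
  proof -
    have "?N \<le> ?q\<^sup>2 * ?r \<phi>"
      using card_inter_radical[OF finite_UNIV, of \<phi>] that form_H by (auto simp: RH_def)
    then show ?thesis
      using mult_left_mono[of ?N "?q\<^sup>2 * ?r \<phi>" "?q\<^sup>2"]
      by (simp add: algebra_simps power2_eq_square power4_eq_xxxx)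
  qed
  \<comment> \<open>\<open>B\<close> collects forms of higher rank in \<open>H\<close>: none for the
    first claim, the single \<open>\<eta>\<close> for the second.\<close>
  have low: "?N * (?q ^ 4 + ?q\<^sup>2 * card RH) + (\<Sum>\<phi>\<in>B. ?q ^ 4 * ?r \<phi>) \<le> ?q ^ 4 * (\<Sum>\<phi>\<in>A. ?r \<phi>)"
    if B: "B \<subseteq> H" "\<And>\<phi>. \<phi> \<in> B \<Longrightarrow> \<not> decomposable \<phi>" for B
  proof -
    have d0: "decomposable 0" by (simp add: decomposable_def pluecker_def)
    have "insert 0 (RH \<union> B) \<subseteq> H" using B fs.subspace_0[OF subspace_H] by (auto simp: RH_def)
    then have "(\<Sum>\<phi>\<in>insert 0 (RH \<union> B). ?q ^ 4 * ?r \<phi>) \<le> (\<Sum>\<phi>\<in>H. ?q ^ 4 * ?r \<phi>)"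
      using finite_H by (intro sum_mono2) auto
    also have "(\<Sum>\<phi>\<in>insert 0 (RH \<union> B). ?q ^ 4 * ?r \<phi>)
        = ?q ^ 4 * ?r 0 + ((\<Sum>\<phi>\<in>RH. ?q ^ 4 * ?r \<phi>) + (\<Sum>\<phi>\<in>B. ?q ^ 4 * ?r \<phi>))"
    proof -
      have fB: "finite B" using B finite_H finite_subset by blast
      have "RH \<inter> B = {}" using B by (auto simp: RH_def)
      moreover have "0 \<notin> RH \<union> B" using B d0 by (auto simp: RH_def)
      ultimately show ?thesis using fB finite_RH by (simp add: sum.union_disjoint)
    qed
    finally have "?q ^ 4 * ?r 0 + ((\<Sum>\<phi>\<in>RH. ?q ^ 4 * ?r \<phi>) + (\<Sum>\<phi>\<in>B. ?q ^ 4 * ?r \<phi>)) \<le> (\<Sum>\<phi>\<in>H. ?q ^ 4 * ?r \<phi>)" .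
    moreover have "(\<Sum>\<phi>\<in>RH. ?q\<^sup>2 * ?N) \<le> (\<Sum>\<phi>\<in>RH. ?q ^ 4 * ?r \<phi>)" by (intro sum_mono ge)
    moreover have "?q ^ 4 * (\<Sum>\<phi>\<in>A. ?r \<phi>) = (\<Sum>\<phi>\<in>H. ?q ^ 4 * ?r \<phi>)"
      by (simp add: sum_card_radical sum_distrib_left)
    ultimately show ?thesis by (simp add: r0 algebra_simps)
  qed
  have "?N * (?q ^ 4 + ?q\<^sup>2 * card RH) \<le> ?N * (?q\<^sup>2 * card RA + card (A - RA))"
    using order_trans[OF low[of "{}"] up] by simp
  then show "?q ^ 4 + ?q\<^sup>2 * card RH + card RA \<le> ?q\<^sup>2 * card RA + ?q ^ 3"
    using N rest by simp
  assume \<eta>: "\<eta> \<in> H" "\<not> decomposable \<eta>"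
  have "0 \<in> radical \<eta>" using \<eta> form_H by (auto simp: radical_def fun_eq_iff alternating_formD)
  then have "?r \<eta> > 0" using finite_UNIV by (metis card_gt_0_iff empty_iff finite_subset subset_UNIV)
  then have "0 < ?q ^ 4 * ?r \<eta>" by simp
  moreover have "?N * (?q ^ 4 + ?q\<^sup>2 * card RH) + ?q ^ 4 * ?r \<eta> \<le> ?q ^ 4 * (\<Sum>\<phi>\<in>A. ?r \<phi>)"
    using low[of "{\<eta>}"] \<eta> by simp
  ultimately have "?N * (?q ^ 4 + ?q\<^sup>2 * card RH) < ?N * (?q\<^sup>2 * card RA + card (A - RA))"
    using up by linarith
  then show "?q ^ 4 + ?q\<^sup>2 * card RH + card RA < ?q\<^sup>2 * card RA + ?q ^ 3"
    using N rest by simp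
qed

end

context covering_forms begin

lemma card_RA_lower: "(CARD('k))\<^sup>2 + 1 + card RH \<le> card RA + CARD('k)"
  using rank_two_count(1) card_k by (rule rank_two_count_lower)

text \<open>Meant for q = 3, where one case of \<open>no_point\<close> ends with an upper bound
  equal to the lower bound of \<open>card_RA_lower\<close>.\<close>

lemma card_RA_lower_strict:
  assumes "\<eta> \<in> H" "\<not> decomposable \<eta>" "RH \<noteq> {}"
  shows "(CARD('k))\<^sup>2 + 2 + card RH \<le> card RA + CARD('k)"
proof (rule rank_two_count_lower_strict[OF rank_two_count(2)[OF assms(1,2)] card_k])
  obtain \<rho> where \<rho>: "\<rho> \<in> RH" using assms by auto
  then obtain x y where xy: "\<rho> x y \<noteq> 0" by (auto simp: RH_def fun_eq_iff)
  \<comment> \<open>\<open>RH\<close> is closed under nonzero scalars, so one member yields q - 1 of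
    them.\<close>
  have "(\<lambda>c. fscale c \<rho>) ` (UNIV - {0}) \<subseteq> RH"
    using \<rho> xy fs.subspace_scale[OF subspace_H] decomposable_fscale by (auto simp: RH_def)
  moreover have "inj_on (\<lambda>c. fscale c \<rho>) (UNIV - {0})"
    using xy by (auto simp: inj_on_def dest: fs.scale_right_imp_eq fun_cong)
  ultimately have "card ((UNIV :: 'k set) - {0}) \<le> card RH"
    using finite_RH by (intro card_inj_on_le)
  then show "CARD('k) \<le> card RH + 1" by simp
qed

lemma card_neighbours:
  assumes "\<phi> \<in> RA"
  shows "card {\<psi> \<in> RA. \<psi> \<noteq> \<phi> \<and> decomposable (\<psi> - \<phi>)} \<le> card RH"
proof (rule card_inj_on_le[where f = "\<lambda>\<psi>. \<psi> - \<phi>"])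
  show "(\<lambda>\<psi>. \<psi> - \<phi>) ` {\<psi> \<in> RA. \<psi> \<noteq> \<phi> \<and> decomposable (\<psi> - \<phi>)} \<subseteq> RH"
    using assms RA_diff by auto
qed (auto simp: inj_on_def finite_RH)

text \<open>A form has at most \<open>card RH\<close> neighbours, and the lower bound exceeds 1 +
  \<open>card RH\<close> because q^2 > q.\<close>

lemma exists_non_adjacent:
  obtains \<phi> \<psi> where "\<phi> \<in> RA" "\<psi> \<in> RA" "\<not> decomposable (\<psi> - \<phi>)"
proof -
  have "3 * CARD('k) \<le> (CARD('k))\<^sup>2" using card_k by (simp add: power2_eq_square)
  then have big: "card RA > 1 + card RH" using card_RA_lower card_k by linarith
  then obtain \<phi> where \<phi>: "\<phi> \<in> RA" by fastforce
  have "\<not> RA \<subseteq> {\<phi>} \<union> {\<psi> \<in> RA. \<psi> \<noteq> \<phi> \<and> decomposable (\<psi> - \<phi>)}"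
  proof
    assume "RA \<subseteq> {\<phi>} \<union> {\<psi> \<in> RA. \<psi> \<noteq> \<phi> \<and> decomposable (\<psi> - \<phi>)}"
    then have "card RA \<le> card ({\<phi>} \<union> {\<psi> \<in> RA. \<psi> \<noteq> \<phi> \<and> decomposable (\<psi> - \<phi>)})"
      using finite_RA by (intro card_mono) auto
    also have "\<dots> \<le> card {\<phi>} + card {\<psi> \<in> RA. \<psi> \<noteq> \<phi> \<and> decomposable (\<psi> - \<phi>)}" by (rule card_Un_le)
    finally show False using big card_neighbours[OF \<phi>] by simp
  qed
  then show ?thesis using \<phi> that by auto
qed

lemma RA_in_multiples:
  assumes "\<psi> \<in> RA" "\<psi> x \<noteq> 0" "\<psi> x = (\<lambda>y. d * g y)"
  shows "\<psi> \<in> multiples g"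
  using assms decomposable_in_multiples[of \<psi> x] multiples_fscale[of "\<psi> x" d g] by (auto simp: RA_def)

text \<open>The line through the two forms stays in \<open>A\<close> and in one space of multiples.
  The weights 1/(1 - d) and -d/(1 - d) sum to 1 and cancel the values at \<open>x\<close>.\<close>

lemma RA_proportional:
  assumes "\<psi> \<in> RA" "\<psi>' \<in> RA" "\<psi> x = (\<lambda>y. d * \<psi>' x y)" "\<psi> x \<noteq> 0" "d \<noteq> 1"
  obtains \<rho> where "\<rho> \<in> RA" "\<rho> x = 0" "\<rho> \<in> multiples (\<psi>' x)"
proof -
  define \<rho> where "\<rho> = fscale (1 / (1 - d)) \<psi> + fscale (- d / (1 - d)) \<psi>'"
  have nz: "\<psi>' x \<noteq> 0" using assms by (auto simp: fun_eq_iff)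
  have m: "\<psi> \<in> multiples (\<psi>' x)" "\<psi>' \<in> multiples (\<psi>' x)"
    using RA_in_multiples[of \<psi> x d "\<psi>' x"] RA_in_multiples[of \<psi>' x 1 "\<psi>' x"] nz assms by auto
  have \<rho>: "\<rho> \<in> multiples (\<psi>' x)"
    unfolding \<rho>_def using m fs.subspace_add fs.subspace_scale subspace_multiples by metis
  have "1 / (1 - d) + - d / (1 - d) = 1" using assms(5) by (simp add: field_simps)
  then have "\<rho> \<in> A" unfolding \<rho>_def using assms by (intro A_line) (auto simp: RA_def)
  moreover have "\<rho> x = 0" by (simp add: \<rho>_def assms(3) fun_eq_iff)
  ultimately show ?thesis using that \<rho> decomposable_multiples by (auto simp: RA_def)
qed

text \<open>The typical use: members of \<open>P\<close> on pairwise distinct lines through 0 of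
  \<open>E\<close>, each line providing q - 1 nonzero points.\<close>

lemma card_slopes:
  fixes P :: "('v \<Rightarrow> 'v \<Rightarrow> 'k) set" and f :: "('v \<Rightarrow> 'v \<Rightarrow> 'k) \<Rightarrow> 'c"
    and m :: "'k \<Rightarrow> ('v \<Rightarrow> 'v \<Rightarrow> 'k) \<Rightarrow> 'c"
  assumes "finite E" "\<And>c \<psi>. c \<noteq> 0 \<Longrightarrow> \<psi> \<in> P \<Longrightarrow> m c \<psi> \<in> E"
    and "\<And>c c' \<psi> \<psi>'. c \<noteq> 0 \<Longrightarrow> c' \<noteq> 0 \<Longrightarrow> \<psi> \<in> P \<Longrightarrow> \<psi>' \<in> P \<Longrightarrow> m c \<psi> = m c' \<psi>' \<Longrightarrow> c = c' \<and> \<psi> = \<psi>'"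
  shows "(CARD('k) - 1) * card P \<le> card E"
proof -
  have "card (((UNIV :: 'k set) - {0}) \<times> P) \<le> card E"
    using assms by (intro card_inj_on_le[where f = "\<lambda>(c, \<psi>). m c \<psi>"]) (auto simp: inj_on_def)
  then show ?thesis by (simp add: card_cartesian_product)
qed

text \<open>The forms \<open>\<phi>1, \<phi>2\<close> are not neighbours. The forms of \<open>RA\<close> not annihilating \<open>x\<close> with proportional
  values at \<open>x\<close> are multiples of a common functional, hence neighbours of each other. The forms in \<open>H\<close>
  annihilating \<open>x\<close> are a line or a plane \<open>D\<close>, and in both cases comparing \<open>RA\<close> with \<open>RH\<close> through
  neighbours gives an upper bound on \<open>card RA\<close> that violates the lower one.\<close>

lemma no_point:
  assumes \<phi>12: "\<phi>1 \<in> RA" "\<phi>2 \<in> RA" "\<not> decomposable (\<phi>2 - \<phi>1)"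
    and x: "\<phi>1 x = 0" "\<phi>2 x = 0" and \<eta>: "\<eta> \<in> H" "\<eta> x \<noteq> 0"
  shows False
proof -
  let ?q = "CARD('k)"
  define \<delta> where "\<delta> = \<phi>2 - \<phi>1"
  define D where "D = {\<phi> \<in> H. \<phi> x = 0}"
  define E where "E = (\<lambda>\<phi>. \<phi> x) ` H"
  have q3: "?q \<ge> 3" by (rule card_k)
  have q_sq: "3 * ?q \<le> ?q\<^sup>2" using q3 by (simp add: power2_eq_square)
  have finD: "finite D" and finE: "finite E" using finite_H by (auto simp: D_def E_def)
  have subD: "fs.subspace D"
    using subspace_H unfolding fs.subspace_def D_def by (auto simp: fun_eq_iff)
  have \<delta>: "\<delta> \<in> D" "\<not> decomposable \<delta>" "\<delta> \<noteq> 0"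
    using \<phi>12 x A_diff by (auto simp: \<delta>_def D_def RA_def decomposable_def pluecker_def)
  have \<delta>H: "\<delta> \<in> H" using \<delta> by (simp add: D_def)
  have A_D: "\<psi> - \<phi>1 \<in> D" if "\<psi> \<in> A" "\<psi> x = 0" for \<psi>
    using that \<phi>12 x A_diff by (auto simp: D_def RA_def)
  have A_E: "\<psi> x \<in> E" if "\<psi> \<in> A" for \<psi>
    using that \<phi>12 x A_diff[of \<psi> \<phi>1] by (auto simp: E_def RA_def intro!: image_eqI[where x = "\<psi> - \<phi>1"])
  have E_scale: "(\<lambda>y. c * g y) \<in> E" if "g \<in> E" for c g
    using that fs.subspace_scale[OF subspace_H, of _ c]
    by (auto simp: E_def intro!: image_eqI[where x = "fscale c _"])
  have E0: "0 \<in> E" using E_scale[of _ 0] \<eta> by (force simp: E_def zero_fun_def)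
  have DE: "card H = card D * card E"
    unfolding D_def E_def using finite_H subspace_H
    by (intro card_additive_kernel) (auto intro: fs.subspace_diff fs.subspace_0)
  have "{0} \<subset> D" using \<delta> fs.subspace_0[OF subD] by auto
  then have D1: "?q \<le> card D"
    using fs.card_proper_subspace[OF _ subD _ finD, of "{0}"] by (simp add: fs.subspace_single_0)
  have "D \<subset> H" using \<eta> by (auto simp: D_def)
  then have D2: "?q * card D \<le> ?q ^ 3"
    using fs.card_proper_subspace[OF subD subspace_H _ finite_H] card_H by simp
  obtain d where d: "card D = ?q ^ d" using fs.card_subspace[OF subD finD] by blast
  \<comment> \<open>\<open>D\<close> contains the nonzero \<open>\<delta>\<close> and misses
    \<open>\<eta>\<close>.\<close>
  have "d = 1 \<or> d = 2"
  proof -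
    have "?q ^ 1 \<le> ?q ^ d" using D1 d by simp
    then have "1 \<le> d" using q3 by (subst (asm) power_increasing_iff) auto
    moreover have "?q ^ Suc d \<le> ?q ^ 3" using D2 d by simp
    then have "Suc d \<le> 3" using q3 by (subst (asm) power_increasing_iff) auto
    ultimately show ?thesis by auto
  qed
  then show False
  proof
    assume "d = 1"
    then have cD: "card D = ?q" and cE: "card E = ?q\<^sup>2"
      using d DE card_H by (auto simp: power2_eq_square power3_eq_cube)
    have D_eq: "D = range (\<lambda>c. fscale c \<delta>)"
    proof (rule card_subset_eq[symmetric, OF finD])
      show "range (\<lambda>c. fscale c \<delta>) \<subseteq> D" using \<delta> fs.subspace_scale[OF subD] by auto
      have "inj (\<lambda>c. fscale c \<delta>)" using \<delta> by (auto simp: inj_on_def dest: fs.scale_right_imp_eq)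
      then show "card (range (\<lambda>c. fscale c \<delta>)) = card D" using cD by (simp add: card_image)
    qed
    \<comment> \<open>Such a form is on the affine line through \<open>\<phi>1\<close> and
      \<open>\<phi>2\<close>, which carries no third decomposable form since these two are not
      neighbours.\<close>
    have RA_T: "\<psi> = \<phi>1 \<or> \<psi> = \<phi>2" if \<psi>: "\<psi> \<in> RA" "\<psi> x = 0" for \<psi>
    proof -
      obtain c where c: "\<psi> - \<phi>1 = fscale c \<delta>" using A_D[of \<psi>] \<psi> D_eq by (auto simp: RA_def)
      then have e: "\<psi> = fscale c \<phi>2 + fscale (1 - c) \<phi>1"
        by (simp add: \<delta>_def fun_eq_iff algebra_simps)
      then have "c = 0 \<or> 1 - c = 0"
        using decomposable_combination_diff[of \<phi>2 \<phi>1 c "1 - c"] \<phi>12 \<psi> by (auto simp: RA_def)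
      then show ?thesis using e by (auto simp: fun_eq_iff)
    qed
    define N where "N \<phi> = {\<psi> \<in> RA. \<psi> \<noteq> \<phi> \<and> decomposable (\<psi> - \<phi>)}" for \<phi>
    define P where "P = RA - {\<phi>1, \<phi>2} - N \<phi>1 - N \<phi>2"
    have P_nz: "\<psi> x \<noteq> 0" if "\<psi> \<in> P" for \<psi> using that RA_T by (auto simp: P_def)
    \<comment> \<open>Values at \<open>x\<close> of distinct members of \<open>P\<close> are not
      proportional. Equal values would put a nonzero multiple of \<open>\<delta>\<close> into a
      space of multiples; a ratio other than 1 would produce a neighbour annihilating
      \<open>x\<close>, and that is \<open>\<phi>1\<close> or \<open>\<phi>2\<close>.\<close>
    have "(?q - 1) * card P \<le> card (E - {0})"
    proof (rule card_slopes[where m = "\<lambda>c \<psi> y. c * \<psi> x y"])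
      show "(\<lambda>y. c * \<psi> x y) \<in> E - {0}" if "c \<noteq> 0" "\<psi> \<in> P" for c \<psi>
        using that A_E E_scale P_nz[OF that(2)] by (auto simp: P_def RA_def fun_eq_iff)
      fix c c' :: 'k and \<psi> \<psi>' assume c: "c \<noteq> 0" "c' \<noteq> 0" and \<psi>: "\<psi> \<in> P" "\<psi>' \<in> P"
        and e: "(\<lambda>y. c * \<psi> x y) = (\<lambda>y. c' * \<psi>' x y)"
      have ratio: "\<psi> x = (\<lambda>y. (c' / c) * \<psi>' x y)"
        using c fun_cong[OF e] by (auto simp: fun_eq_iff field_simps)
      have RA: "\<psi> \<in> RA" "\<psi>' \<in> RA" using \<psi> by (auto simp: P_def)
      have m: "\<psi> \<in> multiples (\<psi>' x)" "\<psi>' \<in> multiples (\<psi>' x)"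
        using RA_in_multiples[OF RA(1) P_nz[OF \<psi>(1)] ratio]
          RA_in_multiples[OF RA(2) P_nz[OF \<psi>(2)], of 1 "\<psi>' x"] by auto
      show "c = c' \<and> \<psi> = \<psi>'"
      proof (cases "c' / c = 1")
        case True
        then have "\<psi> x = \<psi>' x" using ratio by simp
        then have "\<psi> - \<psi>' \<in> D" using RA A_diff by (auto simp: D_def RA_def)
        then obtain t where t: "\<psi> - \<psi>' = fscale t \<delta>" using D_eq by auto
        have "\<psi> - \<psi>' \<in> multiples (\<psi>' x)" using m subspace_multiples fs.subspace_diff by metis
        then have "decomposable (fscale t \<delta>)" using t decomposable_multiples by metis
        then have "t = 0"
          using decomposable_fscale[of "fscale t \<delta>" "inverse t"] \<delta>(2) by (cases "t = 0") auto
        then have "\<psi> = \<psi>'" using t by (auto simp: fun_eq_iff)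
        then show ?thesis using True c by simp
      next
        case False
        obtain \<rho> where \<rho>: "\<rho> \<in> RA" "\<rho> x = 0" "\<rho> \<in> multiples (\<psi>' x)"
          using RA_proportional[OF RA ratio P_nz[OF \<psi>(1)] False] by blast
        have "\<psi> - \<rho> \<in> multiples (\<psi>' x)" using m \<rho> subspace_multiples fs.subspace_diff by metis
        then have "decomposable (\<psi> - \<rho>)" by (rule decomposable_multiples)
        then show ?thesis using RA_T[OF \<rho>(1,2)] \<psi> by (auto simp: P_def N_def)
      qed
    qed (simp add: finE)
    then have "(?q - 1) * card P \<le> (?q - 1) * (?q + 1)"
      using finE E0 cE by (simp add: algebra_simps power2_eq_square)
    then have cP: "card P \<le> ?q + 1" using q3 by (subst (asm) mult_le_cancel1) auto
    \<comment> \<open>Subtracting \<open>\<phi>1\<close> and \<open>\<phi>2\<close> respectively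
      embeds the two sets disjointly in \<open>RH\<close>: at a coincidence
      \<open>\<psi>' - \<psi> = \<delta>\<close>, but forms with a common nonzero value at
      \<open>x\<close> are neighbours, and a zero value makes \<open>\<psi>\<close> equal to
      \<open>\<phi>2\<close>.\<close>
    have cN: "card (N \<phi>1) + card (N \<phi>2) \<le> card RH"
    proof -
      let ?i = "\<lambda>\<phi>. (\<lambda>\<psi>. \<psi> - \<phi>) ` N \<phi>"
      have "?i \<phi>1 \<inter> ?i \<phi>2 = {}"
      proof (rule ccontr)
        assume "?i \<phi>1 \<inter> ?i \<phi>2 \<noteq> {}"
        then obtain \<psi> \<psi>' where \<psi>: "\<psi> \<in> N \<phi>1" "\<psi>' \<in> N \<phi>2" "\<psi> - \<phi>1 = \<psi>' - \<phi>2" by auto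
        then have e: "\<psi>' - \<psi> = \<delta>" by (simp add: \<delta>_def algebra_simps)
        have same: "\<psi>' x = \<psi> x" using fun_cong[OF e, of x] \<delta>(1) by (simp add: D_def)
        show False
        proof (cases "\<psi> x = 0")
          case True
          then have "\<psi> = \<phi>2" using RA_T[of \<psi>] \<psi> by (auto simp: N_def)
          then show False using \<psi>(1) \<delta>(2) by (auto simp: N_def \<delta>_def)
        next
          case False
          then have "\<psi> \<in> multiples (\<psi> x)" "\<psi>' \<in> multiples (\<psi> x)"
            using RA_in_multiples[of \<psi> x 1 "\<psi> x"] RA_in_multiples[of \<psi>' x 1 "\<psi> x"] \<psi> same
            by (auto simp: N_def)
          then have "\<psi>' - \<psi> \<in> multiples (\<psi> x)" using subspace_multiples fs.subspace_diff by metis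
          then show False using decomposable_multiples e \<delta>(2) by metis
        qed
      qed
      moreover have "?i \<phi>1 \<union> ?i \<phi>2 \<subseteq> RH" using \<phi>12 RA_diff by (auto simp: N_def)
      moreover have "finite (?i \<phi>)" "card (?i \<phi>) = card (N \<phi>)" for \<phi>
        using finite_RA by (auto simp: N_def card_image inj_on_def)
      ultimately show ?thesis using finite_RH by (metis card_Un_disjoint card_mono)
    qed
    have "RA \<subseteq> {\<phi>1, \<phi>2} \<union> P \<union> N \<phi>1 \<union> N \<phi>2" by (auto simp: P_def)
    then have "card RA \<le> card ({\<phi>1, \<phi>2} \<union> P \<union> N \<phi>1 \<union> N \<phi>2)"
      using finite_RA by (intro card_mono) (auto simp: P_def N_def)
    also have "\<dots> \<le> card {\<phi>1, \<phi>2} + card P + card (N \<phi>1) + card (N \<phi>2)"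
      by (meson add_le_mono card_Un_le le_refl order_trans)
    also have "\<dots> \<le> 2 + (?q + 1) + card RH"
      using cP cN card_insert_le_m1[of 2 "{\<phi>2}" \<phi>1] by simp
    \<comment> \<open>The upper bound q + 3 + \<open>card RH\<close> is below q^2 - q + 1 +
      \<open>card RH\<close>, as q^2 > 2q + 2 for q \<ge> 3.\<close>
    finally show False using card_RA_lower q_sq q3 by linarith
  next
    assume "d = 2"
    then have cD: "card D = ?q\<^sup>2" and cE: "card E = ?q"
      using d DE card_H q3 by (auto simp: power2_eq_square power3_eq_cube)
    define R where "R = RH \<inter> D"
    define M where "M = {\<psi> \<in> RA. \<psi> x = 0 \<and> \<not> decomposable (\<psi> - \<phi>1)}"
    define P where "P = {\<psi> \<in> RA. \<psi> x = 0}"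
    define Q where "Q = {\<psi> \<in> RA. \<psi> x \<noteq> 0}"
    have fin: "finite R" "finite M" "finite P" "finite Q"
      using finite_RA finite_RH by (auto simp: R_def M_def P_def Q_def)
    have RPQ: "card RA = card P + card Q"
    proof -
      have "RA = P \<union> Q" "P \<inter> Q = {}" by (auto simp: P_def Q_def)
      then show ?thesis using fin by (simp add: card_Un_disjoint)
    qed
    \<comment> \<open>All nonzero multiples of the differences from \<open>\<phi>1\<close> are
      distinct and avoid 0 and \<open>R\<close>: a line through \<open>\<phi>1\<close> and a
      non-neighbour has no third point in \<open>RA\<close>.\<close>
    have "(?q - 1) * card M \<le> card (D - insert 0 R)"
    proof (rule card_slopes[where m = "\<lambda>c \<psi>. fscale c (\<psi> - \<phi>1)"])
      fix c :: 'k and \<psi> assume c: "c \<noteq> 0" "\<psi> \<in> M"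
      have nd: "\<not> decomposable (fscale c (\<psi> - \<phi>1))"
      proof
        assume "decomposable (fscale c (\<psi> - \<phi>1))"
        then have "decomposable (fscale (inverse c) (fscale c (\<psi> - \<phi>1)))" by (rule decomposable_fscale)
        then show False using c by (simp add: M_def)
      qed
      moreover have "decomposable 0" by (simp add: decomposable_def pluecker_def)
      moreover have "fscale c (\<psi> - \<phi>1) \<in> D"
        using c A_D fs.subspace_scale[OF subD] by (auto simp: M_def RA_def)
      ultimately show "fscale c (\<psi> - \<phi>1) \<in> D - insert 0 R" by (auto simp: R_def RH_def)
    next
      fix c c' :: 'k and \<psi> \<psi>' assume c: "c \<noteq> 0" "c' \<noteq> 0" and \<psi>: "\<psi> \<in> M" "\<psi>' \<in> M"
        and e: "fscale c (\<psi> - \<phi>1) = fscale c' (\<psi>' - \<phi>1)"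
      have "\<psi> = fscale (c' / c) \<psi>' + fscale (1 - c' / c) \<phi>1"
        using c fun_cong[OF fun_cong[OF e]] by (auto simp: fun_eq_iff field_simps)
      then have "c' / c = 0 \<or> 1 - c' / c = 0"
        using decomposable_combination_diff[of \<psi>' \<phi>1 "c' / c" "1 - c' / c"] \<psi> \<phi>12 by (auto simp: M_def RA_def)
      then have "c = c'" using c by auto
      then show "c = c' \<and> \<psi> = \<psi>'" using e c by auto
    qed (simp add: finD)
    moreover have "card (D - insert 0 R) + card R + 1 = ?q\<^sup>2"
    proof -
      have "insert 0 R \<subseteq> D" "0 \<notin> R" using fs.subspace_0[OF subD] by (auto simp: R_def RH_def)
      then show ?thesis
        using finD fin cD card_Diff_subset[of "insert 0 R" D] card_mono[of D "insert 0 R"] by simp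
    qed
    ultimately have M: "(?q - 1) * card M + card R + 1 \<le> ?q\<^sup>2" by simp
    have M1: "card M \<le> ?q + 1"
    proof -
      have "(?q - 1) * card M \<le> (?q - 1) * (?q + 1)" using M by (simp add: algebra_simps power2_eq_square)
      then show ?thesis using q3 by (subst (asm) mult_le_cancel1) auto
    qed
    have M2: "card M \<le> ?q" if "card R > 0"
    proof -
      have "(?q - 1) * (?q + 1) = ?q\<^sup>2 - 1" by (simp add: algebra_simps power2_eq_square)
      then have "(?q - 1) * card M < (?q - 1) * (?q + 1)" using M that by linarith
      then show ?thesis using q3 by (subst (asm) mult_less_cancel1) auto
    qed
    have cP: "card P \<le> 1 + card R + card M"
    proof -
      have "P \<subseteq> {\<phi>1} \<union> (\<lambda>\<omega>. \<phi>1 + \<omega>) ` R \<union> M"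
      proof
        fix \<psi> assume \<psi>: "\<psi> \<in> P"
        show "\<psi> \<in> {\<phi>1} \<union> (\<lambda>\<omega>. \<phi>1 + \<omega>) ` R \<union> M"
        proof (cases "\<psi> = \<phi>1 \<or> \<not> decomposable (\<psi> - \<phi>1)")
          case False
          then have "\<psi> - \<phi>1 \<in> R" using \<psi> \<phi>12 A_D RA_diff by (auto simp: P_def R_def RA_def)
          then show ?thesis by (auto intro!: image_eqI[where x = "\<psi> - \<phi>1"])
        qed (use \<psi> in \<open>auto simp: P_def M_def\<close>)
      qed
      then have "card P \<le> card ({\<phi>1} \<union> (\<lambda>\<omega>. \<phi>1 + \<omega>) ` R \<union> M)"
        using fin by (intro card_mono) auto
      also have "\<dots> \<le> card {\<phi>1} + card ((\<lambda>\<omega>. \<phi>1 + \<omega>) ` R) + card M"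
        by (meson add_le_mono card_Un_le le_refl order_trans)
      also have "\<dots> \<le> 1 + card R + card M" using card_image_le[OF fin(1)] by simp
      finally show ?thesis .
    qed
    have RH_R: "card (RH - D) + card R = card RH"
      using finite_RH by (metis R_def add.commute card_Int_Diff)
    \<comment> \<open>\<open>E\<close> is now one-dimensional, so all values at \<open>x\<close> are
      proportional.\<close>
    have line: "\<exists>c. h = (\<lambda>y. c * g y)" if g: "g \<in> E" "g \<noteq> 0" and h: "h \<in> E" for g h
    proof -
      have "E = range (\<lambda>c y. c * g y)"
      proof (rule card_subset_eq[symmetric, OF finE])
        show "range (\<lambda>c y. c * g y) \<subseteq> E" using g E_scale by auto
        have "inj (\<lambda>c y. c * g y)" using g by (auto simp: inj_on_def fun_eq_iff)
        then show "card (range (\<lambda>c y. c * g y)) = card E" using cE by (simp add: card_image)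
      qed
      then show ?thesis using h by auto
    qed
    have Q_E: "\<psi> x \<in> E" "\<psi> x \<noteq> 0" "\<psi> \<in> RA" if "\<psi> \<in> Q" for \<psi>
      using that A_E by (auto simp: Q_def RA_def)
    show False
    proof (cases "\<exists>\<psi>\<in>Q. \<exists>\<psi>'\<in>Q. \<psi> x \<noteq> \<psi>' x")
      case True
      then obtain \<psi> \<psi>' where \<psi>: "\<psi> \<in> Q" "\<psi>' \<in> Q" "\<psi> x \<noteq> \<psi>' x" by auto
      obtain c where c: "\<psi> x = (\<lambda>y. c * \<psi>' x y)" using line Q_E \<psi> by metis
      have "c \<noteq> 1" using c \<psi>(3) by auto
      then obtain \<rho> where \<rho>: "\<rho> \<in> RA" "\<rho> x = 0" "\<rho> \<in> multiples (\<psi>' x)"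
        using RA_proportional[OF Q_E(3)[OF \<psi>(1)] Q_E(3)[OF \<psi>(2)] c Q_E(2)[OF \<psi>(1)]] by blast
      \<comment> \<open>\<open>\<rho>\<close> annihilates \<open>x\<close> and is a neighbour of
        every member of \<open>Q\<close>. The differences lie outside \<open>D\<close>, so they
        share the total \<open>card RH\<close> with \<open>R\<close>.\<close>
      have "\<chi> - \<rho> \<in> RH - D" if \<chi>: "\<chi> \<in> Q" for \<chi>
      proof -
        obtain e where e: "\<chi> x = (\<lambda>y. e * \<psi>' x y)" using line Q_E \<psi> \<chi> by metis
        have "\<chi> \<in> multiples (\<psi>' x)" using RA_in_multiples[OF Q_E(3)[OF \<chi>] Q_E(2)[OF \<chi>] e] .
        then have "\<chi> - \<rho> \<in> multiples (\<psi>' x)" using \<rho> subspace_multiples fs.subspace_diff by metis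
        moreover have "\<chi> \<noteq> \<rho>" using \<rho> Q_E(2)[OF \<chi>] by auto
        ultimately have "\<chi> - \<rho> \<in> RH" using RA_diff[OF Q_E(3)[OF \<chi>] \<rho>(1)] decomposable_multiples by blast
        then show ?thesis using \<rho>(2) Q_E(2)[OF \<chi>] by (auto simp: D_def)
      qed
      then have "card Q \<le> card (RH - D)"
        using finite_RH by (intro card_inj_on_le[where f = "\<lambda>\<chi>. \<chi> - \<rho>"]) (auto simp: inj_on_def)
      then show False using RPQ cP M1 RH_R card_RA_lower q_sq q3 by linarith
    next
      case same: False
      \<comment> \<open>All values at \<open>x\<close> agree, so \<open>Q\<close> lies in a
        translate of \<open>F\<close>, a proper subspace of the plane \<open>D\<close> whose nonzero
        elements are in \<open>R\<close>.\<close>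
      have cQ: "card Q \<le> 1 + card R \<and> card Q \<le> ?q"
      proof (cases "Q = {}")
        case False
        then obtain \<psi> where \<psi>: "\<psi> \<in> Q" by auto
        define F where "F = D \<inter> multiples (\<psi> x)"
        have subF: "fs.subspace F" unfolding F_def using subD subspace_multiples by (rule fs.subspace_inter)
        have "\<delta> \<notin> F" using \<delta> decomposable_multiples by (auto simp: F_def)
        then have "F \<subset> D" using \<delta> by (auto simp: F_def)
        then have "?q * card F \<le> ?q * ?q"
          using fs.card_proper_subspace[OF subF subD _ finD] cD by (simp add: power2_eq_square)
        then have F1: "card F \<le> ?q" using q3 by simp
        have "F \<subseteq> insert 0 R" using decomposable_multiples by (auto simp: F_def R_def RH_def D_def)
        then have "card F \<le> card (insert 0 R)" using fin by (intro card_mono) auto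
        also have "\<dots> \<le> 1 + card R" using card_insert_le_m1[of "Suc (card R)" R 0] by simp
        finally have F2: "card F \<le> 1 + card R" .
        have "\<chi> - \<psi> \<in> F" if \<chi>: "\<chi> \<in> Q" for \<chi>
        proof -
          have e: "\<chi> x = \<psi> x" using same \<chi> \<psi> by blast
          have "\<chi> \<in> multiples (\<psi> x)" "\<psi> \<in> multiples (\<psi> x)"
            using RA_in_multiples[OF Q_E(3,2)[OF \<chi>], of 1 "\<psi> x"]
              RA_in_multiples[OF Q_E(3,2)[OF \<psi>], of 1 "\<psi> x"] e by simp_all
          then have "\<chi> - \<psi> \<in> multiples (\<psi> x)" using subspace_multiples fs.subspace_diff by metis
          moreover have "\<chi> - \<psi> \<in> H" using A_diff Q_E(3)[OF \<chi>] Q_E(3)[OF \<psi>] by (simp add: RA_def)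
          ultimately show ?thesis using e by (simp add: F_def D_def)
        qed
        then have "card Q \<le> card F"
          using finD by (intro card_inj_on_le[where f = "\<lambda>\<chi>. \<chi> - \<psi>"]) (auto simp: inj_on_def F_def)
        then show ?thesis using F1 F2 by simp
      qed simp
      \<comment> \<open>With \<open>R\<close> empty the weak lower bound suffices. Otherwise the
        upper bound is 1 + \<open>card RH\<close> + 2q, which equals the weak bound at q = 3, so the
        strict one is used.\<close>
      show False
      proof (cases "card R = 0")
        case True
        then show False using RPQ cP M1 cQ card_RA_lower q_sq q3 by linarith
      next
        case False
        then have Rpos: "card R > 0" by simp
        then have RH_ne: "RH \<noteq> {}" by (auto simp: R_def)
        have "card R \<le> card RH" using RH_R by simp
        then show False
          using RPQ cP M2[OF Rpos] cQ card_RA_lower_strict[OF \<delta>H \<delta>(2) RH_ne] q_sq q3 by linarith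
      qed
    qed
  qed
qed

text \<open>The radicals of two non-neighbours meet in codimension at most 4, and
  \<open>no_point\<close> forces every vector of the intersection into the common radical.\<close>

theorem card_UNIV_le:
  "card (UNIV :: 'v set) \<le> CARD('k) ^ 4 * card {x. \<phi>0 x = 0 \<and> (\<forall>\<phi>\<in>H. \<phi> x = 0)}"
proof (rule ccontr)
  let ?Z = "{x. \<phi>0 x = 0 \<and> (\<forall>\<phi>\<in>H. \<phi> x = 0)}"
  assume less: "\<not> ?thesis"
  obtain \<phi>1 \<phi>2 where \<phi>: "\<phi>1 \<in> RA" "\<phi>2 \<in> RA" "\<not> decomposable (\<phi>2 - \<phi>1)"
    by (rule exists_non_adjacent)
  have f: "alternating_form \<phi>1" "alternating_form \<phi>2" "decomposable \<phi>1" "decomposable \<phi>2"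
    using \<phi> form_A by (auto simp: RA_def)
  let ?X = "radical \<phi>1 \<inter> radical \<phi>2"
  have "card (UNIV :: 'v set) \<le> (CARD('k))\<^sup>2 * card (radical \<phi>1)"
    using card_inter_radical[OF finite_UNIV _ f(1,3)] by simp
  also have "card (radical \<phi>1) \<le> (CARD('k))\<^sup>2 * card ?X"
    using finite_UNIV f subspace_radical by (intro card_inter_radical) (auto intro: finite_subset)
  finally have "card (UNIV :: 'v set) \<le> CARD('k) ^ 4 * card ?X"
    by (simp add: power2_eq_square power4_eq_xxxx algebra_simps)
  then have "\<not> card ?X \<le> card ?Z" using less by (meson le_trans mult_le_mono2)
  then have "\<not> ?X \<subseteq> ?Z" using finite_UNIV by (meson card_mono finite_subset subset_UNIV)
  then obtain x where x: "\<phi>1 x = 0" "\<phi>2 x = 0" "x \<notin> ?Z" by (auto simp: radical_def)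
  show False
  proof (cases "\<forall>\<phi>\<in>H. \<phi> x = 0")
    case False
    then show False using no_point[OF \<phi> x(1,2)] by auto
  next
    case True
    have "\<phi>1 - \<phi>0 \<in> H" using \<phi> by (simp add: RA_def A_def)
    with True have "(\<phi>1 - \<phi>0) x = 0" by (rule bspec)
    then have "\<phi>0 x = 0" using x(1) by simp
    then show False using True x(3) by blast
  qed
qed

end

section \<open>Central quotients of dimension at least five\<close>

text \<open>Odd characteristic enters as \<open>two_neq_zero\<close>, which yields q \<ge> 3, a
  nonsquare, and completion of squares.\<close>

locale finite_lie_algebra = lie_algebra scale bracket + finite_dimensional_vector_space scale Basis
  for scale :: "'k::{field,finite} \<Rightarrow> 'v::ab_group_add \<Rightarrow> 'v" (infixr \<open>*s\<close> 75)
    and bracket :: "'v \<Rightarrow> 'v \<Rightarrow> 'v" and Basis :: "'v set" +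
  assumes two_neq_zero: "(2 :: 'k) \<noteq> 0"
begin

sublocale finite_scalars scale ..

lemma finite_UNIV: "finite (UNIV :: 'v set)"
  using card_span_independent[OF finite_Basis independent_Basis] unfolding span_Basis by blast

lemma finite_set: "finite (S :: 'v set)"
  by (rule finite_subset[OF subset_UNIV finite_UNIV])

lemma card_dim: "subspace S \<Longrightarrow> card S = CARD('k) ^ dim S"
  by (rule card_subspace[OF _ finite_set])

lemma card_scalars: "3 \<le> CARD('k)"
proof -
  have "card {0, 1, -1 :: 'k} \<le> CARD('k)" by (intro card_mono) auto
  moreover have "(1 :: 'k) \<noteq> -1" using two_neq_zero by (simp add: eq_neg_iff_add_eq_0)
  ultimately show ?thesis by simp
qed

lemma bracket_zero [simp]: "bracket x 0 = 0" "bracket 0 x = 0"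
  using bracket_scale_right[of x 0 0] bracket_scale_left[of 0 0 x] by simp_all

lemma bracket_skew: "bracket y x = - bracket x y"
proof -
  have "bracket (x + y) (x + y) = bracket y x + bracket x y"
    unfolding bracket_add_left bracket_add_right by (simp add: bracket_self)
  then show ?thesis by (simp add: bracket_self eq_neg_iff_add_eq_0)
qed

lemma bracket_minus: "bracket (- x) y = - bracket x y" "bracket x (- y) = - bracket x y"
  using bracket_scale_left[of "-1" x y] bracket_scale_right[of x "-1" y] by simp_all

lemma bracket_diff: "bracket (x - y) z = bracket x z - bracket y z" "bracket x (y - z) = bracket x y - bracket x z"
  by (simp_all add: diff_conv_add_uminus bracket_add_left bracket_add_right bracket_minus del: add_uminus_conv_diff)

lemma bracket_eq_0_sym: "bracket x y = 0 \<Longrightarrow> bracket y x = 0"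
  using bracket_skew[of y x] by simp

lemma bracket_jacobi: "bracket x (bracket y z) = bracket (bracket x y) z + bracket y (bracket x z)"
proof -
  have "bracket x (bracket y z) = - bracket y (bracket z x) - bracket z (bracket x y)"
    using jacobi[of x y z] by (simp add: algebra_simps eq_neg_iff_add_eq_0)
  then show ?thesis
    by (simp add: bracket_skew[of x z] bracket_skew[of "bracket x y" z] bracket_minus)
qed

lemma subspace_center: "subspace center"
  by (rule subspaceI) (auto simp: center_def bracket_add_left bracket_scale_left)

lemma centerD: "z \<in> center \<Longrightarrow> bracket z x = 0" "z \<in> center \<Longrightarrow> bracket x z = 0"
  by (auto simp: center_def intro: bracket_eq_0_sym)

lemma subspace_derived: "subspace derived"
  by (simp add: derived_def bracket_space_def)

lemma bracket_in_derived: "bracket x y \<in> derived"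
  by (auto simp: derived_def bracket_space_def intro: span_base)

lemma derived_minimal: "subspace S \<Longrightarrow> (\<And>x y. bracket x y \<in> S) \<Longrightarrow> derived \<subseteq> S"
  unfolding derived_def bracket_space_def by (intro span_minimal) auto

lemma subspace_range_bracket: "subspace (range (bracket x))"
proof (rule subspaceI)
  show "0 \<in> range (bracket x)" by (metis bracket_zero(1) rangeI)
qed (auto simp flip: bracket_add_right bracket_scale_right)

section \<open>Functionals separating a non-commutator\<close>

definition commutators :: "'v set" where
  "commutators = {bracket x y | x y. True}"

lemma commutators_subset: "commutators \<subseteq> derived"
  by (auto simp: commutators_def bracket_in_derived)

definition functional :: "('v \<Rightarrow> 'k) \<Rightarrow> bool" where
  "functional f \<longleftrightarrow> (\<forall>x y. f (x + y) = f x + f y) \<and> (\<forall>c x. f (c *s x) = c * f x)"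

lemma functionalD: "functional f \<Longrightarrow> f (x + y) = f x + f y" "functional f \<Longrightarrow> f (c *s x) = c * f x" 
  "functional f \<Longrightarrow> f 0 = 0"
proof -
  show "functional f \<Longrightarrow> f (x + y) = f x + f y" and sc: "functional f \<Longrightarrow> f (c *s x) = c * f x" for c x
    by (simp_all add: functional_def)
  show "functional f \<Longrightarrow> f 0 = 0" using sc[of 0 0] by simp
qed

lemma functional_span_eq_0:
  assumes "functional f" "\<And>b. b \<in> B \<Longrightarrow> f b = 0" "v \<in> span B"
  shows "f v = 0"
proof -
  have "subspace {v. f v = 0}" using functionalD[OF assms(1)] by (auto intro!: subspaceI)
  then have "span B \<subseteq> {v. f v = 0}" using assms(2) by (intro span_minimal) auto
  then show ?thesis using assms(3) by auto
qed

lemma separating_functional: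
  assumes S: "subspace S" and z: "z \<notin> S"
  shows "\<exists>f. functional f \<and> f z = 1 \<and> (\<forall>s\<in>S. f s = 0)"
proof -
  obtain B where B: "B \<subseteq> S" "independent B" "S \<subseteq> span B" by (rule basis_exists[of S])
  have span_B: "span B = S" using B S by (intro span_subspace)
  have ind: "independent (insert z B)" using B z span_B by (simp add: independent_insert)
  define C where "C = extend_basis (insert z B)"
  have C: "independent C" "span C = UNIV" "insert z B \<subseteq> C"
    unfolding C_def
    by (rule independent_extend_basis[OF ind] span_extend_basis[OF ind] extend_basis_superset[OF ind])+
  define f where "f = (\<lambda>v. representation C v z)"
  have f: "functional f"
    unfolding functional_def f_def using C by (simp add: representation_add representation_scale)
  have "z \<in> C" using C(3) by blast
  then have "f z = 1" unfolding f_def representation_basis[OF C(1) \<open>z \<in> C\<close>] by simp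
  moreover have "f s = 0" if "s \<in> S" for s
  proof (rule functional_span_eq_0[OF f])
    fix b assume "b \<in> B"
    then have b: "b \<noteq> z" "b \<in> C" using z B(1) C(3) by blast+
    show "f b = 0" unfolding f_def representation_basis[OF C(1) b(2)] using b(1) by simp
  qed (simp add: that span_B)
  ultimately show ?thesis using f by (intro exI[where x = f]) simp
qed

text \<open>Extend \<open>z\<close> to a basis of L' and take the dual functionals; they live on all
  of L but are determined only on L'. There \<open>f2\<close>, \<open>f3\<close>, \<open>f4\<close>
  span the functionals killing \<open>z\<close>, so they parametrize \<open>H\<close>, and
  \<open>f1\<close> gives \<open>\<phi>0\<close>.\<close>

lemma dual_basis_derived:
  assumes d4: "dim derived = 4" and z: "z \<in> derived" "z \<noteq> 0"
  obtains f1 f2 f3 f4 e2 e3 e4 where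
    "functional f1" "functional f2" "functional f3" "functional f4"
    "f1 z = 1" "f2 z = 0" "f3 z = 0" "f4 z = 0" "f2 e2 = 1" "f3 e2 = 0" "f4 e2 = 0"
    "f2 e3 = 0" "f3 e3 = 1" "f4 e3 = 0" "f2 e4 = 0" "f3 e4 = 0" "f4 e4 = 1"
    "e2 \<in> derived" "e3 \<in> derived" "e4 \<in> derived"
    "\<forall>g v. functional g \<longrightarrow> v \<in> derived \<longrightarrow> g v = g z * f1 v + g e2 * f2 v + g e3 * f3 v + g e4 * f4 v"
proof -
  have "independent {z}" using z by simp
  then obtain B where B: "{z} \<subseteq> B" "B \<subseteq> derived" "independent B" "derived \<subseteq> span B"
    using maximal_independent_subset_extend[of "{z}" derived] z by auto
  have span_B: "span B = derived" using B subspace_derived by (intro span_subspace)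
  have "card B = 4" using B d4 span_B by (metis dim_span_eq_card_independent)
  then have "card (B - {z}) = 3" using B by simp
  then obtain e2 e3 e4 where e: "B - {z} = {e2, e3, e4}" "e2 \<noteq> e3" "e2 \<noteq> e4" "e3 \<noteq> e4"
    by (auto simp: card_3_iff)
  have B_eq: "B = {z, e2, e3, e4}" using e(1) B(1) by blast
  have zne: "z \<noteq> e2" "z \<noteq> e3" "z \<noteq> e4" using e(1) by blast+
  have dual: "\<exists>f. functional f \<and> f b = 1 \<and> (\<forall>b'\<in>B - {b}. f b' = 0)" if b: "b \<in> B" for b
  proof -
    have "b \<notin> span (B - {b})" using B(3) b by (auto simp: dependent_def)
    from separating_functional[OF subspace_span this]
    obtain f where f: "functional f" "f b = 1" "\<forall>s\<in>span (B - {b}). f s = 0" by auto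
    then show ?thesis using span_base[of _ "B - {b}"] by (intro exI[where x = f] conjI ballI) simp_all
  qed
  have mem: "z \<in> B" "e2 \<in> B" "e3 \<in> B" "e4 \<in> B" by (simp_all add: B_eq)
  obtain f1 where f1: "functional f1" "f1 z = 1" "f1 e2 = 0" "f1 e3 = 0" "f1 e4 = 0"
    using dual[OF mem(1)] zne mem by (metis insert_Diff_single insert_iff)
  obtain f2 where f2: "functional f2" "f2 z = 0" "f2 e2 = 1" "f2 e3 = 0" "f2 e4 = 0"
    using dual[OF mem(2)] zne mem e(2-4) by (metis insert_Diff_single insert_iff)
  obtain f3 where f3: "functional f3" "f3 z = 0" "f3 e2 = 0" "f3 e3 = 1" "f3 e4 = 0"
    using dual[OF mem(3)] zne mem e(2-4) by (metis insert_Diff_single insert_iff)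
  obtain f4 where f4: "functional f4" "f4 z = 0" "f4 e2 = 0" "f4 e3 = 0" "f4 e4 = 1"
    using dual[OF mem(4)] zne mem e(2-4) by (metis insert_Diff_single insert_iff)
  have dec: "g v = g z * f1 v + g e2 * f2 v + g e3 * f3 v + g e4 * f4 v"
    if g: "functional g" and v: "v \<in> derived" for g v
  proof -
    define h where "h = (\<lambda>v. g v - (g z * f1 v + g e2 * f2 v + g e3 * f3 v + g e4 * f4 v))"
    have "functional h"
      using g f1(1) f2(1) f3(1) f4(1) unfolding functional_def h_def by (simp add: algebra_simps)
    moreover have "v \<in> span B" using v unfolding span_B .
    moreover have "h b = 0" if "b \<in> B" for b
      using that unfolding B_eq h_def by (elim insertE emptyE) (simp_all add: f1 f2 f3 f4)
    ultimately have "h v = 0" using functional_span_eq_0[of h B v] by simp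
    then show ?thesis by (simp add: h_def)
  qed
  have "e2 \<in> derived" "e3 \<in> derived" "e4 \<in> derived" using mem B(2) by (simp_all add: subsetD)
  with f1 f2 f3 f4 allI[OF allI[OF impI[OF impI[OF dec]]]] show ?thesis by (intro that[of f1 f2 f3 f4 e2 e3 e4])
qed

lemma commutators_eq_derived:
  assumes d4: "dim derived = 4" and large: "dim center + 5 \<le> dim (UNIV :: 'v set)"
  shows "commutators = derived"
proof (rule ccontr)
  assume "commutators \<noteq> derived"
  then obtain z where z: "z \<in> derived" "z \<notin> commutators" using commutators_subset by auto
  have z0: "z \<noteq> 0" using z(2) bracket_self unfolding commutators_def by (metis (mono_tags, lifting) mem_Collect_eq)
  obtain f1 f2 f3 f4 e2 e3 e4 where
    f: "functional f1" "functional f2" "functional f3" "functional f4"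
    and val: "f1 z = 1" "f2 z = 0" "f3 z = 0" "f4 z = 0" "f2 e2 = 1" "f3 e2 = 0" "f4 e2 = 0"
    "f2 e3 = 0" "f3 e3 = 1" "f4 e3 = 0" "f2 e4 = 0" "f3 e4 = 0" "f4 e4 = 1"
    and e: "e2 \<in> derived" "e3 \<in> derived" "e4 \<in> derived"
    and "\<forall>g v. functional g \<longrightarrow> v \<in> derived \<longrightarrow> g v = g z * f1 v + g e2 * f2 v + g e3 * f3 v + g e4 * f4 v"
    by (rule dual_basis_derived[OF d4 z(1) z0])
  then have dec: "g v = g z * f1 v + g e2 * f2 v + g e3 * f3 v + g e4 * f4 v"
    if "functional g" "v \<in> derived" for g v using that by simp
  define G where "G = (\<lambda>(a, b, c) x y. a * f2 (bracket x y) + b * f3 (bracket x y) + c * f4 (bracket x y))"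
  define \<phi>0 where "\<phi>0 = (\<lambda>x y. f1 (bracket x y))"
  have zero_on_derived: "g v = 0"
    if "functional g" "\<And>x y. g (bracket x y) = 0" "v \<in> derived" for g v
    using functional_span_eq_0[OF that(1), of "{bracket x y | x y. True}" v] that
    by (auto simp: derived_def bracket_space_def)
  have form: "alternating_form (\<lambda>x y. g (bracket x y))" if "functional g" for g
    using functionalD[OF that] unfolding alternating_form_def
    by (simp add: bracket_add_left bracket_add_right bracket_scale_left bracket_scale_right bracket_self)
  have lin: "functional (\<lambda>v. a * f2 v + b * f3 v + c * f4 v)" for a b c
    using f unfolding functional_def by (simp add: algebra_simps)
  \<comment> \<open>A form determines its functional on L' because brackets span L'.\<close>
  have key: "a = a' \<and> b = b' \<and> c = c'" if eq: "G (a, b, c) = G (a', b', c')" for a b c a' b' c'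
  proof -
    define h where "h = (\<lambda>v. (a - a') * f2 v + (b - b') * f3 v + (c - c') * f4 v)"
    have "h v = 0" if "v \<in> derived" for v
    proof (rule zero_on_derived[OF _ _ that])
      show "functional h" unfolding h_def by (rule lin)
      show "h (bracket x y) = 0" for x y
        using fun_cong[OF fun_cong[OF eq], of x y] by (simp add: G_def h_def algebra_simps)
    qed
    from this[OF e(1)] this[OF e(2)] this[OF e(3)] show ?thesis
      using val by (simp add: h_def)
  qed
  have injG: "inj G"
  proof (rule injI)
    fix s t assume "G s = G t"
    then show "s = t" using key[of "fst s" "fst (snd s)" "snd (snd s)" "fst t" "fst (snd t)" "snd (snd t)"]
      by (simp add: prod_eq_iff)
  qed
  \<comment> \<open>A functional with value 1 at \<open>z\<close> has coefficient 1 at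
    \<open>f1\<close>, so its form differs from \<open>\<phi>0\<close> by a member of the range of
    \<open>G\<close>.\<close>
  have cov: "\<exists>\<phi>. \<phi> - \<phi>0 \<in> range G \<and> \<phi> x = 0" for x
  proof -
    have "z \<notin> range (bracket x)" using z(2) by (auto simp: commutators_def)
    from separating_functional[OF subspace_range_bracket this]
    obtain g where g: "functional g" "g z = 1" "\<forall>s\<in>range (bracket x). g s = 0" by auto
    have "(\<lambda>x y. g (bracket x y)) - \<phi>0 = G (g e2, g e3, g e4)"
      using dec[OF g(1) bracket_in_derived] g(2) by (simp add: fun_eq_iff G_def \<phi>0_def)
    then show ?thesis using g(3) by (intro exI[where x = "\<lambda>x y. g (bracket x y)"]) (auto simp: fun_eq_iff)
  qed
  interpret covering_forms scale "range G" \<phi>0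
  proof
    show "finite (UNIV :: 'v set)" by (rule finite_UNIV)
    show "fs.subspace (range G)"
    proof (rule fs.subspaceI)
      have "G (0, 0, 0) = 0" by (simp add: G_def fun_eq_iff)
      then show "0 \<in> range G" by (metis rangeI)
      fix u assume "u \<in> range G"
      then obtain a b c where u: "u = G (a, b, c)" by auto
      have "fscale k u = G (k * a, k * b, k * c)" for k
        by (simp add: u G_def fun_eq_iff algebra_simps)
      then show "fscale k u \<in> range G" for k by auto
      fix v assume "v \<in> range G"
      then obtain a' b' c' where v: "v = G (a', b', c')" by auto
      have "u + v = G (a + a', b + b', c + c')" by (simp add: u v G_def fun_eq_iff algebra_simps)
      then show "u + v \<in> range G" by auto
    qed
    show "alternating_form \<phi>" if "\<phi> \<in> range G" for \<phi>
    proof -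
      from that obtain a b c where "\<phi> = G (a, b, c)" by auto
      then show ?thesis using form[OF lin, of a b c] by (simp add: G_def)
    qed
    show "alternating_form \<phi>0" unfolding \<phi>0_def by (rule form[OF f(1)])
    show "\<phi>0 \<notin> range G"
    proof
      assume "\<phi>0 \<in> range G"
      then obtain a b c where abc: "\<phi>0 = G (a, b, c)" by auto
      define h where "h = (\<lambda>v. f1 v - (a * f2 v + b * f3 v + c * f4 v))"
      have "h z = 0"
      proof (rule zero_on_derived[OF _ _ z(1)])
        show "functional h" using f unfolding functional_def h_def by (simp add: algebra_simps)
        show "h (bracket x y) = 0" for x y
          using fun_cong[OF fun_cong[OF abc], of x y] by (simp add: G_def \<phi>0_def h_def)
      qed
      then show False using val by (simp add: h_def)
    qed
    show "card (range G) = CARD('k) ^ 3"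
      using card_image[OF injG] by (simp add: card_cartesian_product power3_eq_cube flip: UNIV_Times_UNIV)
    show "\<exists>\<phi>. \<phi> - \<phi>0 \<in> range G \<and> \<phi> x = 0" for x by (rule cov)
    show "3 \<le> CARD('k)" by (rule card_scalars)
  qed
  let ?Z = "{x. \<phi>0 x = 0 \<and> (\<forall>\<phi>\<in>range G. \<phi> x = 0)}"
  have "?Z \<subseteq> center"
  proof
    fix x assume "x \<in> ?Z"
    then have "\<phi>0 x = 0 \<and> (\<forall>\<phi>\<in>range G. \<phi> x = 0)" by (rule CollectD)
    note x = conjunct1[OF this] bspec[OF conjunct2[OF this] rangeI]
    have x0: "f1 (bracket x y) = 0" "f2 (bracket x y) = 0" "f3 (bracket x y) = 0" "f4 (bracket x y) = 0" for y
      using fun_cong[OF x(1), of y] fun_cong[OF x(2)[of "(1, 0, 0)"], of y] fun_cong[OF x(2)[of "(0, 1, 0)"], of y]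
        fun_cong[OF x(2)[of "(0, 0, 1)"], of y] by (simp_all add: \<phi>0_def G_def)
    have "bracket x y = 0" for y
    proof (rule ccontr)
      assume "bracket x y \<noteq> 0"
      then have "bracket x y \<notin> {0}" by simp
      from separating_functional[OF subspace_single_0 this]
      obtain g where "functional g" "g (bracket x y) = 1" by auto
      then show False using dec[OF _ bracket_in_derived, of g x y] x0 by simp
    qed
    then show "x \<in> center" by (simp add: center_def)
  qed
  then have "card ?Z \<le> card center" by (intro card_mono finite_set)
  with card_UNIV_le have "card (UNIV :: 'v set) \<le> CARD('k) ^ 4 * card center"
    by (meson le_trans mult_le_mono2)
  then have "CARD('k) ^ dim (UNIV :: 'v set) \<le> CARD('k) ^ (4 + dim center)"
    using card_dim[OF subspace_UNIV] card_dim[OF subspace_center] by (simp add: power_add)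
  then show False using card_scalars large by (subst (asm) power_increasing_iff) auto
qed

end

section \<open>Central quotients of dimension four\<close>

text \<open>A bivector on the Klein quadric is a product of two vectors. If some p1j is nonzero,
  take b = (0, p12, p13, p14) and let a start with 1; otherwise only the last three coordinates of
  the vectors matter.\<close>

lemma pluecker_vectors:
  fixes p12 p13 p14 p23 p24 p34 :: "'k::field"
  assumes "p12 * p34 - p13 * p24 + p14 * p23 = 0"
  obtains a1 a2 a3 a4 b1 b2 b3 b4 where
    "p12 = a1 * b2 - a2 * b1" "p13 = a1 * b3 - a3 * b1" "p14 = a1 * b4 - a4 * b1"
    "p23 = a2 * b3 - a3 * b2" "p24 = a2 * b4 - a4 * b2" "p34 = a3 * b4 - a4 * b3"
proof -
  have e: "p12 * p34 = p13 * p24 - p14 * p23" using assms by (simp add: algebra_simps eq_neg_iff_add_eq_0)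
  consider "p12 \<noteq> 0" | "p13 \<noteq> 0" | "p14 \<noteq> 0" | "p12 = 0" "p13 = 0" "p14 = 0" "p23 \<noteq> 0"
    | "p12 = 0" "p13 = 0" "p14 = 0" "p23 = 0" "p24 \<noteq> 0" | "p12 = 0" "p13 = 0" "p14 = 0" "p23 = 0" "p24 = 0" by blast
  then show ?thesis
  proof cases
    case 1
    then show ?thesis
      using e by (intro that[of 1 p12 0 0 p13 "- p23 / p12" p14 "- p24 / p12"]) (auto simp: field_simps)
  next
    case 2
    then show ?thesis
      using e by (intro that[of 1 p12 "p23 / p13" 0 p13 0 p14 "- p34 / p13"]) (auto simp: field_simps)
  next
    case 3
    then show ?thesis
      using e by (intro that[of 1 p12 "p24 / p14" 0 p13 "p34 / p14" p14 0]) (auto simp: field_simps)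
  next
    case 4
    then show ?thesis by (intro that[of 0 0 1 0 p23 0 p24 "- p34 / p23"]) (auto simp: field_simps)
  next
    case 5
    then show ?thesis by (intro that[of 0 0 1 0 0 "p34 / p24" p24 0]) (auto simp: field_simps)
  next
    case 6
    then show ?thesis by (intro that[of 0 0 0 0 0 1 p34 0]) (auto simp: field_simps)
  qed
qed

section \<open>Squares and binary quadratic forms over a finite field\<close>

lemma card_squares:
  assumes "(2 :: 'k::{field,finite}) \<noteq> 0"
  shows "CARD('k) + 1 \<le> 2 * card (range (\<lambda>x :: 'k. x * x))"
proof -
  let ?f = "\<lambda>x :: 'k. x * x" and ?S = "range (\<lambda>x :: 'k. x * x)"
  have "CARD('k) = (\<Sum>y\<in>?S. card {x. ?f x = y})"
    using sum.image_gen[of "UNIV :: 'k set" "\<lambda>_. 1::nat" ?f] by simp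
  also have "\<dots> = card {x. ?f x = 0} + (\<Sum>y\<in>?S - {0}. card {x. ?f x = y})"
    by (rule sum.remove) (auto intro: image_eqI[where x = 0])
  also have "card {x. ?f x = 0} = 1" by simp
  also have "(\<Sum>y\<in>?S - {0}. card {x. ?f x = y}) \<le> (\<Sum>y\<in>?S - {0}. 2)"
  proof (rule sum_mono)
    fix y assume "y \<in> ?S - {0}"
    then obtain x where "y = x * x" by auto
    then have "{z. ?f z = y} \<subseteq> {x, -x}" by (auto simp: square_eq_iff)
    then have "card {z. ?f z = y} \<le> card {x, -x}" by (rule card_mono[rotated]) simp
    also have "\<dots> \<le> 2" by (simp add: card_insert_if)
    finally show "card {z. ?f z = y} \<le> 2" .
  qed
  also have "\<dots> = 2 * (card ?S - 1)"
  proof -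
    have "0 \<in> ?S" by (rule image_eqI[where x = 0]) auto
    then show ?thesis by (simp add: card_Diff_singleton)
  qed
  finally have "CARD('k) \<le> 1 + 2 * (card ?S - 1)" by simp
  moreover have "card ?S > 0" by (simp add: card_gt_0_iff)
  ultimately show ?thesis by linarith
qed

lemma exists_nonsquare:
  assumes "(2 :: 'k::{field,finite}) \<noteq> 0"
  shows "\<exists>d :: 'k. \<forall>x. x * x \<noteq> d"
proof -
  have "(1 :: 'k) \<noteq> -1"
  proof
    assume "(1 :: 'k) = -1"
    then have "(2 :: 'k) = 0" unfolding eq_neg_iff_add_eq_0 one_add_one .
    with assms show False by (rule notE)
  qed
  then have "\<not> inj (\<lambda>x :: 'k. x * x)" using injD[of "\<lambda>x :: 'k. x * x" 1 "-1"] by auto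
  then have "\<not> surj (\<lambda>x :: 'k. x * x)" using finite_UNIV_surj_inj[of "\<lambda>x :: 'k. x * x"] by auto
  then show ?thesis by (auto simp: surj_def) metis
qed

text \<open>Pigeonhole: there are at least (q + 1)/2 squares and as many values c minus a times a
  square, so the two sets meet.\<close>

lemma diagonal_binary_form_universal:
  fixes a c :: "'k::{field,finite}"
  assumes two: "(2 :: 'k) \<noteq> 0" and a: "a \<noteq> 0"
  obtains u v where "u * u + a * (v * v) = c"
proof -
  let ?S = "range (\<lambda>x :: 'k. x * x)"
  let ?T = "(\<lambda>s. c - a * s) ` ?S"
  have "card ?T = card ?S" using a by (intro card_image) (auto simp: inj_on_def)
  have "?S \<inter> ?T \<noteq> {}"
  proof
    assume "?S \<inter> ?T = {}"
    then have "card ?S + card ?T = card (?S \<union> ?T)" by (simp add: card_Un_disjoint)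
    also have "\<dots> \<le> CARD('k)" by (intro card_mono) auto
    finally show False using card_squares[OF two] \<open>card ?T = card ?S\<close> by simp
  qed
  then obtain u v where "u * u = c - a * (v * v)" by auto
  then show ?thesis by (intro that[of u v]) simp
qed

text \<open>Completing both squares multiplies the equation by \<open>4\<alpha>\<close> and then by \<open>4\<Delta>\<close>,
  where \<open>\<Delta> = 4\<alpha>\<gamma> - \<beta>\<^sup>2\<close> does not vanish because the form is anisotropic.\<close>

lemma anisotropic_binary_form_affine_zero:
  fixes \<alpha> \<beta> \<gamma> l m c :: "'k::{field,finite}"
  assumes two: "(2 :: 'k) \<noteq> 0"
    and an: "\<And>s t. \<alpha> * s * s + \<beta> * s * t + \<gamma> * t * t = 0 \<Longrightarrow> s = 0 \<and> t = 0"
  obtains s t where "\<alpha> * s * s + \<beta> * s * t + \<gamma> * t * t + l * s + m * t + c = 0"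
proof -
  have \<alpha>: "\<alpha> \<noteq> 0" using an[of 1 0] by auto
  define \<Delta> where "\<Delta> = 4 * \<alpha> * \<gamma> - \<beta> * \<beta>"
  have four: "(4 :: 'k) \<noteq> 0"
    using two by (metis mult_2 mult_eq_0_iff numeral_Bit0)
  have \<Delta>: "\<Delta> \<noteq> 0"
  proof
    assume "\<Delta> = 0"
    \<comment> \<open>At (-\<beta>, 2\<alpha>) the form has the value \<alpha>\<Delta>, so this
      would be a null vector.\<close>
    then have "\<alpha> * (- \<beta>) * (- \<beta>) + \<beta> * (- \<beta>) * (2 * \<alpha>) + \<gamma> * (2 * \<alpha>) * (2 * \<alpha>) = 0"
      unfolding \<Delta>_def by algebra
    from an[OF this] show False using \<alpha> two by simp
  qed
  \<comment> \<open>With u = 2\<alpha>s + \<beta>t + l, the polynomial times 4\<alpha> is u^2 +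
    \<Delta>t^2 + M t + 4\<alpha>c - l^2; the second square is that of v = 2\<Delta>t + M.\<close>
  define M where "M = 4 * \<alpha> * m - 2 * \<beta> * l"
  obtain v u where vu: "v * v + 4 * \<Delta> * (u * u) = M * M - 4 * \<Delta> * (4 * \<alpha> * c - l * l)"
    using diagonal_binary_form_universal[OF two, of "4 * \<Delta>"] four \<Delta> by auto
  define t where "t = (v - M) / (2 * \<Delta>)"
  define s where "s = (u - \<beta> * t - l) / (2 * \<alpha>)"
  have v: "v = 2 * \<Delta> * t + M" using two \<Delta> by (simp add: t_def field_simps)
  have u: "u = 2 * \<alpha> * s + \<beta> * t + l" using two \<alpha> by (simp add: s_def field_simps)
  have "4 * \<Delta> * (4 * \<alpha>) * (\<alpha> * s * s + \<beta> * s * t + \<gamma> * t * t + l * s + m * t + c)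
      = v * v + 4 * \<Delta> * (u * u) - (M * M - 4 * \<Delta> * (4 * \<alpha> * c - l * l))"
    unfolding u v M_def \<Delta>_def by algebra
  also have "\<dots> = 0" by (simp only: vu diff_self)
  finally have "\<alpha> * s * s + \<beta> * s * t + \<gamma> * t * t + l * s + m * t + c = 0"
    by (simp only: mult_eq_0_iff four \<Delta> \<alpha> simp_thms)
  then show ?thesis by (rule that)
qed

section \<open>Frames modulo the center and the map from bivectors to L'\<close>

context finite_lie_algebra begin

text \<open>When dim L/Z(L) = 4, the four vectors are a basis modulo Z(L); see
  \<open>frame_independent\<close>.\<close>

definition frame :: "'v \<Rightarrow> 'v \<Rightarrow> 'v \<Rightarrow> 'v \<Rightarrow> bool" where
  "frame x1 x2 x3 x4 \<longleftrightarrow> span (insert x1 (insert x2 (insert x3 (insert x4 center)))) = UNIV"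

text \<open>The bracket as a linear map on bivectors, in coordinates; its kernel is K.\<close>

definition wedge :: "'v \<Rightarrow> 'v \<Rightarrow> 'v \<Rightarrow> 'v \<Rightarrow> 'k \<times> 'k \<times> 'k \<times> 'k \<times> 'k \<times> 'k \<Rightarrow> 'v" where
  "wedge x1 x2 x3 x4 = (\<lambda>(p12, p13, p14, p23, p24, p34).
    p12 *s bracket x1 x2 + p13 *s bracket x1 x3 + p14 *s bracket x1 x4
    + p23 *s bracket x2 x3 + p24 *s bracket x2 x4 + p34 *s bracket x3 x4)"

lemma frame_decompose:
  assumes "frame x1 x2 x3 x4"
  obtains a1 a2 a3 a4 z where "z \<in> center" "v = a1 *s x1 + a2 *s x2 + a3 *s x3 + a4 *s x4 + z"
proof -
  have "v \<in> span (insert x1 (insert x2 (insert x3 (insert x4 center))))"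
    using assms by (simp add: frame_def)
  then obtain a1 a2 a3 a4 where "v - a1 *s x1 - a2 *s x2 - a3 *s x3 - a4 *s x4 \<in> span center"
    by (auto simp: span_insert)
  then have "v - a1 *s x1 - a2 *s x2 - a3 *s x3 - a4 *s x4 \<in> center"
    using subspace_center by (metis span_eq_iff)
  then show ?thesis by (rule that[of _ a1 a2 a3 a4]) simp
qed

lemma frameI:
  assumes "frame x1 x2 x3 x4"
    and "\<And>x. x \<in> {x1, x2, x3, x4} \<Longrightarrow> x \<in> span (insert y1 (insert y2 (insert y3 (insert y4 center))))"
  shows "frame y1 y2 y3 y4"
proof -
  let ?Y = "insert y1 (insert y2 (insert y3 (insert y4 center)))"
  have "center \<subseteq> ?Y" by blast
  then have "center \<subseteq> span ?Y" by (rule order_trans[OF _ span_superset])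
  then have "insert x1 (insert x2 (insert x3 (insert x4 center))) \<subseteq> span ?Y"
    using assms(2) by simp
  then have "span (insert x1 (insert x2 (insert x3 (insert x4 center)))) \<subseteq> span ?Y"
    by (rule span_minimal[OF _ subspace_span])
  then show ?thesis using assms(1) by (simp add: frame_def top.extremum_unique)
qed

lemma bracket_combination:
  assumes "z \<in> center" "z' \<in> center"
  shows "bracket (a1 *s x1 + a2 *s x2 + a3 *s x3 + a4 *s x4 + z) (b1 *s x1 + b2 *s x2 + b3 *s x3 + b4 *s x4 + z')
    = wedge x1 x2 x3 x4 (a1 * b2 - a2 * b1, a1 * b3 - a3 * b1, a1 * b4 - a4 * b1,
        a2 * b3 - a3 * b2, a2 * b4 - a4 * b2, a3 * b4 - a4 * b3)"
  using bracket_skew[of x1 x2] bracket_skew[of x1 x3] bracket_skew[of x1 x4]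
    bracket_skew[of x2 x3] bracket_skew[of x2 x4] bracket_skew[of x3 x4]
  by (simp add: wedge_def bracket_add_left bracket_add_right bracket_scale_left bracket_scale_right
      bracket_self centerD[OF assms(1)] centerD[OF assms(2)] scale_left_diff_distrib scale_right_diff_distrib
      scale_right_distrib mult.commute)

lemma wedge_add: "wedge x1 x2 x3 x4 (p + p') = wedge x1 x2 x3 x4 p + wedge x1 x2 x3 x4 p'"
  by (cases p; cases p') (simp add: wedge_def scale_left_distrib algebra_simps)

lemma wedge_diff: "wedge x1 x2 x3 x4 (p - p') = wedge x1 x2 x3 x4 p - wedge x1 x2 x3 x4 p'"
  by (cases p; cases p') (simp add: wedge_def scale_left_diff_distrib algebra_simps)

lemma wedge_scale:
  "wedge x1 x2 x3 x4 (c * p12, c * p13, c * p14, c * p23, c * p24, c * p34)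
    = c *s wedge x1 x2 x3 x4 (p12, p13, p14, p23, p24, p34)"
  by (simp add: wedge_def scale_right_distrib)

lemma range_wedge:
  assumes "frame x1 x2 x3 x4"
  shows "range (wedge x1 x2 x3 x4) = derived"
proof
  show "range (wedge x1 x2 x3 x4) \<subseteq> derived"
    using subspace_derived by (auto simp: wedge_def intro!: subspace_add subspace_scale bracket_in_derived)
  show "derived \<subseteq> range (wedge x1 x2 x3 x4)"
  proof (rule derived_minimal)
    show "subspace (range (wedge x1 x2 x3 x4))"
    proof (rule subspaceI)
      show "0 \<in> range (wedge x1 x2 x3 x4)" by (rule image_eqI[where x = "(0, 0, 0, 0, 0, 0)"]) (simp_all add: wedge_def)
    next
      fix u v assume "u \<in> range (wedge x1 x2 x3 x4)" "v \<in> range (wedge x1 x2 x3 x4)"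
      then show "u + v \<in> range (wedge x1 x2 x3 x4)" by (auto simp flip: wedge_add)
    next
      fix c u assume "u \<in> range (wedge x1 x2 x3 x4)"
      then show "c *s u \<in> range (wedge x1 x2 x3 x4)" by (auto simp flip: wedge_scale)
    qed
    fix x y
    obtain a1 a2 a3 a4 z where x: "z \<in> center" "x = a1 *s x1 + a2 *s x2 + a3 *s x3 + a4 *s x4 + z"
      using frame_decompose[OF assms] .
    obtain b1 b2 b3 b4 z' where y: "z' \<in> center" "y = b1 *s x1 + b2 *s x2 + b3 *s x3 + b4 *s x4 + z'"
      using frame_decompose[OF assms] .
    show "bracket x y \<in> range (wedge x1 x2 x3 x4)"
      unfolding x(2) y(2) bracket_combination[OF x(1) y(1)] by (rule rangeI)
  qed
qed

lemma derived_wedge: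
  assumes "frame x1 x2 x3 x4" "v \<in> derived"
  obtains p12 p13 p14 p23 p24 p34 where "v = wedge x1 x2 x3 x4 (p12, p13, p14, p23, p24, p34)"
proof -
  have "v \<in> range (wedge x1 x2 x3 x4)" using assms(2) range_wedge[OF assms(1)] by simp
  then obtain p where p: "v = wedge x1 x2 x3 x4 p" by (rule imageE)
  obtain p12 p13 p14 p23 p24 p34 where "p = (p12, p13, p14, p23, p24, p34)" by (rule prod_cases6)
  with p show ?thesis by (intro that) simp
qed

lemma wedge_commutator:
  assumes "p12 * p34 - p13 * p24 + p14 * p23 = 0"
  shows "wedge x1 x2 x3 x4 (p12, p13, p14, p23, p24, p34) \<in> commutators"
proof -
  have c0: "0 \<in> center" by (simp add: center_def)
  obtain a1 a2 a3 a4 b1 b2 b3 b4 where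
    "p12 = a1 * b2 - a2 * b1" "p13 = a1 * b3 - a3 * b1" "p14 = a1 * b4 - a4 * b1"
    "p23 = a2 * b3 - a3 * b2" "p24 = a2 * b4 - a4 * b2" "p34 = a3 * b4 - a4 * b3"
    by (rule pluecker_vectors[OF assms])
  then have "wedge x1 x2 x3 x4 (p12, p13, p14, p23, p24, p34) = bracket (a1 *s x1 + a2 *s x2 + a3 *s x3 + a4 *s x4 + 0)
      (b1 *s x1 + b2 *s x2 + b3 *s x3 + b4 *s x4 + 0)"
    unfolding bracket_combination[OF c0 c0] by simp
  then show ?thesis unfolding commutators_def by blast
qed

lemma commutator_wedge:
  assumes "frame x1 x2 x3 x4" "v \<in> commutators"
  obtains p12 p13 p14 p23 p24 p34 where "v = wedge x1 x2 x3 x4 (p12, p13, p14, p23, p24, p34)"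
    "p12 * p34 - p13 * p24 + p14 * p23 = 0"
proof -
  obtain x y where v: "v = bracket x y" using assms(2) by (auto simp: commutators_def)
  obtain a1 a2 a3 a4 z where x: "z \<in> center" "x = a1 *s x1 + a2 *s x2 + a3 *s x3 + a4 *s x4 + z"
    using frame_decompose[OF assms(1)] .
  obtain b1 b2 b3 b4 z' where y: "z' \<in> center" "y = b1 *s x1 + b2 *s x2 + b3 *s x3 + b4 *s x4 + z'"
    using frame_decompose[OF assms(1)] .
  show ?thesis
    by (rule that[OF v[unfolded x(2) y(2) bracket_combination[OF x(1) y(1)]]]) (simp add: algebra_simps)
qed

text \<open>The terms with \<open>x1\<close> have it as a common factor, and the others form a
  bivector in three dimensions; both parts are on the Klein quadric.\<close>

lemma derived_sum_two_commutators:
  assumes "frame x1 x2 x3 x4" "v \<in> derived"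
  obtains u u' where "u \<in> commutators" "u' \<in> commutators" "v = u + u'"
proof -
  obtain p12 p13 p14 p23 p24 p34 where v: "v = wedge x1 x2 x3 x4 (p12, p13, p14, p23, p24, p34)"
    using assms(2) by (rule derived_wedge[OF assms(1)])
  have "v = wedge x1 x2 x3 x4 (p12, p13, p14, 0, 0, 0) + wedge x1 x2 x3 x4 (0, 0, 0, p23, p24, p34)"
    by (simp add: v flip: wedge_add)
  then show ?thesis
    by (rule that[rotated 2]) (rule wedge_commutator, simp)+
qed

text \<open>The coordinate map onto L has a domain of the same size as L, so it is
  injective.\<close>

lemma frame_independent:
  assumes fr: "frame x1 x2 x3 x4" and dimU: "dim (UNIV :: 'v set) = dim center + 4"
    and c: "a1 *s x1 + a2 *s x2 + a3 *s x3 + a4 *s x4 \<in> center"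
  shows "a1 = 0 \<and> a2 = 0 \<and> a3 = 0 \<and> a4 = 0"
proof -
  let ?f = "\<lambda>(a1, a2, a3, a4, z). a1 *s x1 + a2 *s x2 + a3 *s x3 + a4 *s x4 + z"
  let ?D = "(UNIV :: 'k set) \<times> (UNIV :: 'k set) \<times> (UNIV :: 'k set) \<times> (UNIV :: 'k set) \<times> center"
  have "?f ` ?D = UNIV"
  proof (rule UNIV_eq_I[symmetric])
    fix v
    obtain a1 a2 a3 a4 z where "z \<in> center" "v = a1 *s x1 + a2 *s x2 + a3 *s x3 + a4 *s x4 + z"
      using frame_decompose[OF fr] .
    then show "v \<in> ?f ` ?D" by (intro image_eqI[where x = "(a1, a2, a3, a4, z)"]) auto
  qed
  moreover have "card ?D = card (UNIV :: 'v set)"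
    using card_dim[OF subspace_UNIV] card_dim[OF subspace_center] dimU
    by (simp add: card_cartesian_product power_add power4_eq_xxxx)
  ultimately have inj: "inj_on ?f ?D" using finite_set by (intro eq_card_imp_inj_on) auto
  have "- (a1 *s x1 + a2 *s x2 + a3 *s x3 + a4 *s x4) \<in> center" using c subspace_center by (rule subspace_neg[rotated])
  then have "(a1, a2, a3, a4, - (a1 *s x1 + a2 *s x2 + a3 *s x3 + a4 *s x4)) = (0, 0, 0, 0, 0)"
    by (intro inj_onD[OF inj]) (simp_all add: subspace_0[OF subspace_center])
  then show ?thesis by simp
qed

lemma inj_onto_derived:
  fixes f :: "'k \<times> 'k \<times> 'k \<times> 'k \<Rightarrow> 'v"
  assumes "dim derived = 4" "range f = derived"
  shows "inj f"
proof (rule eq_card_imp_inj_on)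
  show "card (range f) = card (UNIV :: ('k \<times> 'k \<times> 'k \<times> 'k) set)"
    using assms card_dim[OF subspace_derived]
    by (simp add: card_cartesian_product power4_eq_xxxx flip: UNIV_Times_UNIV)
qed simp

text \<open>K is the totally isotropic plane of the coordinates 12 and 13. On the coset belonging to
  \<open>[x1,x4] + [x2,x3]\<close> the Klein form is constantly 1. The second claim, that the other
  four brackets are a basis of L', feeds the breadth computations.\<close>

lemma isotropic_frame_noncommutator:
  assumes d4: "dim derived = 4" and fr: "frame x1 x2 x3 x4" and r: "bracket x1 x2 = 0" "bracket x1 x3 = 0"
  shows "commutators \<noteq> derived"
    and "a *s bracket x1 x4 + b *s bracket x2 x3 + c *s bracket x2 x4 + d *s bracket x3 x4 = 0
      \<Longrightarrow> a = 0 \<and> b = 0 \<and> c = 0 \<and> d = 0"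
proof -
  let ?f = "\<lambda>(a, b, c, d). a *s bracket x1 x4 + b *s bracket x2 x3 + c *s bracket x2 x4 + d *s bracket x3 x4"
  have w: "wedge x1 x2 x3 x4 (p12, p13, p14, p23, p24, p34) = ?f (p14, p23, p24, p34)" for p12 p13 p14 p23 p24 p34
    by (simp add: wedge_def r)
  have "range ?f = range (wedge x1 x2 x3 x4)"
  proof (intro equalityI subsetI)
    fix v assume "v \<in> range ?f"
    then obtain p where p: "v = ?f p" by (rule imageE)
    obtain a b c d where "p = (a, b, c, d)" by (rule prod_cases4)
    with p have "v = ?f (a, b, c, d)" by simp
    then show "v \<in> range (wedge x1 x2 x3 x4)" by (intro image_eqI[where x = "(0, 0, a, b, c, d)"]) (simp_all only: w UNIV_I)
  next
    fix v assume "v \<in> range (wedge x1 x2 x3 x4)"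
    then have "v \<in> derived" using range_wedge[OF fr] by simp
    then obtain p12 p13 p14 p23 p24 p34 where "v = wedge x1 x2 x3 x4 (p12, p13, p14, p23, p24, p34)"
      by (rule derived_wedge[OF fr])
    then show "v \<in> range ?f" by (intro image_eqI[where x = "(p14, p23, p24, p34)"]) (simp_all only: w UNIV_I)
  qed
  then have rf: "range ?f = derived" using range_wedge[OF fr] by simp
  then have inj: "inj ?f" by (rule inj_onto_derived[OF d4])
  show "commutators \<noteq> derived"
  proof
    assume eq: "commutators = derived"
    have "?f (1, 1, 0, 0) \<in> commutators" unfolding eq rf[symmetric] by (rule rangeI)
    then obtain p12 p13 p14 p23 p24 p34 where p: "?f (1, 1, 0, 0) = wedge x1 x2 x3 x4 (p12, p13, p14, p23, p24, p34)"
      and pl: "p12 * p34 - p13 * p24 + p14 * p23 = 0"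
      by (rule commutator_wedge[OF fr])
    have "(1, 1, 0, 0) = (p14, p23, p24, p34)" using p unfolding w by (rule injD[OF inj])
    then show False using pl by simp
  qed
  assume "a *s bracket x1 x4 + b *s bracket x2 x3 + c *s bracket x2 x4 + d *s bracket x3 x4 = 0"
  then have "?f (a, b, c, d) = ?f (0, 0, 0, 0)" by simp
  then have "(a, b, c, d) = (0, 0, 0, 0)" by (rule injD[OF inj])
  then show "a = 0 \<and> b = 0 \<and> c = 0 \<and> d = 0" by simp
qed

text \<open>On K only the coordinate 12 and the equal coordinates 13 and 24 survive, and the Klein
  form has rank one. On the coset belonging to \<open>n [x1,x4] + [x2,x3]\<close> it is n - t^2,
  without zero for a nonsquare n.\<close>

lemma parabolic_frame_noncommutator:
  assumes d4: "dim derived = 4" and fr: "frame x1 x2 x3 x4"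
    and r: "bracket x1 x2 = 0" "bracket x1 x3 + bracket x2 x4 = 0"
  shows "commutators \<noteq> derived"
    and "a *s bracket x1 x3 + b *s bracket x1 x4 + c *s bracket x2 x3 + d *s bracket x3 x4 = 0
      \<Longrightarrow> a = 0 \<and> b = 0 \<and> c = 0 \<and> d = 0"
proof -
  let ?f = "\<lambda>(a, b, c, d). a *s bracket x1 x3 + b *s bracket x1 x4 + c *s bracket x2 x3 + d *s bracket x3 x4"
  have r24: "bracket x2 x4 = - bracket x1 x3" using r(2) by (simp add: eq_neg_iff_add_eq_0 add.commute)
  have w: "wedge x1 x2 x3 x4 (p12, p13, p14, p23, p24, p34) = ?f (p13 - p24, p14, p23, p34)" for p12 p13 p14 p23 p24 p34
    by (simp add: wedge_def r(1) r24 scale_left_diff_distrib)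
  have "range ?f = range (wedge x1 x2 x3 x4)"
  proof (intro equalityI subsetI)
    fix v assume "v \<in> range ?f"
    then obtain p where p: "v = ?f p" by (rule imageE)
    obtain a b c d where "p = (a, b, c, d)" by (rule prod_cases4)
    with p have "v = ?f (a, b, c, d)" by simp
    then have "v = wedge x1 x2 x3 x4 (0, a, b, c, 0, d)" unfolding w by simp
    then show "v \<in> range (wedge x1 x2 x3 x4)" by simp
  next
    fix v assume "v \<in> range (wedge x1 x2 x3 x4)"
    then have "v \<in> derived" using range_wedge[OF fr] by simp
    then obtain p12 p13 p14 p23 p24 p34 where "v = wedge x1 x2 x3 x4 (p12, p13, p14, p23, p24, p34)"
      by (rule derived_wedge[OF fr])
    then show "v \<in> range ?f" by (intro image_eqI[where x = "(p13 - p24, p14, p23, p34)"]) (simp_all only: w UNIV_I)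
  qed
  then have rf: "range ?f = derived" using range_wedge[OF fr] by simp
  then have inj: "inj ?f" by (rule inj_onto_derived[OF d4])
  obtain n :: 'k where n: "\<forall>x. x * x \<noteq> n" using exists_nonsquare[OF two_neq_zero] by auto
  show "commutators \<noteq> derived"
  proof
    assume eq: "commutators = derived"
    have "?f (0, n, 1, 0) \<in> commutators" unfolding eq rf[symmetric] by (rule rangeI)
    then obtain p12 p13 p14 p23 p24 p34 where p: "?f (0, n, 1, 0) = wedge x1 x2 x3 x4 (p12, p13, p14, p23, p24, p34)"
      and pl: "p12 * p34 - p13 * p24 + p14 * p23 = 0"
      by (rule commutator_wedge[OF fr])
    have "(0, n, 1, 0) = (p13 - p24, p14, p23, p34)" using p unfolding w by (rule injD[OF inj])
    then show False using pl spec[OF n, of p24] by simp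
  qed
  assume "a *s bracket x1 x3 + b *s bracket x1 x4 + c *s bracket x2 x3 + d *s bracket x3 x4 = 0"
  then have "?f (a, b, c, d) = ?f (0, 0, 0, 0)" by simp
  then have "(a, b, c, d) = (0, 0, 0, 0)" by (rule injD[OF inj])
  then show "a = 0 \<and> b = 0 \<and> c = 0 \<and> d = 0" by simp
qed

text \<open>The coordinates \<open>p12\<close> and \<open>p34\<close> may be changed freely: put
  \<open>p34 = 1\<close> and solve the Klein equation for \<open>p12\<close>.\<close>

lemma hyperbolic_frame_commutators:
  assumes fr: "frame x1 x2 x3 x4" and r: "bracket x1 x2 = 0" "bracket x3 x4 = 0"
  shows "commutators = derived"
proof (rule equalityI[OF commutators_subset subsetI])
  fix v assume "v \<in> derived"
  then obtain p12 p13 p14 p23 p24 p34 where v: "v = wedge x1 x2 x3 x4 (p12, p13, p14, p23, p24, p34)"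
    by (rule derived_wedge[OF fr])
  have "v = wedge x1 x2 x3 x4 (p13 * p24 - p14 * p23, p13, p14, p23, p24, 1)"
    unfolding v wedge_def by (simp add: r)
  moreover have "\<dots> \<in> commutators" by (rule wedge_commutator) simp
  ultimately show "v \<in> commutators" by simp
qed

text \<open>On a coset of K the Klein form is a quadratic polynomial in two variables with
  anisotropic leading part, so it has a zero.\<close>

lemma anisotropic_frame_commutators:
  assumes d4: "dim derived = 4" and fr: "frame x1 x2 x3 x4"
    and an: "\<And>p12 p13 p14 p23 p24 p34. wedge x1 x2 x3 x4 (p12, p13, p14, p23, p24, p34) = 0
      \<Longrightarrow> p12 * p34 - p13 * p24 + p14 * p23 = 0 \<Longrightarrow> (p12, p13, p14, p23, p24, p34) = 0"
  shows "commutators = derived"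
proof (rule equalityI[OF commutators_subset subsetI])
  fix v assume "v \<in> derived"
  then obtain p12 p13 p14 p23 p24 p34 where v: "v = wedge x1 x2 x3 x4 (p12, p13, p14, p23, p24, p34)"
    by (rule derived_wedge[OF fr])
  have expand: "(c12 + s * a12 + t * b12) * (c34 + s * a34 + t * b34) - (c13 + s * a13 + t * b13) * (c24 + s * a24 + t * b24)
        + (c14 + s * a14 + t * b14) * (c23 + s * a23 + t * b23)
      = (a12 * a34 - a13 * a24 + a14 * a23) * s * s
        + (a12 * b34 + b12 * a34 - a13 * b24 - b13 * a24 + a14 * b23 + b14 * a23) * s * t
        + (b12 * b34 - b13 * b24 + b14 * b23) * t * t
        + (c12 * a34 + a12 * c34 - c13 * a24 - a13 * c24 + c14 * a23 + a14 * c23) * s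
        + (c12 * b34 + b12 * c34 - c13 * b24 - b13 * c24 + c14 * b23 + b14 * c23) * t
        + (c12 * c34 - c13 * c24 + c14 * c23)"
    for a12 a13 a14 a23 a24 a34 b12 b13 b14 b23 b24 b34 c12 c13 c14 c23 c24 c34 s t :: 'k
    by (simp add: algebra_simps)
  define K where "K = {p. wedge x1 x2 x3 x4 p = 0}"
  have "card (UNIV :: ('k \<times> 'k \<times> 'k \<times> 'k \<times> 'k \<times> 'k) set)
      = card {p \<in> UNIV. wedge x1 x2 x3 x4 p = 0} * card (range (wedge x1 x2 x3 x4))"
    by (rule card_additive_kernel) (simp_all add: wedge_diff)
  moreover have "card (UNIV :: ('k \<times> 'k \<times> 'k \<times> 'k \<times> 'k \<times> 'k) set) = CARD('k) ^ 6"
    by (simp add: eval_nat_numeral)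
  ultimately have "CARD('k) ^ 6 = card K * CARD('k) ^ 4"
    using d4 card_dim[OF subspace_derived] by (simp add: range_wedge[OF fr] K_def)
  moreover have "(CARD('k))\<^sup>2 * CARD('k) ^ 4 = CARD('k) ^ 6" by (simp flip: power_add)
  ultimately have "card K * CARD('k) ^ 4 = (CARD('k))\<^sup>2 * CARD('k) ^ 4" by (simp only:)
  then have "card K = (CARD('k))\<^sup>2 \<or> CARD('k) ^ 4 = 0" by (rule mult_cancel2[THEN iffD1])
  then have cK: "card K = (CARD('k))\<^sup>2" by simp
  have q: "1 < CARD('k)" "CARD('k) < (CARD('k))\<^sup>2" using card_scalars by (simp_all add: power2_eq_square)
  \<comment> \<open>Two independent elements of K are found by size: q^2 elements fit neither in {0}
    nor in a line.\<close>
  have "\<not> K \<subseteq> {0}"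
  proof
    assume "K \<subseteq> {0}"
    then have "card K \<le> card {0 :: 'k \<times> 'k \<times> 'k \<times> 'k \<times> 'k \<times> 'k}" by (rule card_mono[rotated]) simp
    then show False using cK q by simp
  qed
  then obtain k where k: "k \<in> K" "k \<noteq> 0" by blast
  obtain a12 a13 a14 a23 a24 a34 where "k = (a12, a13, a14, a23, a24, a34)" by (rule prod_cases6)
  with k have a: "(a12, a13, a14, a23, a24, a34) \<in> K" "(a12, a13, a14, a23, a24, a34) \<noteq> 0" by simp_all
  let ?m = "\<lambda>s. (s * a12, s * a13, s * a14, s * a23, s * a24, s * a34)"
  have "\<not> K \<subseteq> range ?m"
  proof
    assume "K \<subseteq> range ?m"
    then have "card K \<le> card (range ?m)" by (rule card_mono[rotated]) simp
    also have "\<dots> \<le> CARD('k)" by (rule card_image_le) simp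
    finally show False using cK q by simp
  qed
  then obtain k' where k': "k' \<in> K" "k' \<notin> range ?m" unfolding subset_iff by auto
  obtain b12 b13 b14 b23 b24 b34 where "k' = (b12, b13, b14, b23, b24, b34)" by (rule prod_cases6)
  with k' have b: "(b12, b13, b14, b23, b24, b34) \<in> K" "(b12, b13, b14, b23, b24, b34) \<notin> range ?m"
    by (simp_all only: not_False_eq_True)
  have wab: "wedge x1 x2 x3 x4 (c12 + s * a12 + t * b12, c13 + s * a13 + t * b13, c14 + s * a14 + t * b14,
      c23 + s * a23 + t * b23, c24 + s * a24 + t * b24, c34 + s * a34 + t * b34)
      = wedge x1 x2 x3 x4 (c12, c13, c14, c23, c24, c34)" for s t c12 c13 c14 c23 c24 c34
  proof -
    have "wedge x1 x2 x3 x4 ((c12, c13, c14, c23, c24, c34) + ?m s + (t * b12, t * b13, t * b14, t * b23, t * b24, t * b34))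
        = wedge x1 x2 x3 x4 (c12, c13, c14, c23, c24, c34)"
      unfolding wedge_add wedge_scale using a(1) b(1) by (simp add: K_def)
    then show ?thesis by simp
  qed
  have aniso: "s = 0 \<and> t = 0"
    if e: "(a12 * a34 - a13 * a24 + a14 * a23) * s * s
      + (a12 * b34 + b12 * a34 - a13 * b24 - b13 * a24 + a14 * b23 + b14 * a23) * s * t
      + (b12 * b34 - b13 * b24 + b14 * b23) * t * t = 0" for s t
  proof -
    \<comment> \<open>The leading zeros are the base point of the coset in \<open>wab\<close> and
      \<open>expand\<close>, here K itself.\<close>
    have "(0 + s * a12 + t * b12, 0 + s * a13 + t * b13, 0 + s * a14 + t * b14,
      0 + s * a23 + t * b23, 0 + s * a24 + t * b24, 0 + s * a34 + t * b34) = 0"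
    proof (rule an)
      show "wedge x1 x2 x3 x4 (0 + s * a12 + t * b12, 0 + s * a13 + t * b13, 0 + s * a14 + t * b14,
          0 + s * a23 + t * b23, 0 + s * a24 + t * b24, 0 + s * a34 + t * b34) = 0"
        unfolding wab by (simp add: wedge_def)
      show "(0 + s * a12 + t * b12) * (0 + s * a34 + t * b34) - (0 + s * a13 + t * b13) * (0 + s * a24 + t * b24)
          + (0 + s * a14 + t * b14) * (0 + s * a23 + t * b23) = 0"
        unfolding expand using e by simp
    qed
    then have z: "s * a12 + t * b12 = 0" "s * a13 + t * b13 = 0" "s * a14 + t * b14 = 0"
      "s * a23 + t * b23 = 0" "s * a24 + t * b24 = 0" "s * a34 + t * b34 = 0" by (simp_all add: zero_prod_def)
    have "t = 0"
    proof (rule ccontr)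
      assume t: "t \<noteq> 0"
      have "y = (- s / t) * x" if "s * x + t * y = 0" for x y
      proof -
        have "y = t * y / t" using t by simp
        also have "t * y = - (s * x)" using that by (simp add: add_eq_0_iff)
        finally show ?thesis by simp
      qed
      from this[OF z(1)] this[OF z(2)] this[OF z(3)] this[OF z(4)] this[OF z(5)] this[OF z(6)]
      have "(b12, b13, b14, b23, b24, b34) = ?m (- s / t)" by simp
      then have "(b12, b13, b14, b23, b24, b34) \<in> range ?m" by (rule range_eqI)
      with b(2) show False by (rule notE)
    qed
    moreover have "s = 0"
      using z a(2) \<open>t = 0\<close> by (auto simp: zero_prod_def)
    ultimately show ?thesis by simp
  qed
  obtain s t where st: "(a12 * a34 - a13 * a24 + a14 * a23) * s * s
      + (a12 * b34 + b12 * a34 - a13 * b24 - b13 * a24 + a14 * b23 + b14 * a23) * s * t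
      + (b12 * b34 - b13 * b24 + b14 * b23) * t * t
      + (p12 * a34 + a12 * p34 - p13 * a24 - a13 * p24 + p14 * a23 + a14 * p23) * s
      + (p12 * b34 + b12 * p34 - p13 * b24 - b13 * p24 + p14 * b23 + b14 * p23) * t
      + (p12 * p34 - p13 * p24 + p14 * p23) = 0"
    by (rule anisotropic_binary_form_affine_zero[OF two_neq_zero aniso])
  have "wedge x1 x2 x3 x4 (p12 + s * a12 + t * b12, p13 + s * a13 + t * b13, p14 + s * a14 + t * b14,
      p23 + s * a23 + t * b23, p24 + s * a24 + t * b24, p34 + s * a34 + t * b34) \<in> commutators"
    by (rule wedge_commutator) (unfold expand, rule st)
  then show "v \<in> commutators" unfolding wab v .
qed

text \<open>The two alternatives describe the degenerate planes \<open>K\<close>: totally isotropic, or of rank one.\<close>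

definition degenerate_frame :: "'v \<Rightarrow> 'v \<Rightarrow> 'v \<Rightarrow> 'v \<Rightarrow> bool" where
  "degenerate_frame x1 x2 x3 x4 \<longleftrightarrow> frame x1 x2 x3 x4 \<and> bracket x1 x2 = 0
    \<and> (bracket x1 x3 = 0 \<or> bracket x1 x3 + bracket x2 x4 = 0)"

lemma degenerate_frame_noncommutator:
  assumes "dim derived = 4" "degenerate_frame x1 x2 x3 x4"
  shows "commutators \<noteq> derived"
  using assms isotropic_frame_noncommutator(1) parabolic_frame_noncommutator(1)
  unfolding degenerate_frame_def by metis

section \<open>Construction of frames and normal forms of K\<close>

lemma exists_notin_span: "dim S < dim (UNIV :: 'v set) \<Longrightarrow> \<exists>x. x \<notin> span S"
  using dim_span[of S] by (metis UNIV_eq_I less_irrefl)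

lemma extend_to_frame3:
  assumes dimU: "dim (UNIV :: 'v set) = dim center + 4"
    and y: "y1 \<notin> center" "y2 \<notin> span (insert y1 center)" "y3 \<notin> span (insert y2 (insert y1 center))"
  shows "\<exists>y4. frame y1 y2 y3 y4"
proof -
  have "y1 \<notin> span center" using y(1) subspace_center by (metis span_eq_iff)
  then have "dim (insert y1 center) = dim center + 1" by (simp add: dim_insert)
  then have "dim (insert y2 (insert y1 center)) = dim center + 2" using y(2) by (simp add: dim_insert)
  then have d3: "dim (insert y3 (insert y2 (insert y1 center))) = dim center + 3"
    using y(3) by (simp add: dim_insert)
  obtain y4 where y4: "y4 \<notin> span (insert y3 (insert y2 (insert y1 center)))"
    using exists_notin_span[of "insert y3 (insert y2 (insert y1 center))"] dimU d3 by auto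
  then have "dim (insert y4 (insert y3 (insert y2 (insert y1 center)))) = dim (UNIV :: 'v set)"
    using d3 dimU by (simp add: dim_insert)
  then have "span (insert y4 (insert y3 (insert y2 (insert y1 center)))) = UNIV"
    using dim_eq_full dim_UNIV dimension_def by metis
  moreover have "insert y4 (insert y3 (insert y2 (insert y1 center))) = insert y1 (insert y2 (insert y3 (insert y4 center)))"
    by auto
  ultimately show ?thesis unfolding frame_def by metis
qed

lemma extend_to_frame:
  assumes dimU: "dim (UNIV :: 'v set) = dim center + 4"
    and y: "y1 \<notin> center" "y2 \<notin> span (insert y1 center)"
  shows "\<exists>y3 y4. frame y1 y2 y3 y4"
proof -
  have "y1 \<notin> span center" using y(1) subspace_center by (metis span_eq_iff)
  then have "dim (insert y1 center) = dim center + 1" by (simp add: dim_insert)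
  then have "dim (insert y2 (insert y1 center)) = dim center + 2" using y(2) by (simp add: dim_insert)
  then obtain y3 where "y3 \<notin> span (insert y2 (insert y1 center))"
    using exists_notin_span[of "insert y2 (insert y1 center)"] dimU by auto
  then show ?thesis using extend_to_frame3[OF dimU y] by metis
qed

lemma exists_frame:
  assumes dimU: "dim (UNIV :: 'v set) = dim center + 4"
  shows "\<exists>x1 x2 x3 x4. frame x1 x2 x3 x4"
proof -
  have sp: "span center = center" by (rule span_eq_iff[THEN iffD2, OF subspace_center])
  obtain y1 where y1: "y1 \<notin> span center" using exists_notin_span[of center] dimU by auto
  then have "dim (insert y1 center) = dim center + 1" by (simp add: dim_insert)
  then obtain y2 where "y2 \<notin> span (insert y1 center)"
    using exists_notin_span[of "insert y1 center"] dimU by auto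
  then show ?thesis using extend_to_frame[OF dimU, of y1 y2] y1 unfolding sp by blast
qed

lemma in_span_frame:
  "a *s y1 + b *s y2 + c *s y3 + d *s y4 \<in> span (insert y1 (insert y2 (insert y3 (insert y4 S))))"
  by (intro span_add span_scale span_base) simp_all

lemma in_span_frameI:
  "x = a *s y1 + b *s y2 + c *s y3 + d *s y4 \<Longrightarrow> x \<in> span (insert y1 (insert y2 (insert y3 (insert y4 S))))"
  using in_span_frame by simp

lemma frame_changeI:
  assumes "frame x1 x2 x3 x4"
    and "x1 = a11 *s y1 + a12 *s y2 + a13 *s y3 + a14 *s y4"
    and "x2 = a21 *s y1 + a22 *s y2 + a23 *s y3 + a24 *s y4"
    and "x3 = a31 *s y1 + a32 *s y2 + a33 *s y3 + a34 *s y4"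
    and "x4 = a41 *s y1 + a42 *s y2 + a43 *s y3 + a44 *s y4"
  shows "frame y1 y2 y3 y4"
proof (rule frameI[OF assms(1)])
  fix x assume "x \<in> {x1, x2, x3, x4}"
  then show "x \<in> span (insert y1 (insert y2 (insert y3 (insert y4 center))))"
    using in_span_frameI[OF assms(2)] in_span_frameI[OF assms(3)] in_span_frameI[OF assms(4)]
      in_span_frameI[OF assms(5)] by auto
qed

text \<open>A nonzero isotropic element of K is a product of two vectors with zero bracket. They are
  independent modulo Z(L), since otherwise the product would vanish, and so they start a
  frame.\<close>

lemma commuting_frame:
  assumes dimU: "dim (UNIV :: 'v set) = dim center + 4" and fr: "frame x1 x2 x3 x4"
    and w: "wedge x1 x2 x3 x4 (p12, p13, p14, p23, p24, p34) = 0"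
    and pl: "p12 * p34 - p13 * p24 + p14 * p23 = 0"
    and nz: "(p12, p13, p14, p23, p24, p34) \<noteq> 0"
  shows "\<exists>y1 y2 y3 y4. frame y1 y2 y3 y4 \<and> bracket y1 y2 = 0"
proof -
  have c0: "0 \<in> center" by (simp add: center_def)
  obtain a1 a2 a3 a4 b1 b2 b3 b4 where p:
    "p12 = a1 * b2 - a2 * b1" "p13 = a1 * b3 - a3 * b1" "p14 = a1 * b4 - a4 * b1"
    "p23 = a2 * b3 - a3 * b2" "p24 = a2 * b4 - a4 * b2" "p34 = a3 * b4 - a4 * b3"
    by (rule pluecker_vectors[OF pl])
  define y1 where "y1 = a1 *s x1 + a2 *s x2 + a3 *s x3 + a4 *s x4"
  define y2 where "y2 = b1 *s x1 + b2 *s x2 + b3 *s x3 + b4 *s x4"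
  have y12: "bracket y1 y2 = 0"
    using bracket_combination[OF c0 c0, of a1 x1 a2 x2 a3 x3 a4 x4 b1 b2 b3 b4] w
    by (simp add: y1_def y2_def p)
  have "y1 \<notin> center"
  proof
    assume "y1 \<in> center"
    then have "a1 = 0 \<and> a2 = 0 \<and> a3 = 0 \<and> a4 = 0" unfolding y1_def by (rule frame_independent[OF fr dimU])
    then show False using nz p by (simp add: zero_prod_def)
  qed
  moreover have "y2 \<notin> span (insert y1 center)"
  proof
    assume "y2 \<in> span (insert y1 center)"
    then obtain k where "y2 - k *s y1 \<in> span center" by (auto simp: span_insert)
    then have "y2 - k *s y1 \<in> center" using subspace_center by (metis span_eq_iff)
    moreover have "y2 - k *s y1 = (b1 - k * a1) *s x1 + (b2 - k * a2) *s x2 + (b3 - k * a3) *s x3 + (b4 - k * a4) *s x4"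
      by (simp add: y1_def y2_def scale_left_diff_distrib scale_right_distrib algebra_simps)
    ultimately have "b1 - k * a1 = 0 \<and> b2 - k * a2 = 0 \<and> b3 - k * a3 = 0 \<and> b4 - k * a4 = 0"
      using frame_independent[OF fr dimU, of "b1 - k * a1" "b2 - k * a2" "b3 - k * a3" "b4 - k * a4"] by argo
    then show False using nz p by (simp add: zero_prod_def)
  qed
  ultimately show ?thesis using extend_to_frame[OF dimU] y12 by blast
qed

text \<open>Five brackets in a four-dimensional space are dependent. For commuting
  \<open>x1\<close>, \<open>x2\<close> this gives an element of K outside the line of their
  product.\<close>

lemma commuting_frame_relation:
  assumes d4: "dim derived = 4"
  shows "\<exists>p13 p14 p23 p24 p34. (p13, p14, p23, p24, p34) \<noteq> 0 \<and> wedge x1 x2 x3 x4 (0, p13, p14, p23, p24, p34) = 0"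
proof -
  let ?f = "\<lambda>(p13, p14, p23, p24, p34). wedge x1 x2 x3 x4 (0, p13, p14, p23, p24, p34)"
  have "\<not> inj ?f"
  proof
    assume inj: "inj ?f"
    have "range ?f \<subseteq> derived"
      using subspace_derived by (auto simp: wedge_def intro!: subspace_add subspace_scale bracket_in_derived)
    then have "card (UNIV :: ('k \<times> 'k \<times> 'k \<times> 'k \<times> 'k) set) \<le> card derived"
      by (rule card_inj_on_le[OF inj _ finite_set])
    then have "CARD('k) ^ 5 \<le> CARD('k) ^ 4"
      using d4 card_dim[OF subspace_derived] by (simp add: eval_nat_numeral)
    then show False using card_scalars by (subst (asm) power_increasing_iff) auto
  qed
  then obtain p p' where p: "?f p = ?f p'" "p \<noteq> p'" by (auto simp: inj_def)
  obtain a b c d e where abc: "p = (a, b, c, d, e)" by (rule prod_cases5)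
  obtain a' b' c' d' e' where abc': "p' = (a', b', c', d', e')" by (rule prod_cases5)
  have "wedge x1 x2 x3 x4 (0, a - a', b - b', c - c', d - d', e - e') = 0"
    using p(1) wedge_diff[of x1 x2 x3 x4 "(0, a, b, c, d, e)" "(0, a', b', c', d', e')"] by (simp add: abc abc')
  moreover have "(a - a', b - b', c - c', d - d', e - e') \<noteq> 0" using p(2) by (simp add: abc abc' zero_prod_def)
  ultimately show ?thesis by blast
qed

text \<open>A relation without 34 coordinate is orthogonal to the product of \<open>x1\<close> and
  \<open>x2\<close>, which also lies in K; so K is degenerate. Written as
  \<open>[x1,y1] + [x2,y2] = 0\<close>, the relation has the rank-one shape if \<open>y1\<close>,
  \<open>y2\<close> are independent and collapses to a single vanishing bracket otherwise.\<close>

lemma degenerate_frameI: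
  assumes fr: "frame x1 x2 x3 x4" and x12: "bracket x1 x2 = 0"
    and rel: "wedge x1 x2 x3 x4 (0, p13, p14, p23, p24, 0) = 0"
    and nz: "(p13, p14, p23, p24) \<noteq> 0"
  shows "\<exists>y1 y2 y3 y4. degenerate_frame y1 y2 y3 y4"
proof -
  have x21: "bracket x2 x1 = 0" using x12 by (rule bracket_eq_0_sym)
  define y1 where "y1 = p13 *s x3 + p14 *s x4"
  define y2 where "y2 = p23 *s x3 + p24 *s x4"
  have y: "bracket x1 y1 + bracket x2 y2 = 0"
    using rel by (simp add: wedge_def y1_def y2_def bracket_add_right bracket_scale_right algebra_simps)
  consider (reg) "p13 * p24 - p14 * p23 \<noteq> 0"
    | (c13) "p13 * p24 - p14 * p23 = 0" "p13 \<noteq> 0"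
    | (c14) "p13 * p24 - p14 * p23 = 0" "p13 = 0" "p14 \<noteq> 0"
    | (c23) "p13 = 0" "p14 = 0" "p23 \<noteq> 0"
    | (c24) "p13 = 0" "p14 = 0" "p23 = 0" "p24 \<noteq> 0"
    using nz unfolding zero_prod_def by blast
  then show ?thesis
  proof cases
    case reg
    define D where "D = p13 * p24 - p14 * p23"
    have D: "D \<noteq> 0" "p13 * p24 = D + p14 * p23" using reg by (simp_all add: D_def)
    have "frame x1 x2 y1 y2"
    \<comment> \<open>\<open>x3\<close> and \<open>x4\<close> are recovered from \<open>y1\<close>
      and \<open>y2\<close> by Cramer's rule.\<close>
    proof (rule frame_changeI[OF fr, of 1 _ 0 _ 0 _ 0 _ 0 1 0 0 0 0 "p24 / D" "- p14 / D" 0 0 "- p23 / D" "p13 / D"])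
      have "0 *s x1 + 0 *s x2 + (p24 / D) *s y1 + (- p14 / D) *s y2
          = ((p13 * p24 - p14 * p23) / D) *s x3 + ((p24 * p14 - p14 * p24) / D) *s x4"
        by (simp add: y1_def y2_def scale_right_distrib scale_left_diff_distrib diff_divide_distrib algebra_simps)
      then show "x3 = 0 *s x1 + 0 *s x2 + (p24 / D) *s y1 + (- p14 / D) *s y2" using reg by (simp add: D_def)
      have "0 *s x1 + 0 *s x2 + (- p23 / D) *s y1 + (p13 / D) *s y2
          = ((p13 * p23 - p13 * p23) / D) *s x3 + ((p13 * p24 - p14 * p23) / D) *s x4"
        by (simp add: y1_def y2_def scale_right_distrib scale_left_diff_distrib diff_divide_distrib algebra_simps)
      then show "x4 = 0 *s x1 + 0 *s x2 + (- p23 / D) *s y1 + (p13 / D) *s y2" using reg by (simp add: D_def)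
    qed simp_all
    then show ?thesis using x12 y unfolding degenerate_frame_def by blast
  next
    case c13
    define t where "t = p23 / p13"
    have t: "p23 = t * p13" "p24 = t * p14" using c13 by (simp_all add: t_def field_simps)
    \<comment> \<open>The relation becomes \<open>[x1 + t x2, y1] = 0\<close>, a second vanishing
      bracket with the first factor of \<open>[x1 + t x2, x2] = 0\<close>.\<close>
    have "y2 = t *s y1" by (simp add: y1_def y2_def t scale_right_distrib)
    then have "bracket (x1 + t *s x2) y1 = 0"
      using y by (simp add: bracket_add_left bracket_scale_left bracket_scale_right)
    moreover have "bracket (x1 + t *s x2) x2 = 0" by (simp add: bracket_add_left bracket_scale_left x12 bracket_self)
    moreover have "frame (x1 + t *s x2) x2 y1 x4"
      by (rule frame_changeI[OF fr, of 1 _ "- t" _ 0 _ 0 _ 0 1 0 0 0 0 "1 / p13" "- p14 / p13" 0 0 0 1])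
        (use c13(2) in \<open>simp_all add: y1_def scale_right_distrib\<close>)
    ultimately show ?thesis unfolding degenerate_frame_def by blast
  next
    case c14
    then have "p23 = 0" by simp
    note c14 = c14(2,3) this
    define t where "t = p24 / p14"
    have "y2 = t *s y1" using c14 by (simp add: y1_def y2_def t_def)
    then have "bracket (x1 + t *s x2) y1 = 0"
      using y by (simp add: bracket_add_left bracket_scale_left bracket_scale_right)
    moreover have "bracket (x1 + t *s x2) x2 = 0" by (simp add: bracket_add_left bracket_scale_left x12 bracket_self)
    moreover have "frame (x1 + t *s x2) x2 y1 x3"
      by (rule frame_changeI[OF fr, of 1 _ "- t" _ 0 _ 0 _ 0 1 0 0 0 0 0 1 0 0 "1 / p14" 0])
        (use c14 in \<open>simp_all add: y1_def scale_right_distrib\<close>)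
    ultimately show ?thesis unfolding degenerate_frame_def by blast
  next
    case c23
    have "bracket x2 y2 = 0" using y c23 by (simp add: y1_def)
    moreover have "frame x2 x1 y2 x4"
      by (rule frame_changeI[OF fr, of 0 _ 1 _ 0 _ 0 _ 1 0 0 0 0 0 "1 / p23" "- p24 / p23" 0 0 0 1])
        (use c23 in \<open>simp_all add: y2_def scale_right_distrib\<close>)
    ultimately show ?thesis using x21 unfolding degenerate_frame_def by blast
  next
    case c24
    have "bracket x2 y2 = 0" using y c24 by (simp add: y1_def)
    moreover have "frame x2 x1 y2 x3"
      by (rule frame_changeI[OF fr, of 0 _ 1 _ 0 _ 0 _ 1 0 0 0 0 0 0 1 0 0 "1 / p24" 0])
        (use c24 in \<open>simp_all add: y2_def scale_right_distrib\<close>)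
    ultimately show ?thesis using x21 unfolding degenerate_frame_def by blast
  qed
qed

text \<open>The coordinate \<open>p34\<close> of the second relation is its pairing with the product
  of \<open>x1\<close> and \<open>x2\<close> under the Klein form. If it vanishes, K is degenerate;
  otherwise K is hyperbolic, and its other isotropic line gives another commuting pair.\<close>

lemma commuting_frame_cases:
  assumes d4: "dim derived = 4" and fr: "frame x1 x2 x3 x4" and x12: "bracket x1 x2 = 0"
  shows "(\<exists>y1 y2 y3 y4. degenerate_frame y1 y2 y3 y4)
    \<or> (\<exists>y3 y4. frame x1 x2 y3 y4 \<and> bracket y3 y4 = 0)"
proof -
  obtain p13 p14 p23 p24 p34 where p: "(p13, p14, p23, p24, p34) \<noteq> 0"
    "wedge x1 x2 x3 x4 (0, p13, p14, p23, p24, p34) = 0"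
    using commuting_frame_relation[OF d4] by metis
  show ?thesis
  proof (cases "p34 = 0")
    case True
    then show ?thesis using degenerate_frameI[OF fr x12, of p13 p14 p23 p24] p by (simp add: zero_prod_def)
  next
    case False
    \<comment> \<open>The product of \<open>y3\<close> and \<open>y4\<close> is the relation up to a
      multiple of the product of \<open>x1\<close> and \<open>x2\<close>.\<close>
    define y3 where "y3 = x3 + (p14 / p34) *s x1 + (p24 / p34) *s x2"
    define y4 where "y4 = p34 *s x4 - p13 *s x1 - p23 *s x2"
    have "bracket y3 y4 = wedge x1 x2 x3 x4 (0, p13, p14, p23, p24, p34)"
      using False x12 bracket_eq_0_sym[OF x12] bracket_skew[of x1 x3] bracket_skew[of x2 x3]
      by (simp add: y3_def y4_def wedge_def bracket_add_left bracket_add_right bracket_diff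
          bracket_scale_left bracket_scale_right bracket_self algebra_simps)
    moreover have "frame x1 x2 y3 y4"
      by (rule frame_changeI[OF fr, of 1 _ 0 _ 0 _ 0 _ 0 1 0 0 "- p14 / p34" "- p24 / p34" 1 0 "p13 / p34" "p23 / p34" 0 "1 / p34"])
        (use False in \<open>simp_all add: y3_def y4_def scale_right_distrib scale_right_diff_distrib\<close>)
    ultimately show ?thesis using p(2) by metis
  qed
qed

theorem commutators_neq_derived_iff:
  assumes d4: "dim derived = 4" and dimU: "dim (UNIV :: 'v set) = dim center + 4"
  shows "commutators \<noteq> derived \<longleftrightarrow> (\<exists>x1 x2 x3 x4. degenerate_frame x1 x2 x3 x4)"
proof
  assume ne: "commutators \<noteq> derived"
  obtain x1 x2 x3 x4 where fr: "frame x1 x2 x3 x4" using exists_frame[OF dimU] by metis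
  have "\<exists>y1 y2 y3 y4. frame y1 y2 y3 y4 \<and> bracket y1 y2 = 0"
  proof (rule ccontr)
    assume no: "\<not> ?thesis"
    have "commutators = derived"
      by (rule anisotropic_frame_commutators[OF d4 fr]) (use commuting_frame[OF dimU fr] no in metis)
    then show False using ne by simp
  qed
  then obtain y1 y2 y3 y4 where "frame y1 y2 y3 y4" "bracket y1 y2 = 0" by metis
  from commuting_frame_cases[OF d4 this] show "\<exists>x1 x2 x3 x4. degenerate_frame x1 x2 x3 x4"
    using hyperbolic_frame_commutators[of y1 y2] \<open>bracket y1 y2 = 0\<close> ne by metis
qed (use degenerate_frame_noncommutator[OF d4] in metis)

text \<open>Three vectors modulo Z(L) have only three brackets, too few to span L'.\<close>

lemma four_le_codim_center:
  assumes d4: "dim derived = 4"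
  shows "dim center + 4 \<le> dim (UNIV :: 'v set)"
proof (rule ccontr)
  assume "\<not> ?thesis"
  then have le: "dim (UNIV :: 'v set) \<le> dim center + 3" by simp
  have step: "\<exists>x. dim (UNIV :: 'v set) \<le> dim (insert x S) + n" if "dim (UNIV :: 'v set) \<le> dim S + Suc n" for S n
  proof (cases "dim S < dim (UNIV :: 'v set)")
    case True
    then obtain x where "x \<notin> span S" using exists_notin_span by metis
    then show ?thesis using that by (intro exI[where x = x]) (simp add: dim_insert)
  next
    case False
    moreover have "dim S \<le> dim (insert x S)" for x by (rule dim_subset) auto
    ultimately show ?thesis by (metis add.commute le_add2 le_trans not_le)
  qed
  obtain x1 where x1: "dim (UNIV :: 'v set) \<le> dim (insert x1 center) + 2"
    using step[of center 2] le by auto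
  obtain x2 where x2: "dim (UNIV :: 'v set) \<le> dim (insert x2 (insert x1 center)) + 1"
    using step[of "insert x1 center" 1] x1 by auto
  obtain x3 where x3: "dim (UNIV :: 'v set) \<le> dim (insert x3 (insert x2 (insert x1 center)))"
    using step[of "insert x2 (insert x1 center)" 0] x2 by auto
  have "dim (insert x3 (insert x2 (insert x1 center))) = dim (UNIV :: 'v set)"
    using x3 dim_subset[OF subset_UNIV, of "insert x3 (insert x2 (insert x1 center))"] by simp
  then have full: "span (insert x3 (insert x2 (insert x1 center))) = UNIV" using dim_eq_full dim_UNIV dimension_def by metis
  \<comment> \<open>The vector 0 pads the triple to a frame, so that \<open>derived_wedge\<close>
    applies.\<close>
  have "insert x3 (insert x2 (insert x1 center)) = insert x1 (insert x2 (insert x3 (insert 0 center)))"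
    using subspace_0[OF subspace_center] by auto
  then have fr: "frame x1 x2 x3 0" using full by (simp add: frame_def)
  let ?f = "\<lambda>(a, b, c). a *s bracket x1 x2 + b *s bracket x1 x3 + c *s bracket x2 x3"
  have "derived \<subseteq> range ?f"
  proof
    fix v assume "v \<in> derived"
    then obtain p12 p13 p14 p23 p24 p34 where "v = wedge x1 x2 x3 0 (p12, p13, p14, p23, p24, p34)"
      by (rule derived_wedge[OF fr])
    then show "v \<in> range ?f" by (intro image_eqI[where x = "(p12, p13, p23)"]) (simp_all add: wedge_def)
  qed
  then have "card derived \<le> card (range ?f)" by (intro card_mono finite_set)
  also have "\<dots> \<le> card (UNIV :: ('k \<times> 'k \<times> 'k) set)" by (rule card_image_le) simp
  finally have "CARD('k) ^ 4 \<le> CARD('k) ^ 3"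
    using d4 card_dim[OF subspace_derived] by (simp add: eval_nat_numeral)
  then show False using card_scalars by (subst (asm) power_increasing_iff) auto
qed

section \<open>Nilpotency class\<close>

lemma bracket_in_bracket_space: "x \<in> A \<Longrightarrow> y \<in> B \<Longrightarrow> bracket x y \<in> bracket_space A B"
  unfolding bracket_space_def by (rule span_base) auto

lemma bracket_space_minimal:
  assumes "subspace S" "\<And>x y. x \<in> A \<Longrightarrow> y \<in> B \<Longrightarrow> bracket x y \<in> S"
  shows "bracket_space A B \<subseteq> S"
  unfolding bracket_space_def using assms by (intro span_minimal) auto

lemma bracket_space_mono: "B \<subseteq> B' \<Longrightarrow> bracket_space A B \<subseteq> bracket_space A B'"
  unfolding bracket_space_def by (rule span_mono) auto

lemma subspace_lower_central: "subspace (lower_central i)"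
  by (cases i) (simp_all add: bracket_space_def)

lemma lower_central_1: "lower_central (Suc 0) = derived"
  by (simp add: derived_def)

lemma lower_central_Suc_subset: "lower_central (Suc i) \<subseteq> lower_central i"
proof (induction i)
  case (Suc i)
  then show ?case using bracket_space_mono[of "lower_central (Suc i)" "lower_central i" UNIV] by simp
qed simp

lemma lower_central_antimono: "i \<le> j \<Longrightarrow> lower_central j \<subseteq> lower_central i"
  by (induction j rule: dec_induct) (use lower_central_Suc_subset in blast)+

lemma bracket_lower_central: "y \<in> lower_central i \<Longrightarrow> bracket x y \<in> lower_central (Suc i)"
  by (simp add: bracket_in_bracket_space)

text \<open>The inclusion propagates, so the term i lies in every later term, and one of these is
  zero.\<close>

lemma lower_central_stable:
  assumes nil: "nilpotent" and "lower_central i \<subseteq> lower_central (Suc i)"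
  shows "lower_central i = {0}"
proof -
  obtain n where n: "lower_central n = {0}" using nil by (auto simp: nilpotent_def)
  have "lower_central i \<subseteq> lower_central (i + k)" for k
  proof (induction k)
    case (Suc k)
    then have "lower_central (Suc i) \<subseteq> lower_central (Suc (i + k))" by (simp add: bracket_space_mono)
    then show ?case using assms(2) by simp
  qed simp
  moreover have "lower_central (i + n) \<subseteq> {0}" using lower_central_antimono[of n "i + n"] n by simp
  ultimately have "lower_central i \<subseteq> {0}" by (rule order_trans)
  then show ?thesis using subspace_0[OF subspace_lower_central[of i]] by auto
qed

text \<open>Dividing by the eigenvalue, \<open>w\<close> descends through the whole lower central
  series.\<close>

lemma no_eigenvector:
  assumes nil: "nilpotent" and w: "bracket x w = \<alpha> *s w" "\<alpha> \<noteq> 0"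
  shows "w = 0"
proof -
  obtain n where n: "lower_central n = {0}" using nil by (auto simp: nilpotent_def)
  have "w \<in> lower_central i" for i
  proof (induction i)
    case (Suc i)
    have "bracket x w \<in> lower_central (Suc i)" using Suc by (rule bracket_lower_central)
    then have "inverse \<alpha> *s bracket x w \<in> lower_central (Suc i)" by (rule subspace_scale[OF subspace_lower_central])
    then show ?case using w by simp
  qed simp
  from this[of n] n show ?thesis by simp
qed

lemma subspace_eq_span_insert:
  assumes "subspace S" "subspace T" "S \<subseteq> T" "x \<in> T" "x \<notin> S" "dim T \<le> dim S + 1"
  shows "span (insert x S) = T"
proof -
  have "x \<notin> span S" using assms(5) unfolding span_eq_iff[THEN iffD2, OF assms(1)] .
  then have "dim (span (insert x S)) = dim S + 1" by (simp add: dim_insert)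
  moreover have "span (insert x S) \<subseteq> T" using assms by (intro span_minimal) auto
  ultimately show ?thesis using assms(2,6) by (intro subspace_dim_equal) auto
qed

lemma span_insertE:
  assumes "v \<in> span (insert x S)" "subspace S"
  obtains c s where "s \<in> S" "v = c *s x + s"
proof -
  obtain c where "v - c *s x \<in> span S" using assms(1) by (auto simp: span_insert)
  then have "v - c *s x \<in> S" unfolding span_eq_iff[THEN iffD2, OF assms(2)] .
  then show ?thesis by (rule that[of _ c]) simp
qed

text \<open>Otherwise \<open>[x,u]\<close> is an eigenvector of \<open>ad x\<close> with nonzero eigenvalue.\<close>

lemma nilpotent_action_on_line:
  assumes nil: "nilpotent" and S: "subspace S" "S \<subseteq> center" and u: "u \<notin> S"
    and r: "bracket x u \<in> span (insert u S)"
  shows "bracket x u \<in> S"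
proof -
  obtain \<alpha> z where z: "z \<in> S" "bracket x u = \<alpha> *s u + z" using r S(1) by (rule span_insertE)
  have "\<alpha> = 0"
  proof (rule ccontr)
    assume \<alpha>: "\<alpha> \<noteq> 0"
    have "z \<in> center" using z(1) S(2) by (rule subsetD[rotated])
    then have "bracket x (\<alpha> *s u + z) = \<alpha> *s bracket x u"
      by (simp add: bracket_add_right bracket_scale_right centerD)
    then have "bracket x (bracket x u) = \<alpha> *s bracket x u" by (simp only: z(2))
    then have "bracket x u = 0" using \<alpha> by (rule no_eigenvector[OF nil])
    then have "\<alpha> *s u = - z" using z(2) by (simp add: eq_neg_iff_add_eq_0)
    then have "\<alpha> *s u \<in> S" using subspace_neg[OF S(1) z(1)] by simp
    then have "inverse \<alpha> *s (\<alpha> *s u) \<in> S" by (rule subspace_scale[OF S(1)])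
    then show False using u \<alpha> by simp
  qed
  then show ?thesis using z by simp
qed

lemma bracket_in_center_sym: "bracket x y \<in> center \<Longrightarrow> bracket y x \<in> center"
  using subspace_neg[OF subspace_center, of "bracket x y"] bracket_skew[of y x] by simp

text \<open>By Jacobi \<open>[c,[x,y]] = [[c,x],y] + [x,[c,y]]\<close>, and the inner brackets with
  \<open>c\<close> are central.\<close>

lemma commutes_with_derived:
  assumes "\<And>x. bracket c x \<in> center" "v \<in> derived"
  shows "bracket c v = 0"
proof -
  have "derived \<subseteq> {v. bracket c v = 0}"
  proof (rule derived_minimal)
    show "subspace {v. bracket c v = 0}" by (rule subspaceI) (simp_all add: bracket_add_right bracket_scale_right)
    show "bracket x y \<in> {v. bracket c v = 0}" for x y
      using bracket_jacobi[of c x y] centerD(1)[OF assms(1)[of x]] centerD(2)[OF assms(1)[of y]] by simp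
  qed
  then show ?thesis using assms(2) by auto
qed

lemma derived_not_subset_lower_central_2:
  assumes "nilpotent" "dim derived = 4"
  shows "\<not> derived \<subseteq> lower_central 2"
proof
  assume "derived \<subseteq> lower_central 2"
  then have "lower_central (Suc 0) = {0}"
    by (intro lower_central_stable[OF assms(1)]) (simp only: lower_central_1 numeral_2_eq_2)
  then show False using assms(2) by (simp only: lower_central_1) simp
qed

text \<open>Modulo [L,L'] a bracket depends only on classes modulo L', here through a
  determinant.\<close>

lemma bracket_decompose_lower_central_2:
  assumes "d \<in> derived" "d' \<in> derived"
  shows "\<exists>r\<in>lower_central 2. bracket (a *s x + b *s y + d) (a' *s x + b' *s y + d') = (a * b' - b * a') *s bracket x y + r"
proof -
  have l2: "bracket x v \<in> lower_central 2" "bracket v x \<in> lower_central 2" if "v \<in> derived" for x v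
  proof -
    have v: "v \<in> lower_central (Suc 0)" unfolding lower_central_1 by (rule that)
    show l: "bracket x v \<in> lower_central 2" using bracket_lower_central[OF v, of x] by (simp only: numeral_2_eq_2)
    show "bracket v x \<in> lower_central 2"
      using subspace_neg[OF subspace_lower_central l] bracket_skew[of v x] by simp
  qed
  let ?r = "a *s bracket x d' + b *s bracket y d' + a' *s bracket d x + b' *s bracket d y + bracket d d'"
  have "?r \<in> lower_central 2"
    using subspace_lower_central by (intro subspace_add subspace_scale l2 assms)
  moreover have "bracket (a *s x + b *s y + d) (a' *s x + b' *s y + d') = (a * b' - b * a') *s bracket x y + ?r"
    using bracket_skew[of x y]
    by (simp add: bracket_add_left bracket_add_right bracket_scale_left bracket_scale_right bracket_self
        scale_left_diff_distrib scale_right_distrib scale_right_diff_distrib mult.commute)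
  ultimately show ?thesis by metis
qed

text \<open>If L/L' had dimension at most one, every bracket would lie in [L,L'], and nilpotency
  would force L' = 0.\<close>

lemma two_generators_needed:
  assumes nil: "nilpotent" and d4: "dim derived = 4"
  shows "6 \<le> dim (UNIV :: 'v set)"
proof (rule ccontr)
  assume "\<not> ?thesis"
  then have le: "dim (UNIV :: 'v set) \<le> dim derived + 1" using d4 by simp
  have "\<exists>x. span (insert x derived) = UNIV"
  proof (cases "derived = UNIV")
    case False
    then obtain x where "x \<notin> derived" by auto
    then have "span (insert x derived) = UNIV"
      using le by (intro subspace_eq_span_insert subspace_derived) auto
    then show ?thesis by metis
  qed (simp add: insert_absorb)
  then obtain x where x: "span (insert x derived) = UNIV" by metis
  have "derived \<subseteq> lower_central 2"
  proof (rule derived_minimal[OF subspace_lower_central])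
    fix u v
    have mem: "w \<in> span (insert x derived)" for w using x by simp
    obtain a d where u: "d \<in> derived" "u = a *s x + d" using mem subspace_derived by (rule span_insertE)
    obtain a' d' where v: "d' \<in> derived" "v = a' *s x + d'" using mem subspace_derived by (rule span_insertE)
    show "bracket u v \<in> lower_central 2"
      \<comment> \<open>The second direction is taken to be 0, so only the remainder in [L,L'] is
        left.\<close>
      using bracket_decompose_lower_central_2[OF u(1) v(1), of a x 0 0 a' 0] u(2) v(2) by auto
  qed
  then show False using derived_not_subset_lower_central_2[OF nil d4] by simp
qed

text \<open>L' exceeds Z(L) by one line, so the bracket modulo Z(L) is an alternating form on the
  three-dimensional L/L'. Its rank is at most two, and a vector of its radical outside L' joins
  \<open>u\<close> in a degenerate frame.\<close>

lemma center_dim_3: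
  assumes nil: "nilpotent" and d4: "dim derived = 4" and sub: "center \<subseteq> derived"
    and dimU: "dim (UNIV :: 'v set) = dim center + 4" and z3: "dim center = 3"
  shows "step_nilpotent 3" and "\<exists>x1 x2 x3 x4. degenerate_frame x1 x2 x3 x4"
proof -
  have "center \<noteq> derived" using z3 d4 by auto
  then obtain u where u: "u \<in> derived" "u \<notin> center" using sub by auto
  have du: "span (insert u center) = derived"
    using u z3 d4 sub by (intro subspace_eq_span_insert subspace_center subspace_derived) auto
  have ad_u: "bracket x u \<in> center" for x
    using nil subspace_center order_refl u(2) by (rule nilpotent_action_on_line) (simp add: du bracket_in_derived)
  have ad_derived: "bracket x v \<in> center" if "v \<in> derived" for x v
  proof -
    have "v \<in> span (insert u center)" using that du by simp
    then obtain c z where "z \<in> center" "v = c *s u + z" using subspace_center by (rule span_insertE)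
    then show ?thesis
      by (simp add: bracket_add_right bracket_scale_right centerD ad_u subspace_scale[OF subspace_center])
  qed
  have l2: "lower_central 2 \<subseteq> center"
    unfolding numeral_2_eq_2 lower_central.simps(2)[of "Suc 0"] lower_central_1
    by (rule bracket_space_minimal[OF subspace_center]) (rule ad_derived)
  have "lower_central 3 \<subseteq> {0}"
    unfolding numeral_3_eq_3 lower_central.simps(2)[of "Suc (Suc 0)"]
    using l2 by (intro bracket_space_minimal subspace_single_0) (auto simp: numeral_2_eq_2 dest!: subsetD intro: centerD)
  moreover have "lower_central 2 \<noteq> {0}"
  proof
    assume l20: "lower_central 2 = {0}"
    have "bracket x v = 0" if "v \<in> derived" for x v
    proof -
      have "bracket x v \<in> lower_central (Suc (Suc 0))"
        using that by (intro bracket_lower_central) (simp only: lower_central_1)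
      then show ?thesis using l20 by (simp only: numeral_2_eq_2) simp
    qed
    then have "bracket u x = 0" for x using u(1) bracket_eq_0_sym by metis
    then show False using u(2) by (simp add: center_def)
  qed
  ultimately show "step_nilpotent 3"
    using subspace_0[OF subspace_lower_central[of 3]] unfolding step_nilpotent_def by auto
  obtain f where f: "functional f" "f u = 1" "\<forall>s\<in>center. f s = 0"
    using separating_functional[OF subspace_center u(2)] by auto
  define \<beta> where "\<beta> = (\<lambda>x y. f (bracket x y))"
  have form: "alternating_form \<beta>"
    using functionalD[OF f(1)] unfolding alternating_form_def \<beta>_def
    by (simp add: bracket_add_left bracket_add_right bracket_scale_left bracket_scale_right bracket_self)
  have f_derived: "v \<in> center" if "v \<in> derived" "f v = 0" for v
  proof -
    have "v \<in> span (insert u center)" using that(1) du by simp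
    then obtain c z where v: "z \<in> center" "v = c *s u + z" using subspace_center by (rule span_insertE)
    then have "c = 0" using that(2) f functionalD[OF f(1)] by simp
    then show ?thesis using v by simp
  qed
  have derived_rad: "derived \<subseteq> radical \<beta>"
  proof
    fix v assume v: "v \<in> derived"
    have "\<beta> v y = 0" for y
      using bspec[OF f(3) bracket_in_center_sym[OF ad_derived[OF v]]] by (simp add: \<beta>_def)
    then show "v \<in> radical \<beta>" by (simp add: radical_def fun_eq_iff)
  qed
  have cU: "card (UNIV :: 'v set) = CARD('k) ^ 3 * card derived"
    using card_dim[OF subspace_UNIV] card_dim[OF subspace_derived] dimU z3 d4 by (simp flip: power_add)
  have pos: "card derived > 0" using finite_set subspace_0[OF subspace_derived] by (auto simp: card_gt_0_iff)
  have le: "card derived \<le> card (radical \<beta>)" by (rule card_mono[OF finite_set derived_rad])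
  \<comment> \<open>Rank four or more needs a radical of codimension at least 4, but the radical
    contains L', of codimension 3.\<close>
  have dec: "decomposable \<beta>"
  proof (rule ccontr)
    assume "\<not> decomposable \<beta>"
    then have "card (radical \<beta>) * CARD('k) ^ 4 \<le> card (UNIV :: 'v set)"
      by (rule card_radical_le4[OF finite_UNIV form])
    then have "card derived * CARD('k) ^ 4 \<le> CARD('k) ^ 3 * card derived"
      using mult_le_mono1[OF le, of "CARD('k) ^ 4"] cU by linarith
    then show False using pos card_scalars by (simp add: eval_nat_numeral)
  qed
  have "CARD('k) ^ 3 * card derived \<le> (CARD('k))\<^sup>2 * card (radical \<beta>)"
    using card_inter_radical[OF finite_UNIV subspace_UNIV form dec] cU by simp
  then have "CARD('k) * card derived \<le> card (radical \<beta>)"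
    by (simp add: power2_eq_square power3_eq_cube)
  then have "\<not> card (radical \<beta>) \<le> card derived"
    using pos card_scalars mult_le_mono1[of 3 "CARD('k)" "card derived"] by linarith
  then have "\<not> radical \<beta> \<subseteq> derived" using card_mono[OF finite_set] by metis
  then obtain c where c: "c \<in> radical \<beta>" "c \<notin> derived" by auto
  have ad_c: "bracket c x \<in> center" for x
  proof (rule f_derived[OF bracket_in_derived])
    have "\<beta> c = 0" using c(1) by (simp add: radical_def)
    then have "\<beta> c x = 0" by simp
    then show "f (bracket c x) = 0" by (simp only: \<beta>_def)
  qed
  obtain y3 y4 where fr: "frame u c y3 y4"
    using extend_to_frame[OF dimU u(2), of c] c(2) du by auto
  have uc: "bracket u c = 0" using commutes_with_derived[OF ad_c u(1)] by (rule bracket_eq_0_sym)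
  obtain p13 p14 p23 p24 p34 where p: "(p13, p14, p23, p24, p34) \<noteq> 0"
    "wedge u c y3 y4 (0, p13, p14, p23, p24, p34) = 0"
    using commuting_frame_relation[OF d4] by metis
  have fu: "f (bracket u x) = 0" "f (bracket c x) = 0" for x
    using bspec[OF f(3) bracket_in_center_sym[OF ad_u]] bspec[OF f(3) ad_c] by simp_all
  have f_wedge: "f (wedge u c y3 y4 (q12, q13, q14, q23, q24, q34)) = q34 * f (bracket y3 y4)" for q12 q13 q14 q23 q24 q34
    by (simp add: wedge_def functionalD[OF f(1)] fu)
  \<comment> \<open>On brackets of the frame \<open>f\<close> sees only \<open>[y3,y4]\<close>, and
    it is 1 at \<open>u\<close>, which lies in L'. Applied to the second relation it then gives
    \<open>p34 = 0\<close>.\<close>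
  have "f (bracket y3 y4) \<noteq> 0"
  proof
    assume z: "f (bracket y3 y4) = 0"
    obtain q12 q13 q14 q23 q24 q34 where "u = wedge u c y3 y4 (q12, q13, q14, q23, q24, q34)"
      using derived_wedge[OF fr u(1)] .
    then have "f u = q34 * f (bracket y3 y4)" using f_wedge by metis
    then show False using z f(2) by simp
  qed
  moreover have "p34 * f (bracket y3 y4) = 0"
    using f_wedge[of 0 p13 p14 p23 p24 p34] p(2) functionalD(3)[OF f(1)] by simp
  ultimately have "p34 = 0" by simp
  then show "\<exists>x1 x2 x3 x4. degenerate_frame x1 x2 x3 x4"
    using degenerate_frameI[OF fr uc, of p13 p14 p23 p24] p by (simp add: zero_prod_def)
qed

text \<open>The quotients of the chain L, L', [L,L'], Z(L) have dimensions 2, 1, 1, represented by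
  \<open>x\<close> and \<open>y\<close>, by \<open>u = [x,y]\<close> and by \<open>v\<close>. Some
  \<open>y'\<close> outside L' has central bracket with \<open>u\<close>; Jacobi makes it commute
  with \<open>v\<close>, and \<open>v\<close> also commutes with \<open>u\<close>, which gives the
  totally isotropic case.\<close>

lemma center_dim_2:
  assumes nil: "nilpotent" and d4: "dim derived = 4" and sub: "center \<subseteq> derived"
    and dimU: "dim (UNIV :: 'v set) = dim center + 4" and z2: "dim center = 2"
  shows "step_nilpotent 4" and "\<exists>x1 x2 x3 x4. degenerate_frame x1 x2 x3 x4"
proof -
  let ?L2 = "lower_central 2" and ?L3 = "lower_central 3"
  have d6: "dim (UNIV :: 'v set) = 6" using dimU z2 by simp
  have L2_eq: "?L2 = bracket_space UNIV derived"
    unfolding numeral_2_eq_2 lower_central.simps(2)[of "Suc 0"] lower_central_1 ..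
  have L3_eq: "?L3 = bracket_space UNIV ?L2"
    unfolding numeral_3_eq_3 lower_central.simps(2)[of "Suc (Suc 0)"] numeral_2_eq_2 ..
  have L4_eq: "lower_central 4 = bracket_space UNIV ?L3"
    using lower_central.simps(2)[of 3] by (simp add: eval_nat_numeral)
  have L2_sub: "?L2 \<subseteq> derived"
    unfolding L2_eq by (rule bracket_space_minimal[OF subspace_derived]) (rule bracket_in_derived)
  have L32: "?L3 \<subseteq> ?L2" using lower_central_Suc_subset[of 2] by (simp add: eval_nat_numeral)
  have sL2: "subspace ?L2" by (rule subspace_lower_central)
  have "derived \<noteq> UNIV" using d4 d6 by auto
  then obtain x where x: "x \<notin> derived" by auto
  then have "x \<notin> span derived" unfolding span_eq_iff[THEN iffD2, OF subspace_derived] .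
  then have d5: "dim (insert x derived) = 5" using d4 by (simp add: dim_insert)
  obtain y where y_notin: "y \<notin> span (insert x derived)"
    using exists_notin_span[of "insert x derived"] d5 d6 by auto
  have xy: "span (insert y (span (insert x derived))) = UNIV"
    using y_notin d5 d6 by (intro subspace_eq_span_insert) auto
  have decomp: "\<exists>a b d. d \<in> derived \<and> v = a *s x + b *s y + d" for v
  proof -
    have "v \<in> span (insert y (span (insert x derived)))" using xy by simp
    then obtain b s where s: "s \<in> span (insert x derived)" "v = b *s y + s"
      using subspace_span by (rule span_insertE)
    obtain a d where "d \<in> derived" "s = a *s x + d" using s(1) subspace_derived by (rule span_insertE)
    then have "d \<in> derived \<and> v = a *s x + b *s y + d" using s(2) by simp
    then show ?thesis by metis
  qed
  define u where "u = bracket x y"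
  have u: "u \<in> derived" by (simp add: u_def bracket_in_derived)
  have derived_sub: "derived \<subseteq> span (insert u ?L2)"
  proof (rule derived_minimal[OF subspace_span])
    fix v w
    obtain a b d where v: "d \<in> derived" "v = a *s x + b *s y + d" using decomp by metis
    obtain a' b' d' where w: "d' \<in> derived" "w = a' *s x + b' *s y + d'" using decomp by metis
    obtain r where "r \<in> ?L2" "bracket v w = (a * b' - b * a') *s u + r"
      using bracket_decompose_lower_central_2[OF v(1) w(1)] unfolding v(2) w(2) u_def by metis
    then show "bracket v w \<in> span (insert u ?L2)"
      by (auto intro!: span_add span_scale intro: span_base)
  qed
  have uL2: "u \<notin> ?L2"
  proof
    assume "u \<in> ?L2"
    then have "derived \<subseteq> span ?L2" using derived_sub by (simp add: insert_absorb)
    then have "derived \<subseteq> ?L2" unfolding span_eq_iff[THEN iffD2, OF sL2] .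
    then show False using derived_not_subset_lower_central_2[OF nil d4] by simp
  qed
  then have "u \<notin> span ?L2" unfolding span_eq_iff[THEN iffD2, OF sL2] .
  moreover have "span (insert u ?L2) = derived"
    using derived_sub u L2_sub by (intro subset_antisym span_minimal subspace_derived) auto
  moreover have "dim (span (insert u ?L2)) = dim (insert u ?L2)" by (rule dim_span)
  ultimately have dL2: "dim ?L2 = 3" using d4 by (simp add: dim_insert)
  have L20: "?L2 \<noteq> {0}" using dL2 by auto
  \<comment> \<open>A central vector outside [L,L'] would span L' modulo [L,L'] while contributing
    nothing to [L,L'], so the series would be stationary there.\<close>
  have Z_L2: "center \<subseteq> ?L2"
  proof (rule ccontr)
    assume "\<not> center \<subseteq> ?L2"
    then obtain z where z: "z \<in> center" "z \<notin> ?L2" by auto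
    have dz: "span (insert z ?L2) = derived"
      using z sub L2_sub dL2 d4 by (intro subspace_eq_span_insert sL2 subspace_derived) auto
    have "?L2 \<subseteq> ?L3"
      unfolding L2_eq
    proof (rule bracket_space_minimal[OF subspace_lower_central])
      fix g v assume "v \<in> derived"
      then have "v \<in> span (insert z ?L2)" using dz by simp
      then obtain c s where s: "s \<in> ?L2" "v = c *s z + s" using sL2 by (rule span_insertE)
      then have "bracket g v = bracket g s"
        by (simp add: bracket_add_right bracket_scale_right centerD[OF z(1)])
      then show "bracket g v \<in> ?L3" using s(1) unfolding L3_eq by (simp add: bracket_in_bracket_space)
    qed
    then have "?L2 = {0}" by (intro lower_central_stable[OF nil]) (simp add: eval_nat_numeral)
    then show False using L20 by simp
  qed
  have "center \<noteq> ?L2" using dL2 z2 by auto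
  then obtain v where v: "v \<in> ?L2" "v \<notin> center" using Z_L2 by auto
  have sv: "span (insert v center) = ?L2"
    using v Z_L2 dL2 z2 by (intro subspace_eq_span_insert subspace_center sL2) auto
  have ad_v: "bracket g v \<in> center" for g
  proof (rule nilpotent_action_on_line[OF nil subspace_center order_refl v(2)])
    have "bracket g v \<in> ?L3" using v(1) unfolding L3_eq by (simp add: bracket_in_bracket_space)
    then show "bracket g v \<in> span (insert v center)" using L32 sv by auto
  qed
  have ad_L2: "bracket g s \<in> center" if "s \<in> ?L2" for g s
  proof -
    have "s \<in> span (insert v center)" using that sv by simp
    then obtain c z where "z \<in> center" "s = c *s v + z" using subspace_center by (rule span_insertE)
    then show ?thesis
      by (simp add: bracket_add_right bracket_scale_right centerD ad_v subspace_scale[OF subspace_center])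
  qed
  have L3_Z: "?L3 \<subseteq> center"
    unfolding L3_eq by (rule bracket_space_minimal[OF subspace_center]) (rule ad_L2)
  have "lower_central 4 \<subseteq> {0}"
    unfolding L4_eq by (rule bracket_space_minimal[OF subspace_single_0]) (use L3_Z centerD in auto)
  moreover have "?L3 \<noteq> {0}"
  proof
    assume L30: "?L3 = {0}"
    have "bracket g v = 0" for g
    proof -
      have "bracket g v \<in> ?L3" using v(1) unfolding L3_eq by (simp add: bracket_in_bracket_space)
      then show ?thesis using L30 by simp
    qed
    then have "bracket v g = 0" for g using bracket_eq_0_sym by metis
    then show False using v(2) by (simp add: center_def)
  qed
  ultimately show "step_nilpotent 4"
    using subspace_0[OF subspace_lower_central[of 4]] unfolding step_nilpotent_def by auto
  have v_derived: "bracket v s = 0" if "s \<in> derived" for s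
  proof (rule commutes_with_derived[OF _ that])
    show "bracket v g \<in> center" for g by (rule bracket_in_center_sym[OF ad_v])
  qed
  have gu: "bracket g u \<in> span (insert v center)" for g
    using u sv unfolding L2_eq by (simp add: bracket_in_bracket_space)
  obtain \<alpha> z\<alpha> where \<alpha>: "z\<alpha> \<in> center" "bracket x u = \<alpha> *s v + z\<alpha>" using gu subspace_center by (rule span_insertE)
  obtain \<beta> z\<beta> where \<beta>: "z\<beta> \<in> center" "bracket y u = \<beta> *s v + z\<beta>" using gu subspace_center by (rule span_insertE)
  \<comment> \<open>If both vanished, [L,L'] would be central, against the choice of
    \<open>v\<close>.\<close>
  have nz: "\<alpha> \<noteq> 0 \<or> \<beta> \<noteq> 0"
  proof (rule ccontr)
    assume "\<not> ?thesis"
    then have xu: "bracket x u \<in> center" "bracket y u \<in> center" using \<alpha> \<beta> by simp_all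
    have "?L2 \<subseteq> center"
      unfolding L2_eq
    proof (rule bracket_space_minimal[OF subspace_center])
      fix g s assume s: "s \<in> derived"
      obtain a b d where g: "d \<in> derived" "g = a *s x + b *s y + d" using decomp by metis
      have du: "bracket d u \<in> center"
      proof -
        have "d \<in> span (insert u ?L2)" using derived_sub g(1) by auto
        then obtain c r where r: "r \<in> ?L2" "d = c *s u + r" using sL2 by (rule span_insertE)
        have "bracket r u = - bracket u r" by (rule bracket_skew)
        then show ?thesis
          using subspace_neg[OF subspace_center ad_L2[OF r(1), of u]]
          by (simp add: r(2) bracket_add_left bracket_scale_left bracket_self)
      qed
      have gu: "bracket g u \<in> center"
        unfolding g(2) bracket_add_left bracket_scale_left
        using subspace_center xu du by (intro subspace_add subspace_scale)
      have "s \<in> span (insert u ?L2)" using derived_sub s by auto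
      then obtain c r where r: "r \<in> ?L2" "s = c *s u + r" using sL2 by (rule span_insertE)
      show "bracket g s \<in> center"
        unfolding r(2) bracket_add_right bracket_scale_right
        using subspace_center gu ad_L2[OF r(1)] by (intro subspace_add subspace_scale)
    qed
    then show False using v by auto
  qed
  \<comment> \<open>The combination of \<open>x\<close> and \<open>y\<close> whose bracket with
    \<open>u\<close> has no \<open>v\<close> component.\<close>
  define y' where "y' = \<beta> *s x - \<alpha> *s y"
  have y'u: "bracket y' u \<in> center"
  proof -
    have "bracket y' u = \<beta> *s z\<alpha> - \<alpha> *s z\<beta>"
      by (simp add: y'_def bracket_diff bracket_scale_left \<alpha>(2) \<beta>(2) scale_right_distrib mult.commute)
    then show ?thesis using \<alpha>(1) \<beta>(1) subspace_center by (simp add: subspace_diff subspace_scale)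
  qed
  \<comment> \<open>Both Jacobi terms vanish: \<open>[[y',g],u]\<close> is a multiple of
    \<open>[u,u]\<close>, and \<open>[y',u]\<close> is central.\<close>
  have y'gu: "bracket y' (bracket g u) = 0" if "bracket y' g = c *s u" for g c
    using bracket_jacobi[of y' g u] that centerD(2)[OF y'u] by (simp add: bracket_scale_left bracket_self)
  have "bracket y' x = \<alpha> *s u" "bracket y' y = \<beta> *s u"
    using bracket_skew[of y x] by (simp_all add: y'_def bracket_diff bracket_scale_left bracket_self u_def)
  from y'gu[OF this(1)] y'gu[OF this(2)]
  have "\<alpha> *s bracket y' v = 0" "\<beta> *s bracket y' v = 0"
    by (simp_all add: \<alpha> \<beta> bracket_add_right bracket_scale_right centerD)
  then have y'v: "bracket y' v = 0" using nz by auto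
  have y'_derived: "y' \<notin> derived"
  proof
    assume d: "y' \<in> derived"
    show False
    proof (cases "\<alpha> = 0")
      case True
      then have "x = inverse \<beta> *s y'" using nz by (simp add: y'_def)
      then show False using x d subspace_scale[OF subspace_derived] by simp
    next
      case False
      then have y: "y = inverse \<alpha> *s (\<beta> *s x - y')" by (simp add: y'_def)
      have "\<beta> *s x - y' \<in> span (insert x derived)"
        using d by (intro span_diff span_scale span_base) simp_all
      then have "inverse \<alpha> *s (\<beta> *s x - y') \<in> span (insert x derived)" by (rule span_scale)
      then show False using y_notin unfolding y[symmetric] by simp
    qed
  qed
  have "insert u (insert v center) \<subseteq> derived" using u v(1) L2_sub sub by auto
  then have "span (insert u (insert v center)) \<subseteq> derived" by (rule span_minimal[OF _ subspace_derived])
  then have "y' \<notin> span (insert u (insert v center))" using y'_derived by (rule contra_subsetD)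
  moreover have "u \<notin> span (insert v center)" unfolding sv by (rule uL2)
  ultimately have "\<exists>y4. frame v u y' y4" by (intro extend_to_frame3[OF dimU v(2)])
  then obtain y4 where "frame v u y' y4" ..
  moreover have "bracket v u = 0" using v_derived[OF u] .
  moreover have "bracket v y' = 0" using y'v by (rule bracket_eq_0_sym)
  ultimately have "degenerate_frame v u y' y4" by (simp add: degenerate_frame_def)
  then show "\<exists>x1 x2 x3 x4. degenerate_frame x1 x2 x3 x4" by metis
qed

section \<open>Breadth type\<close>

lemma subspace_centralizer: "subspace {y. bracket x y = 0}"
  by (rule subspaceI) (simp_all add: bracket_add_right bracket_scale_right)

lemma dim_centralizer: "dim {y. bracket x y = 0} + breadth x = dim (UNIV :: 'v set)"
proof -
  have "card (UNIV :: 'v set) = card {y \<in> UNIV. bracket x y = 0} * card (range (bracket x))"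
    by (rule card_additive_kernel[OF finite_UNIV]) (simp_all add: bracket_diff)
  then have "CARD('k) ^ dim (UNIV :: 'v set) = CARD('k) ^ (dim {y. bracket x y = 0} + breadth x)"
    using card_dim[OF subspace_UNIV] card_dim[OF subspace_centralizer[of x]] card_dim[OF subspace_range_bracket[of x]]
    by (simp add: breadth_def power_add)
  then show ?thesis using card_scalars by (subst (asm) power_inject_exp) auto
qed

lemma breadth_eq_0_iff: "breadth x = 0 \<longleftrightarrow> x \<in> center"
proof
  assume "x \<in> center"
  then have "{y. bracket x y = 0} = UNIV" by (simp add: center_def)
  then show "breadth x = 0" using dim_centralizer[of x] by simp
next
  assume "breadth x = 0"
  then have "CARD('k) ^ dim {y. bracket x y = 0} = CARD('k) ^ dim (UNIV :: 'v set)"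
    using dim_centralizer[of x] by simp
  then have "card {y. bracket x y = 0} = card (UNIV :: 'v set)"
    using card_dim[OF subspace_UNIV] card_dim[OF subspace_centralizer[of x]] by simp
  then have "{y. bracket x y = 0} = UNIV" by (intro card_subset_eq finite_UNIV) auto
  then show "x \<in> center" by (auto simp: center_def)
qed

lemma center_subset_centralizer: "insert x center \<subseteq> {y. bracket x y = 0}"
  by (auto simp: bracket_self centerD)

lemma exists_in_subspace_notin_span:
  assumes "subspace C" "dim S < dim C"
  shows "\<exists>y\<in>C. y \<notin> span S"
proof (rule ccontr)
  assume "\<not> ?thesis"
  then have "C \<subseteq> span S" by auto
  then have "dim C \<le> dim (span S)" by (rule dim_subset)
  then show False using assms(2) by simp
qed

lemma dim_insert_center:
  assumes "x \<notin> center"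
  shows "dim (insert x center) = dim center + 1"
proof -
  have "x \<notin> span center" unfolding span_eq_iff[THEN iffD2, OF subspace_center] by (rule assms)
  then show ?thesis by (simp add: dim_insert)
qed

lemma dim_le_breadth:
  fixes g :: "'c::finite \<Rightarrow> 'v"
  assumes "inj (\<lambda>p. bracket x (g p))" "card (UNIV :: 'c set) = CARD('k) ^ n"
  shows "n \<le> breadth x"
proof -
  have "card (UNIV :: 'c set) \<le> card (range (bracket x))"
    using assms(1) by (rule card_inj_on_le[OF _ _ finite_set]) auto
  then have "CARD('k) ^ n \<le> CARD('k) ^ breadth x"
    using assms(2) card_dim[OF subspace_range_bracket[of x]] by (simp add: breadth_def)
  then show ?thesis using card_scalars by (subst (asm) power_increasing_iff) auto
qed

lemma breadth_ge_2:
  assumes "\<And>a b. a *s bracket x y + b *s bracket x z = 0 \<Longrightarrow> a = 0 \<and> b = 0"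
  shows "2 \<le> breadth x"
proof (rule dim_le_breadth[where g = "\<lambda>(a, b). a *s y + b *s z"])
  show "inj (\<lambda>p. bracket x (case p of (a, b) \<Rightarrow> a *s y + b *s z))"
  proof (rule injI)
    fix p p' assume e: "bracket x (case p of (a, b) \<Rightarrow> a *s y + b *s z) = bracket x (case p' of (a, b) \<Rightarrow> a *s y + b *s z)"
    obtain a b where p: "p = (a, b)" by (cases p)
    obtain a' b' where p': "p' = (a', b')" by (cases p')
    have "(a - a') *s bracket x y + (b - b') *s bracket x z = 0"
      using e by (simp add: p p' bracket_add_right bracket_scale_right scale_left_diff_distrib algebra_simps)
    then have "a - a' = 0 \<and> b - b' = 0" by (rule assms)
    then show "p = p'" by (simp add: p p')
  qed
  show "card (UNIV :: ('k \<times> 'k) set) = CARD('k)\<^sup>2" by (simp add: power2_eq_square)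
qed

lemma breadth_ge_3:
  assumes "\<And>a b c. a *s bracket x y + b *s bracket x z + c *s bracket x w = 0 \<Longrightarrow> a = 0 \<and> b = 0 \<and> c = 0"
  shows "3 \<le> breadth x"
proof (rule dim_le_breadth[where g = "\<lambda>(a, b, c). a *s y + b *s z + c *s w"])
  show "inj (\<lambda>p. bracket x (case p of (a, b, c) \<Rightarrow> a *s y + b *s z + c *s w))"
  proof (rule injI)
    fix p p' assume e: "bracket x (case p of (a, b, c) \<Rightarrow> a *s y + b *s z + c *s w)
      = bracket x (case p' of (a, b, c) \<Rightarrow> a *s y + b *s z + c *s w)"
    obtain a b c where p: "p = (a, b, c)" by (rule prod_cases3)
    obtain a' b' c' where p': "p' = (a', b', c')" by (rule prod_cases3)
    have "(a - a') *s bracket x y + (b - b') *s bracket x z + (c - c') *s bracket x w = 0"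
      using e by (simp add: p p' bracket_add_right bracket_scale_right scale_left_diff_distrib algebra_simps)
    then have "a - a' = 0 \<and> b - b' = 0 \<and> c - c' = 0" by (rule assms)
    then show "p = p'" by (simp add: p p')
  qed
  show "card (UNIV :: ('k \<times> 'k \<times> 'k) set) = CARD('k) ^ 3" by (simp add: power3_eq_cube)
qed

section \<open>Breadths and generating sets when L/Z(L) has dimension four\<close>

context
  assumes d4: "dim derived = 4" and dimU: "dim (UNIV :: 'v set) = dim center + 4"
begin

lemma breadth_le_3: "breadth x \<le> 3"
proof (cases "x \<in> center")
  case True
  then show ?thesis using breadth_eq_0_iff[of x] by simp
next
  case False
  have "dim (insert x center) \<le> dim {y. bracket x y = 0}" by (rule dim_subset[OF center_subset_centralizer])
  then show ?thesis using dim_insert_center[OF False] dim_centralizer[of x] dimU by simp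
qed

lemma frame_breadth_le_2:
  assumes "x \<notin> center" "y \<notin> span (insert x center)" "bracket x y = 0"
  shows "breadth x \<le> 2"
proof -
  have "insert y (insert x center) \<subseteq> {y. bracket x y = 0}" using center_subset_centralizer assms(3) by simp
  then have "dim (insert y (insert x center)) \<le> dim {y. bracket x y = 0}" by (rule dim_subset)
  then show ?thesis
    using dim_insert_center[OF assms(1)] assms(2) dim_centralizer[of x] dimU by (simp add: dim_insert)
qed

lemma frame_breadth_le_1:
  assumes "x \<notin> center" "y \<notin> span (insert x center)" "z \<notin> span (insert y (insert x center))"
    and "bracket x y = 0" "bracket x z = 0"
  shows "breadth x \<le> 1"
proof -
  have "insert z (insert y (insert x center)) \<subseteq> {y. bracket x y = 0}"
    using center_subset_centralizer assms(4,5) by simp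
  then have "dim (insert z (insert y (insert x center))) \<le> dim {y. bracket x y = 0}" by (rule dim_subset)
  then show ?thesis
    using dim_insert_center[OF assms(1)] assms(2,3) dim_centralizer[of x] dimU by (simp add: dim_insert)
qed

lemma frame_notin:
  assumes fr: "frame x1 x2 x3 x4"
  shows "x1 \<notin> center" "x2 \<notin> span (insert x1 center)" "x3 \<notin> span (insert x2 (insert x1 center))"
proof -
  have "insert x1 (insert x2 (insert x3 (insert x4 center))) = insert x4 (insert x3 (insert x2 (insert x1 center)))" by auto
  then have "dim (span (insert x4 (insert x3 (insert x2 (insert x1 center))))) = dim (UNIV :: 'v set)"
    using fr unfolding frame_def by simp
  then have d: "dim (insert x4 (insert x3 (insert x2 (insert x1 center)))) = dim center + 4" using dimU by simp
  have le: "dim (insert x S) \<le> dim S + 1" for x S by (simp add: dim_insert)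
  have d3: "dim center + 3 \<le> dim (insert x3 (insert x2 (insert x1 center)))"
    using d le[of x4 "insert x3 (insert x2 (insert x1 center))"] by simp
  then have d2: "dim center + 2 \<le> dim (insert x2 (insert x1 center))"
    using le[of x3 "insert x2 (insert x1 center)"] by simp
  then have d1: "dim center + 1 \<le> dim (insert x1 center)" using le[of x2 "insert x1 center"] by simp
  show "x1 \<notin> center" using d1 by (auto simp: insert_absorb)
  have u1: "dim (insert x1 center) \<le> dim center + 1" by (rule le)
  then have u2: "dim (insert x2 (insert x1 center)) \<le> dim center + 2" using le[of x2 "insert x1 center"] by simp
  show "x2 \<notin> span (insert x1 center)"
  proof
    assume "x2 \<in> span (insert x1 center)"
    then have "dim (insert x2 (insert x1 center)) = dim (insert x1 center)" by (simp only: dim_insert if_True)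
    then show False using d2 u1 by simp
  qed
  show "x3 \<notin> span (insert x2 (insert x1 center))"
  proof
    assume "x3 \<in> span (insert x2 (insert x1 center))"
    then have "dim (insert x3 (insert x2 (insert x1 center))) = dim (insert x2 (insert x1 center))"
      by (simp only: dim_insert if_True)
    then show False using d3 u2 by simp
  qed
qed

text \<open>The centralizer of \<open>x\<close> has codimension one, so it supplies two further
  frame vectors.\<close>

lemma breadth_1_frame:
  assumes "breadth x = 1"
  shows "\<exists>x2 x3 x4. frame x x2 x3 x4 \<and> bracket x x2 = 0 \<and> bracket x x3 = 0"
proof -
  have x: "x \<notin> center" using breadth_eq_0_iff[of x] assms by auto
  have dC: "dim {y. bracket x y = 0} = dim center + 3" using dim_centralizer[of x] assms dimU by simp
  have d1: "dim (insert x center) = dim center + 1" by (rule dim_insert_center[OF x])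
  obtain x2 where x2: "bracket x x2 = 0" "x2 \<notin> span (insert x center)"
    using exists_in_subspace_notin_span[OF subspace_centralizer[of x], of "insert x center"] dC d1 by auto
  then have "dim (insert x2 (insert x center)) = dim center + 2" using d1 by (simp add: dim_insert)
  then obtain x3 where "bracket x x3 = 0" "x3 \<notin> span (insert x2 (insert x center))"
    using exists_in_subspace_notin_span[OF subspace_centralizer[of x], of "insert x2 (insert x center)"] dC by auto
  then show ?thesis using extend_to_frame3[OF dimU x x2(2)] x2(1) by metis
qed

lemma breadth_2_frame:
  assumes "breadth x = 2"
  shows "\<exists>x2 x3 x4. frame x x2 x3 x4 \<and> bracket x x2 = 0"
proof -
  have x: "x \<notin> center" using breadth_eq_0_iff[of x] assms by auto
  have dC: "dim {y. bracket x y = 0} = dim center + 2" using dim_centralizer[of x] assms dimU by simp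
  have d1: "dim (insert x center) = dim center + 1" by (rule dim_insert_center[OF x])
  obtain x2 where "bracket x x2 = 0" "x2 \<notin> span (insert x center)"
    using exists_in_subspace_notin_span[OF subspace_centralizer[of x], of "insert x center"] dC d1 by auto
  then show ?thesis using extend_to_frame[OF dimU x] by metis
qed

lemma set_breadth_type: "set breadth_type = range breadth"
proof -
  have "finite (range breadth)" using finite_UNIV by simp
  then show ?thesis by (simp add: breadth_type_def)
qed

text \<open>Breadths 1, 2 and 3 are attained at \<open>x1\<close>, \<open>x2\<close> and
  \<open>x4\<close>; the lower bounds come from the four brackets that form a basis of L'.\<close>

lemma isotropic_frame_breadth_type:
  assumes fr: "frame x1 x2 x3 x4" and r: "bracket x1 x2 = 0" "bracket x1 x3 = 0"
  shows "breadth_type = [0, 1, 2, 3]"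
proof -
  note ind = isotropic_frame_noncommutator(2)[OF d4 fr r]
  note ni = frame_notin[OF fr]
  have "breadth x1 = 1"
    using frame_breadth_le_1[OF ni r] breadth_eq_0_iff[of x1] ni(1) by linarith
  moreover have "breadth x2 = 2"
  proof -
    have "2 \<le> breadth x2"
    proof (rule breadth_ge_2[of _ x3 x4])
      fix a b assume "a *s bracket x2 x3 + b *s bracket x2 x4 = 0"
      then show "a = 0 \<and> b = 0" using ind[of 0 a b 0] by simp
    qed
    moreover have "breadth x2 \<le> 2"
    proof (rule frame_breadth_le_2)
      have "frame x2 x1 x3 x4" using fr unfolding frame_def by (metis insert_commute)
      from frame_notin(1,2)[OF this] show "x2 \<notin> center" "x1 \<notin> span (insert x2 center)" .
      show "bracket x2 x1 = 0" by (rule bracket_eq_0_sym[OF r(1)])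
    qed
    ultimately show ?thesis by simp
  qed
  moreover have "breadth x4 = 3"
  proof -
    have "3 \<le> breadth x4"
    proof (rule breadth_ge_3[of _ x1 x2 x3])
      fix a b c assume e: "a *s bracket x4 x1 + b *s bracket x4 x2 + c *s bracket x4 x3 = 0"
      have "a *s bracket x1 x4 + b *s bracket x2 x4 + c *s bracket x3 x4
          = - (a *s bracket x4 x1 + b *s bracket x4 x2 + c *s bracket x4 x3)"
        by (simp add: bracket_skew[of x1 x4] bracket_skew[of x2 x4] bracket_skew[of x3 x4])
      then have "a *s bracket x1 x4 + b *s bracket x2 x4 + c *s bracket x3 x4 = 0" unfolding e by simp
      then show "a = 0 \<and> b = 0 \<and> c = 0" using ind[of a 0 b c] by simp
    qed
    then show ?thesis using breadth_le_3[of x4] by simp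
  qed
  moreover have "breadth 0 = 0" using breadth_eq_0_iff subspace_0[OF subspace_center] by simp
  ultimately have "{0, 1, 2, 3} \<subseteq> range breadth" by (metis empty_subsetI insert_subset rangeI)
  moreover have "range breadth \<subseteq> {0, 1, 2, 3}"
  proof
    fix b assume "b \<in> range breadth"
    then obtain x where "b = breadth x" by auto
    then have "b \<le> 3" using breadth_le_3 by simp
    then show "b \<in> {0, 1, 2, 3}" by auto
  qed
  ultimately have "{0, 1, 2, 3} = range breadth" by (rule subset_antisym)
  from this[symmetric] show ?thesis by (simp add: breadth_type_def)
qed

text \<open>\<open>x1\<close> commutes with \<open>x2\<close>, so its breadth is at most 2, and it
  is 2 once breadth 1 is excluded. \<open>x3\<close> attains 3 because its brackets with the other
  frame vectors are independent.\<close>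

lemma parabolic_frame_breadth_type:
  assumes fr: "frame x1 x2 x3 x4" and r: "bracket x1 x2 = 0" "bracket x1 x3 + bracket x2 x4 = 0"
    and no1: "\<And>x. breadth x \<noteq> 1"
  shows "breadth_type = [0, 2, 3]"
proof -
  note ind = parabolic_frame_noncommutator(2)[OF d4 fr r]
  note ni = frame_notin[OF fr]
  have "breadth x1 = 2"
    using frame_breadth_le_2[OF ni(1,2) r(1)] breadth_eq_0_iff[of x1] ni(1) no1[of x1] by linarith
  moreover have "breadth x3 = 3"
  proof -
    have "3 \<le> breadth x3"
    proof (rule breadth_ge_3[of _ x1 x2 x4])
      fix a b c assume "a *s bracket x3 x1 + b *s bracket x3 x2 + c *s bracket x3 x4 = 0"
      then have "(- a) *s bracket x1 x3 + (- b) *s bracket x2 x3 + c *s bracket x3 x4 = 0"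
        by (simp add: bracket_skew[of x1 x3] bracket_skew[of x2 x3])
      then show "a = 0 \<and> b = 0 \<and> c = 0" using ind[of "- a" 0 "- b" c] by simp
    qed
    then show ?thesis using breadth_le_3[of x3] by simp
  qed
  moreover have "breadth 0 = 0" using breadth_eq_0_iff subspace_0[OF subspace_center] by simp
  ultimately have "{0, 2, 3} \<subseteq> range breadth" by (metis empty_subsetI insert_subset rangeI)
  moreover have "range breadth \<subseteq> {0, 2, 3}"
  proof
    fix b assume "b \<in> range breadth"
    then obtain x where "b = breadth x" by auto
    then have "b \<le> 3" "b \<noteq> 1" using breadth_le_3 no1 by simp_all
    then show "b \<in> {0, 2, 3}" by auto
  qed
  ultimately have "{0, 2, 3} = range breadth" by (rule subset_antisym)
  from this[symmetric] show ?thesis by (simp add: breadth_type_def)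
qed

text \<open>When brackets are central, any subspace containing Z(L) is closed under them.\<close>

lemma generating_set_frame:
  assumes "derived \<subseteq> center" "generating_set {u1, u2, u3, u4}"
  shows "frame u1 u2 u3 u4"
proof -
  let ?S = "span (insert u1 (insert u2 (insert u3 (insert u4 center))))"
  have cS: "center \<subseteq> ?S" by (auto intro: span_base)
  have "subalgebra ?S"
    unfolding subalgebra_def using assms(1) bracket_in_derived cS by (auto simp: subset_eq)
  moreover have "{u1, u2, u3, u4} \<subseteq> ?S" by (auto intro: span_base)
  ultimately have "subalgebra hull {u1, u2, u3, u4} \<subseteq> ?S" by (intro hull_minimal)
  then show ?thesis using assms(2) by (auto simp: frame_def generating_set_def)
qed

text \<open>The brackets of a frame span L', which contains Z(L); so the generated subalgebra is
  everything.\<close>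

lemma frame_generating_set:
  assumes cd: "center \<subseteq> derived" and fr: "frame u1 u2 u3 u4"
  shows "generating_set {u1, u2, u3, u4}"
proof -
  have "T = UNIV" if T: "subalgebra T" "{u1, u2, u3, u4} \<subseteq> T" for T
  proof -
    have sT: "subspace T" and br: "\<And>x y. x \<in> T \<Longrightarrow> y \<in> T \<Longrightarrow> bracket x y \<in> T"
      using T(1) by (auto simp: subalgebra_def)
    have u: "u1 \<in> T" "u2 \<in> T" "u3 \<in> T" "u4 \<in> T" using T(2) by auto
    have "derived \<subseteq> T"
    proof
      fix v assume "v \<in> derived"
      then obtain p12 p13 p14 p23 p24 p34 where v: "v = wedge u1 u2 u3 u4 (p12, p13, p14, p23, p24, p34)"
        by (rule derived_wedge[OF fr])
      show "v \<in> T" unfolding v wedge_def prod.case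
        by (intro subspace_add[OF sT] subspace_scale[OF sT] br u)
    qed
    then have "insert u1 (insert u2 (insert u3 (insert u4 center))) \<subseteq> T" using cd u by auto
    then have "span (insert u1 (insert u2 (insert u3 (insert u4 center)))) \<subseteq> T" by (rule span_minimal[OF _ sT])
    then show ?thesis using fr by (auto simp: frame_def)
  qed
  then show ?thesis unfolding generating_set_def hull_def by auto
qed

text \<open>The type of K is visible in L: a vector of breadth 1 means that K is totally isotropic,
  one of breadth 2 gives a nonzero isotropic element of K, and a generating set of two commuting
  pairs means that K is hyperbolic.\<close>

lemma step_2_classification:
  assumes cd: "center = derived"
  shows "commutators \<noteq> derived \<longleftrightarrow>
    breadth_type = [0, 1, 3] \<or> breadth_type = [0, 1, 2, 3]
      \<or> (breadth_type = [0, 2, 3] \<and> \<not> (\<exists>u1 u2 u3 u4. generating_set {u1, u2, u3, u4}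
          \<and> bracket u1 u2 = 0 \<and> bracket u3 u4 = 0))" (is "_ \<longleftrightarrow> ?R")
proof
  assume ne: "commutators \<noteq> derived"
  show ?R
  proof (cases "\<exists>x. breadth x = 1")
    case True
    then obtain x x2 x3 x4 where "frame x x2 x3 x4" "bracket x x2 = 0" "bracket x x3 = 0"
      using breadth_1_frame by metis
    then show ?thesis using isotropic_frame_breadth_type by simp
  next
    case False
    obtain x1 x2 x3 x4 where dg: "degenerate_frame x1 x2 x3 x4"
      using commutators_neq_derived_iff[OF d4 dimU] ne by metis
    then have fr: "frame x1 x2 x3 x4" and x12: "bracket x1 x2 = 0" by (simp_all add: degenerate_frame_def)
    have "bracket x1 x3 \<noteq> 0"
    proof
      assume "bracket x1 x3 = 0"
      then have "breadth_type = [0, 1, 2, 3]" using isotropic_frame_breadth_type[OF fr x12] by simp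
      then have "1 \<in> set breadth_type" by simp
      then have "1 \<in> range breadth" unfolding set_breadth_type .
      then show False using False by (metis rangeE)
    qed
    then have "bracket x1 x3 + bracket x2 x4 = 0" using dg by (simp add: degenerate_frame_def)
    then have "breadth_type = [0, 2, 3]" using parabolic_frame_breadth_type[OF fr x12] False by metis
    moreover have "\<not> (\<exists>u1 u2 u3 u4. generating_set {u1, u2, u3, u4} \<and> bracket u1 u2 = 0 \<and> bracket u3 u4 = 0)"
      using generating_set_frame[OF equalityD2[OF cd]] hyperbolic_frame_commutators ne by metis
    ultimately show ?thesis by simp
  qed
next
  assume R: ?R
  show "commutators \<noteq> derived"
  proof (cases "1 \<in> range breadth")
    case True
    then obtain x x2 x3 x4 where "frame x x2 x3 x4" "bracket x x2 = 0" "bracket x x3 = 0"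
      using breadth_1_frame by (metis rangeE)
    then show ?thesis using isotropic_frame_noncommutator(1)[OF d4] by metis
  next
    case False
    then have no1: "1 \<notin> set breadth_type" by (simp only: set_breadth_type not_False_eq_True)
    have bt: "breadth_type = [0, 2, 3]"
      and gen: "\<not> (\<exists>u1 u2 u3 u4. generating_set {u1, u2, u3, u4} \<and> bracket u1 u2 = 0 \<and> bracket u3 u4 = 0)"
      using R no1 by auto
    have "2 \<in> range breadth" unfolding set_breadth_type[symmetric] bt by simp
    then obtain x x2 x3 x4 where fr: "frame x x2 x3 x4" and x: "bracket x x2 = 0"
      using breadth_2_frame by (metis rangeE)
    have "\<not> (\<exists>y3 y4. frame x x2 y3 y4 \<and> bracket y3 y4 = 0)"
      using frame_generating_set[OF equalityD1[OF cd]] gen x by metis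
    then have "\<exists>y1 y2 y3 y4. degenerate_frame y1 y2 y3 y4" using commuting_frame_cases[OF d4 fr x] by blast
    then show ?thesis using commutators_neq_derived_iff[OF d4 dimU] by simp
  qed
qed

end

text \<open>From dim L \<ge> 6, dim Z(L) \<le> dim L' = 4 and dim L = dim Z(L) + 4 only dim Z(L) =
  2, 3, 4 remain. For 2 and 3 a degenerate frame always exists; for 4 the center equals L' and the
  breadths decide.\<close>

theorem classification:
  assumes nil: "nilpotent" and cd: "center \<subseteq> derived" and d4: "dim derived = 4"
  shows "commutators \<noteq> derived \<longleftrightarrow>
      (step_nilpotent 4 \<and> dim (UNIV :: 'v set) = 6 \<and> dim center = 2)
    \<or> (step_nilpotent 3 \<and> dim (UNIV :: 'v set) = 7 \<and> dim center = 3)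
    \<or> (step_nilpotent 2 \<and> dim (UNIV :: 'v set) = 8
        \<and> (breadth_type = [0, 1, 3] \<or> breadth_type = [0, 1, 2, 3]
          \<or> (breadth_type = [0, 2, 3] \<and> \<not> (\<exists>u1 u2 u3 u4. generating_set {u1, u2, u3, u4}
              \<and> bracket u1 u2 = 0 \<and> bracket u3 u4 = 0))))"
    (is "_ \<longleftrightarrow> ?A \<or> ?B \<or> (_ \<and> _ \<and> ?C)")
proof
  assume ne: "commutators \<noteq> derived"
  have dimU: "dim (UNIV :: 'v set) = dim center + 4"
    using commutators_eq_derived[OF d4] four_le_codim_center[OF d4] ne by force
  have "dim center \<le> 4" using dim_subset[OF cd] d4 by simp
  then consider "dim center = 2" | "dim center = 3" | "dim center = 4"
    using two_generators_needed[OF nil d4] dimU by linarith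
  then show "?A \<or> ?B \<or> (step_nilpotent 2 \<and> dim (UNIV :: 'v set) = 8 \<and> ?C)"
  proof cases
    case 1
    then show ?thesis using center_dim_2(1)[OF nil d4 cd dimU] dimU by simp
  next
    case 2
    then show ?thesis using center_dim_3(1)[OF nil d4 cd dimU] dimU by simp
  next
    case 3
    have eq: "center = derived"
      using cd d4 3 by (intro subspace_dim_equal subspace_center subspace_derived) auto
    have "lower_central (Suc (Suc 0)) \<subseteq> {0}"
      unfolding lower_central.simps(2)[of "Suc 0"] lower_central_1 eq[symmetric]
      by (rule bracket_space_minimal[OF subspace_single_0]) (simp add: centerD)
    then have "lower_central 2 = {0}"
      using subspace_0[OF subspace_lower_central[of 2]] by (auto simp: numeral_2_eq_2)
    moreover have "lower_central (2 - 1) \<noteq> {0}"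
    proof
      assume "lower_central (2 - 1) = {0}"
      then have "derived = {0}" by (simp add: derived_def)
      then show False using d4 by simp
    qed
    ultimately have "step_nilpotent 2" by (simp add: step_nilpotent_def)
    moreover have ?C using step_2_classification[OF d4 dimU eq] ne by metis
    ultimately show ?thesis using dimU 3 by simp
  qed
next
  assume R: "?A \<or> ?B \<or> (step_nilpotent 2 \<and> dim (UNIV :: 'v set) = 8 \<and> ?C)"
  then consider (a) ?A | (b) ?B | (c) "step_nilpotent 2" "dim (UNIV :: 'v set) = 8" ?C by metis
  then show "commutators \<noteq> derived"
  proof cases
    case a
    then have dimU: "dim (UNIV :: 'v set) = dim center + 4" and z: "dim center = 2" by simp_all
    show ?thesis using center_dim_2(2)[OF nil d4 cd dimU z] commutators_neq_derived_iff[OF d4 dimU] by simp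
  next
    case b
    then have dimU: "dim (UNIV :: 'v set) = dim center + 4" and z: "dim center = 3" by simp_all
    show ?thesis using center_dim_3(2)[OF nil d4 cd dimU z] commutators_neq_derived_iff[OF d4 dimU] by simp
  next
    case c
    have "derived \<subseteq> center"
    proof
      fix v assume "v \<in> derived"
      then have "bracket x v \<in> lower_central (Suc (Suc 0))" for x
        by (intro bracket_lower_central) (simp only: lower_central_1)
      moreover have "lower_central (Suc (Suc 0)) = {0}"
        using c(1) unfolding step_nilpotent_def numeral_2_eq_2 by (elim conjE)
      ultimately have "bracket x v = 0" for x by blast
      then have "bracket v x = 0" for x by (rule bracket_eq_0_sym)
      then show "v \<in> center" by (simp add: center_def)
    qed
    then have eq: "center = derived" using cd by simp
    then have dimU: "dim (UNIV :: 'v set) = dim center + 4" using c(2) d4 by simp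
    show ?thesis using step_2_classification[OF d4 dimU eq] c(3) by metis
  qed
qed

theorem two_commutators_suffice:
  assumes d4: "dim derived = 4" and ne: "commutators \<noteq> derived" and z: "z \<in> derived"
  shows "\<exists>xs. length xs \<le> 2 \<and> set xs \<subseteq> commutators \<and> z = sum_list xs"
proof -
  have "dim (UNIV :: 'v set) = dim center + 4"
    using commutators_eq_derived[OF d4] four_le_codim_center[OF d4] ne by force
  then obtain x1 x2 x3 x4 where "frame x1 x2 x3 x4" using exists_frame by metis
  then obtain u u' where "u \<in> commutators" "u' \<in> commutators" "z = u + u'"
    using z by (rule derived_sum_two_commutators)
  then show ?thesis by (intro exI[where x = "[u, u']"]) simp
qed

text \<open>The scalar is absorbed into the first argument of the bracket.\<close>

lemma poly_image_commutators:
  assumes "multilinear_lie_poly2 w"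
  shows "poly_image w = commutators"
proof -
  obtain c where c: "c \<noteq> 0" "\<And>x y. w x y = c *s bracket x y" using assms by (auto simp: multilinear_lie_poly2_def)
  have "w x y = bracket (c *s x) y" "bracket x y = w (inverse c *s x) y" for x y
    using c by (simp_all add: bracket_scale_left)
  then show ?thesis unfolding poly_image_def commutators_def by (intro Collect_cong) metis
qed

end

theorem theorem2:
  fixes scale :: "'k::{field,finite} \<Rightarrow> 'v::ab_group_add \<Rightarrow> 'v"
    and bracket :: "'v \<Rightarrow> 'v \<Rightarrow> 'v"
    and w :: "'v \<Rightarrow> 'v \<Rightarrow> 'v"
  assumes "odd CHAR('k)"
    and "lie_algebra scale bracket"
    and "\<exists>Basis. finite_dimensional_vector_space scale Basis"
    and "lie_algebra.nilpotent scale bracket"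
    and "lie_algebra.center bracket \<subseteq> lie_algebra.derived scale bracket"
    and "vector_space.dim scale (lie_algebra.derived scale bracket) = 4"
    and "lie_algebra.multilinear_lie_poly2 scale bracket w"
  shows "(poly_image w \<noteq> lie_algebra.derived scale bracket \<longleftrightarrow>
      (lie_algebra.step_nilpotent scale bracket 4
        \<and> vector_space.dim scale (UNIV :: 'v set) = 6
        \<and> vector_space.dim scale (lie_algebra.center bracket) = 2)
    \<or> (lie_algebra.step_nilpotent scale bracket 3
        \<and> vector_space.dim scale (UNIV :: 'v set) = 7
        \<and> vector_space.dim scale (lie_algebra.center bracket) = 3)
    \<or> (lie_algebra.step_nilpotent scale bracket 2
        \<and> vector_space.dim scale (UNIV :: 'v set) = 8
        \<and> (lie_algebra.breadth_type scale bracket = [0, 1, 3]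
          \<or> lie_algebra.breadth_type scale bracket = [0, 1, 2, 3]
          \<or> (lie_algebra.breadth_type scale bracket = [0, 2, 3]
            \<and> \<not> (\<exists>u1 u2 u3 u4. lie_algebra.generating_set scale bracket {u1, u2, u3, u4}
                  \<and> bracket u1 u2 = 0 \<and> bracket u3 u4 = 0)))))
    \<and> (poly_image w \<noteq> lie_algebra.derived scale bracket \<longrightarrow>
        (\<forall>z \<in> lie_algebra.derived scale bracket.
          \<exists>xs. length xs \<le> 2 \<and> set xs \<subseteq> poly_image w \<and> z = sum_list xs))"
proof -
  obtain Basis where B: "finite_dimensional_vector_space scale Basis" using assms(3) by auto
  have "(2 :: 'k) \<noteq> 0"
  proof
    assume "(2 :: 'k) = 0"
    then have "of_nat 2 = (0 :: 'k)" by simp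
    then have "CHAR('k) dvd 2" by (simp only: of_nat_eq_0_iff_char_dvd)
    then have "CHAR('k) \<le> 2" by (rule dvd_imp_le) simp
    \<comment> \<open>Being odd rules out 0 and 2, and no field has characteristic 1.\<close>
    then have "CHAR('k) = 1" using assms(1) by (auto simp: le_Suc_eq numeral_2_eq_2)
    then show False by simp
  qed
  then interpret finite_lie_algebra scale bracket Basis
    using B assms(2) by (simp add: finite_lie_algebra_def finite_lie_algebra_axioms_def)
  note w = poly_image_commutators[OF assms(7)]
  show ?thesis
    unfolding w
    using classification[OF assms(4,5,6)] two_commutators_suffice[OF assms(6)] by blast
qed

end
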